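(* Let $p$ be a prime and let $q$ be an odd prime that divides $p-1$. Then there exists a finite solvable group $G$ with $\mathrm{dl}(G)=4$, Fitting height $3$, and $$\mathrm{cd}(G)=\{1,\ q,\ (p^q-1)_{q'}(p-1)_q\,q,\ p^q q\}.$$
   Context: $\mathrm{cd}(G)$ is the set of degrees of irreducible complex characters of $G$, and $\mathrm{dl}(G)$ is the derived length of $G$. For a positive integer $N$ and a prime $q$, $N_q$ denotes the largest power of $q$ dividing $N$, and $N_{q'}=N/N_q$. *)

theory Defs
  imports "HOL-Algebra.Solvable_Groups" "HOL-Algebra.Coset"
    "HOL-Computational_Algebra.Primes" "Jordan_Normal_Form.Matrix"
begin

definition ppart :: "nat \<Rightarrow> nat \<Rightarrow> nat" where
  "ppart q N = q ^ multiplicity q N"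

definition pprime_part :: "nat \<Rightarrow> nat \<Rightarrow> nat" where
  "pprime_part q N = N div ppart q N"

definition derived_length :: "('a, 'b) monoid_scheme \<Rightarrow> nat" where
  "derived_length G = (LEAST n. (derived G ^^ n) (carrier G) = {\<one>\<^bsub>G\<^esub>})"

definition comm_set :: "('a, 'b) monoid_scheme \<Rightarrow> 'a set \<Rightarrow> 'a set \<Rightarrow> 'a set" where
  "comm_set G A B = {a \<otimes>\<^bsub>G\<^esub> b \<otimes>\<^bsub>G\<^esub> inv\<^bsub>G\<^esub> a \<otimes>\<^bsub>G\<^esub> inv\<^bsub>G\<^esub> b | a b. a \<in> A \<and> b \<in> B}"

fun lower_central :: "('a, 'b) monoid_scheme \<Rightarrow> nat \<Rightarrow> 'a set" where
  "lower_central G 0 = carrier G"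
| "lower_central G (Suc n) = generate G (comm_set G (lower_central G n) (carrier G))"

definition nilpotent_group :: "('a, 'b) monoid_scheme \<Rightarrow> bool" where
  "nilpotent_group G \<longleftrightarrow> group G \<and> (\<exists>n. lower_central G n = {\<one>\<^bsub>G\<^esub>})"

definition fitting_height :: "('a, 'b) monoid_scheme \<Rightarrow> nat" where
  "fitting_height G = (LEAST h. \<exists>N :: nat \<Rightarrow> 'a set.
      N 0 = {\<one>\<^bsub>G\<^esub>} \<and> N h = carrier G \<and>
      (\<forall>i\<le>h. N i \<lhd> G) \<and>
      (\<forall>i<h. N i \<subseteq> N (Suc i) \<and>
             nilpotent_group ((G\<lparr>carrier := N (Suc i)\<rparr>) Mod (N i))))"

definition is_rep :: "('a, 'b) monoid_scheme \<Rightarrow> nat \<Rightarrow> ('a \<Rightarrow> complex mat) \<Rightarrow> bool" where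
  "is_rep G n \<rho> \<longleftrightarrow>
     (\<forall>g\<in>carrier G. \<rho> g \<in> carrier_mat n n) \<and>
     \<rho> \<one>\<^bsub>G\<^esub> = 1\<^sub>m n \<and>
     (\<forall>g\<in>carrier G. \<forall>h\<in>carrier G. \<rho> (g \<otimes>\<^bsub>G\<^esub> h) = \<rho> g * \<rho> h)"

definition is_subspace :: "nat \<Rightarrow> complex vec set \<Rightarrow> bool" where
  "is_subspace n W \<longleftrightarrow> W \<subseteq> carrier_vec n \<and> 0\<^sub>v n \<in> W \<and>
     (\<forall>v\<in>W. \<forall>w\<in>W. v + w \<in> W) \<and> (\<forall>c. \<forall>v\<in>W. c \<cdot>\<^sub>v v \<in> W)"

definition irreducible_rep :: "('a, 'b) monoid_scheme \<Rightarrow> nat \<Rightarrow> ('a \<Rightarrow> complex mat) \<Rightarrow> bool" where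
  "irreducible_rep G n \<rho> \<longleftrightarrow> is_rep G n \<rho> \<and> n > 0 \<and>
     (\<forall>W. is_subspace n W \<and> (\<forall>g\<in>carrier G. \<forall>w\<in>W. \<rho> g *\<^sub>v w \<in> W)
          \<longrightarrow> W = {0\<^sub>v n} \<or> W = carrier_vec n)"

text \<open>cd(G): degrees chi(1) of the irreducible complex characters, i.e. the
  dimensions of the irreducible complex representations.\<close>
definition char_degrees :: "('a, 'b) monoid_scheme \<Rightarrow> nat set" where
  "char_degrees G = {n. \<exists>\<rho>. irreducible_rep G n \<rho>}"

end

theory Submission
  imports Defs "HOL-Algebra.Multiplicative_Group" "HOL-Algebra.QuotRing"
    "HOL-Number_Theory.Number_Theory" "HOL-Computational_Algebra.Polynomial"
begin

text \<open>
  Let \<open>K\<close> be the field with \<open>p\<^sup>q\<close> elements. Since \<open>q\<close> divides \<open>p - 1\<close>, the nonzero elements of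
  \<open>K\<close> form a nonabelian Dickson nearfield group \<open>H\<close>, of order \<open>p\<^sup>q - 1\<close>, with an abelian normal
  subgroup \<open>C\<close> of index \<open>q\<close>; it acts without fixed points on \<open>K\<close> and, twisted by the linear
  character \<open>H/C \<rightarrow> F\<^sub>p\<^sup>*\<close>, on the dual of \<open>K\<close>. So \<open>H\<close> acts on the extraspecial group \<open>P\<close> of order
  \<open>p\<^sup>2\<^sup>q\<^sup>+\<^sup>1\<close> on \<open>K \<times> K\<^sup>* \<times> F\<^sub>p\<close>, with \<open>C\<close> centralizing the centre \<open>Z\<close> of \<open>P\<close>, and \<open>G\<close> is the semidirect
  product of \<open>P\<close> and \<open>H\<close>. Every irreducible representation is induced from a linear character
  \<open>\<chi>\<close> of a subgroup \<open>S\<close> which is the stabilizer of the restriction of \<open>\<chi>\<close> to a normal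
  subgroup of \<open>G\<close>: with \<open>S = (K\<^sup>* \<times> Z) C\<close> (degree \<open>p\<^sup>q q\<close>) if \<open>Z\<close> acts nontrivially, \<open>S = P\<close> (degree
  \<open>p\<^sup>q - 1\<close>) if \<open>Z\<close> but not \<open>P\<close> is in the kernel, and \<open>S = P C\<close> or \<open>S = G\<close> (degrees \<open>q\<close> and \<open>1\<close>)
  otherwise. The third degree of the theorem equals \<open>p\<^sup>q - 1\<close>, because \<open>(p\<^sup>q - 1)\<^sub>q = q (p - 1)\<^sub>q\<close>.
\<close>

section \<open>Derived length and Fitting height\<close>

text \<open>The twist on the dual copy of \<open>K\<close> removes an unwanted degree. Untwisted,
  the pairing would be invariant under \<open>H\<close>, \<open>Z\<close> would be central in
  \<open>G\<close>, and the degrees over a nontrivial character of \<open>Z\<close> would be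
  \<open>p^q\<close> times those of \<open>H\<close>, including \<open>p^q\<close> itself. The twist
  shrinks the stabilizer of such a character to \<open>P C\<close> with \<open>C\<close> abelian.
  Freeness on the dual copy survives because \<open>q^2\<close> divides \<open>p^q - 1\<close>,
  which makes the twist invisible to discrete logarithms modulo \<open>q\<close>. Oddness of
  \<open>q\<close> enters through \<open>(p^q - 1) / (p - 1)\<close> being divisible by
  \<open>q\<close> exactly once. Besides the third degree this yields a prime divisor of
  \<open>p^q - 1\<close> dividing neither \<open>q\<close> nor \<open>p - 1\<close>; it makes
  \<open>H\<close> non-nilpotent and so forces Fitting height 3. Since the prime field contains the
  \<open>q\<close>-th roots of unity, \<open>K\<close> is obtained as a Kummer extension by a root
  of \<open>X^q - a\<close>.\<close>

lemma lower_central_subgroup: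
  assumes "group X" shows "subgroup (lower_central X n) X"
proof (cases n)
  case 0
  then show ?thesis using assms by (simp add: group.subgroup_self)
next
  case (Suc m)
  interpret group X by fact
  have *: "lower_central X m \<subseteq> carrier X"
  proof (induction m)
    case (Suc m)
    then have "comm_set X (lower_central X m) (carrier X) \<subseteq> carrier X"
      by (auto simp: comm_set_def subset_iff)
    then show ?case using generate_in_carrier by auto
  qed simp
  have "comm_set X (lower_central X m) (carrier X) \<subseteq> carrier X"
    using * by (auto simp: comm_set_def subset_iff)
  then show ?thesis using Suc generate_is_subgroup by simp
qed

lemma lower_central_hom_image:
  assumes "group X" "group Y" "h \<in> hom X Y" "h ` carrier X = carrier Y"
  shows "lower_central Y n = h ` lower_central X n"
proof -
  interpret group_hom X Y h
    using assms by (simp add: group_hom_def group_hom_axioms_def)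
  show ?thesis
  proof (induction n)
    case 0
    show ?case using assms(4) by simp
  next
    case (Suc n)
    have sub: "lower_central X n \<subseteq> carrier X"
      using lower_central_subgroup[OF assms(1)] by (rule subgroup.subset)
    then have 1: "comm_set X (lower_central X n) (carrier X) \<subseteq> carrier X"
      by (auto simp: comm_set_def)
    have hc: "h (a \<otimes>\<^bsub>X\<^esub> b \<otimes>\<^bsub>X\<^esub> inv\<^bsub>X\<^esub> a \<otimes>\<^bsub>X\<^esub> inv\<^bsub>X\<^esub> b)
        = h a \<otimes>\<^bsub>Y\<^esub> h b \<otimes>\<^bsub>Y\<^esub> inv\<^bsub>Y\<^esub> h a \<otimes>\<^bsub>Y\<^esub> inv\<^bsub>Y\<^esub> h b"
      if "a \<in> lower_central X n" "b \<in> carrier X" for a b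
      using that sub by (auto simp: subset_iff)
    have "comm_set Y (lower_central Y n) (carrier Y) = h ` comm_set X (lower_central X n) (carrier X)"
    proof (intro equalityI subsetI)
      fix y assume "y \<in> comm_set Y (lower_central Y n) (carrier Y)"
      then obtain a b where ab: "a \<in> lower_central X n" "b \<in> carrier X"
        and "y = h a \<otimes>\<^bsub>Y\<^esub> h b \<otimes>\<^bsub>Y\<^esub> inv\<^bsub>Y\<^esub> h a \<otimes>\<^bsub>Y\<^esub> inv\<^bsub>Y\<^esub> h b"
        unfolding comm_set_def Suc assms(4)[symmetric] by blast
      then have "y = h (a \<otimes>\<^bsub>X\<^esub> b \<otimes>\<^bsub>X\<^esub> inv\<^bsub>X\<^esub> a \<otimes>\<^bsub>X\<^esub> inv\<^bsub>X\<^esub> b)"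
        using hc by simp
      moreover have "a \<otimes>\<^bsub>X\<^esub> b \<otimes>\<^bsub>X\<^esub> inv\<^bsub>X\<^esub> a \<otimes>\<^bsub>X\<^esub> inv\<^bsub>X\<^esub> b
          \<in> comm_set X (lower_central X n) (carrier X)"
        unfolding comm_set_def using ab by auto
      ultimately show "y \<in> h ` comm_set X (lower_central X n) (carrier X)" by simp
    next
      fix y assume "y \<in> h ` comm_set X (lower_central X n) (carrier X)"
      then obtain a b where ab: "a \<in> lower_central X n" "b \<in> carrier X"
        and y: "y = h (a \<otimes>\<^bsub>X\<^esub> b \<otimes>\<^bsub>X\<^esub> inv\<^bsub>X\<^esub> a \<otimes>\<^bsub>X\<^esub> inv\<^bsub>X\<^esub> b)"
        unfolding comm_set_def by blast
      have "h a \<in> h ` lower_central X n" "h b \<in> h ` carrier X" using ab by simp_all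
      then show "y \<in> comm_set Y (lower_central Y n) (carrier Y)"
        unfolding comm_set_def Suc assms(4)[symmetric] y hc[OF ab] by auto
    qed
    then show ?case using generate_img[OF 1] by simp
  qed
qed

lemma image_eq_singleton_iff: "S \<noteq> {} \<Longrightarrow> f ` S = {y} \<longleftrightarrow> (\<forall>x\<in>S. f x = y)"
  by (metis image_is_empty image_subset_iff insertI1 singletonD subset_singletonD image_constant_conv image_cong)

text \<open>The lower central series of a quotient is the image of that of \<open>X\<close>, so
  nilpotency of a quotient becomes an inclusion of subgroups of \<open>X\<close>. The Fitting height
  is computed in this form, without handling cosets.\<close>

lemma nilpotent_group_Mod_iff:
  assumes "group X" "N \<lhd> X"
  shows "nilpotent_group (X Mod N) \<longleftrightarrow> (\<exists>n. lower_central X n \<subseteq> N)"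
proof -
  interpret normal N X by fact
  have im: "lower_central (X Mod N) n = (\<lambda>a. N #>\<^bsub>X\<^esub> a) ` lower_central X n" for n
    by (rule lower_central_hom_image[OF assms(1) factorgroup_is_group r_coset_hom_Mod])
       (simp add: carrier_FactGroup)
  have eq: "lower_central (X Mod N) n = {N} \<longleftrightarrow> lower_central X n \<subseteq> N" for n
  proof -
    have sg: "subgroup (lower_central X n) X" 
      by (rule lower_central_subgroup) fact
    have ne: "lower_central X n \<noteq> {}" using subgroup.one_closed[OF sg] by blast
    have "N #>\<^bsub>X\<^esub> a = N \<longleftrightarrow> a \<in> N" if "a \<in> lower_central X n" for a
      using that subgroup.subset[OF sg]
      by (metis coset_join1 coset_join2 is_subgroup subgroup.mem_carrier sg)
    moreover have "lower_central (X Mod N) n = {N}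
        \<longleftrightarrow> (\<forall>a\<in>lower_central X n. N #>\<^bsub>X\<^esub> a = N)"
      unfolding im by (rule image_eq_singleton_iff) (rule ne)
    ultimately show ?thesis by (simp add: subset_eq)
  qed
  show ?thesis unfolding nilpotent_group_def using eq factorgroup_is_group by simp
qed

text \<open>The equation \<open>x y = c y x\<close> is the inverse-free form of
  \<open>c = [x, y]\<close>. Commutators are passed around in this form because products in the
  concrete group expand easily while inverses do not.\<close>

lemma (in group) commutator_eqI:
  assumes "x \<in> carrier G" "y \<in> carrier G" "c \<in> carrier G" "x \<otimes> y = c \<otimes> y \<otimes> x"
  shows "x \<otimes> y \<otimes> inv x \<otimes> inv y = c"
proof -
  have "x \<otimes> y \<otimes> inv x \<otimes> inv y = c \<otimes> y \<otimes> (x \<otimes> inv x) \<otimes> inv y"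
    using assms by (simp add: m_assoc del: r_inv)
  then show ?thesis using assms by (simp add: m_assoc)
qed

lemma (in group) mem_derived:
  assumes "x \<in> H" "y \<in> H" "H \<subseteq> carrier G" "c \<in> carrier G" "x \<otimes> y = c \<otimes> y \<otimes> x"
  shows "c \<in> derived G H"
proof -
  have "x \<otimes> y \<otimes> inv x \<otimes> inv y \<in> derived_set G H" using assms by blast
  moreover have "x \<otimes> y \<otimes> inv x \<otimes> inv y = c" using assms by (intro commutator_eqI) auto
  ultimately show ?thesis unfolding derived_def by (simp add: generate.incl)
qed

lemma (in group) derived_subset:
  assumes "H \<subseteq> carrier G" "subgroup L G"
    and "\<And>x y. x \<in> H \<Longrightarrow> y \<in> H \<Longrightarrow> \<exists>c\<in>L. x \<otimes> y = c \<otimes> y \<otimes> x"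
  shows "derived G H \<subseteq> L"
proof -
  have "x \<otimes> y \<otimes> inv x \<otimes> inv y \<in> L" if "x \<in> H" "y \<in> H" for x y
  proof -
    obtain c where c: "c \<in> L" "x \<otimes> y = c \<otimes> y \<otimes> x" using assms(3) \<open>x \<in> H\<close> \<open>y \<in> H\<close> by blast
    then have "x \<otimes> y \<otimes> inv x \<otimes> inv y = c"
      using that assms(1) subgroup.mem_carrier[OF assms(2)] by (intro commutator_eqI) auto
    then show ?thesis using c by simp
  qed
  then have "derived_set G H \<subseteq> L" by blast
  then show ?thesis unfolding derived_def by (rule generate_subgroup_incl) fact
qed

lemma (in group) lower_central_Suc_subset:
  assumes "group (G\<lparr>carrier := H\<rparr>)" "subgroup H G" "subgroup L G"
    and "\<And>x y. x \<in> lower_central (G\<lparr>carrier := H\<rparr>) n \<Longrightarrow> y \<in> H \<Longrightarrow> \<exists>c\<in>L. x \<otimes> y = c \<otimes> y \<otimes> x"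
  shows "lower_central (G\<lparr>carrier := H\<rparr>) (Suc n) \<subseteq> L"
proof -
  let ?X = "G\<lparr>carrier := H\<rparr>"
  have HG: "H \<subseteq> carrier G" using assms(2) by (rule subgroup.subset)
  have lc: "lower_central ?X n \<subseteq> H" 
    using subgroup.subset[OF lower_central_subgroup[OF assms(1)]] by simp
  have "comm_set ?X (lower_central ?X n) (carrier ?X) \<subseteq> L \<inter> H"
  proof
    fix w assume "w \<in> comm_set ?X (lower_central ?X n) (carrier ?X)"
    then obtain x y where xy: "x \<in> lower_central ?X n" "y \<in> H"
      "w = x \<otimes> y \<otimes> inv\<^bsub>?X\<^esub> x \<otimes> inv\<^bsub>?X\<^esub> y" by (auto simp: comm_set_def)
    then have xH: "x \<in> H" using lc by auto
    have w: "w = x \<otimes> y \<otimes> inv x \<otimes> inv y"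
      using xy xH m_inv_consistent[OF assms(2)] by simp
    obtain c where c: "c \<in> L" "x \<otimes> y = c \<otimes> y \<otimes> x" using assms(4) xy by blast
    have "x \<otimes> y \<otimes> inv x \<otimes> inv y = c"
      by (rule commutator_eqI) (use xH xy HG c subgroup.mem_carrier[OF assms(3)] in auto)
    moreover have "w \<in> H" unfolding w using xH xy subgroupE[OF assms(2)] by auto
    ultimately show "w \<in> L \<inter> H" using c w by auto
  qed
  moreover have "subgroup (L \<inter> H) ?X"
    by (metis assms(2,3) inf.commute inf_le1 subgroup_incl subgroups_Inter_pair)
  ultimately show ?thesis 
    using group.generate_subgroup_incl[OF assms(1), of _ "L \<inter> H"]
    by (metis le_inf_iff lower_central.simps(2))
qed

lemma (in group) mem_lower_central_Suc:
  assumes "group (G\<lparr>carrier := H\<rparr>)" "subgroup H G" "x \<in> lower_central (G\<lparr>carrier := H\<rparr>) n" "y \<in> H"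
    "c \<in> carrier G" "x \<otimes> y = c \<otimes> y \<otimes> x"
  shows "c \<in> lower_central (G\<lparr>carrier := H\<rparr>) (Suc n)"
proof -
  let ?X = "G\<lparr>carrier := H\<rparr>"
  have HG: "H \<subseteq> carrier G" using assms(2) by (rule subgroup.subset)
  have xH: "x \<in> H" 
    using subgroup.subset[OF lower_central_subgroup[OF assms(1)]] assms(3) by auto
  have "x \<otimes> y \<otimes> inv x \<otimes> inv y = c"
    by (rule commutator_eqI) (use assms HG xH in auto)
  then have "c = x \<otimes>\<^bsub>?X\<^esub> y \<otimes>\<^bsub>?X\<^esub> inv\<^bsub>?X\<^esub> x \<otimes>\<^bsub>?X\<^esub> inv\<^bsub>?X\<^esub> y"
    using m_inv_consistent[OF assms(2) xH] m_inv_consistent[OF assms(2) assms(4)] by simp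
  then have "c \<in> comm_set ?X (lower_central ?X n) (carrier ?X)"
    unfolding comm_set_def using assms(3,4) by fastforce
  then show ?thesis by (simp add: generate.incl)
qed

text \<open>The assumption \<open>free\<close> says that elements outside \<open>P\<close> act without fixed points on \<open>P/Z\<close>, and
  the set \<open>D\<close> witnesses that \<open>G/P\<close> is not nilpotent.\<close>

locale tower = group +
  fixes Z P Q D
  assumes subZ: "subgroup Z G" and nP: "P \<lhd> G" and nQ: "Q \<lhd> G"
    and ZP: "Z \<subseteq> P" and PQ: "P \<subseteq> Q"
    and Z_nontriv: "\<exists>z\<in>Z. z \<noteq> \<one>"
    and Z_central: "\<lbrakk>z \<in> Z; u \<in> P\<rbrakk> \<Longrightarrow> z \<otimes> u = u \<otimes> z"
    and comm_P: "\<lbrakk>u \<in> P; v \<in> P\<rbrakk> \<Longrightarrow> \<exists>z\<in>Z. u \<otimes> v = z \<otimes> v \<otimes> u"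
    and Z_comm: "z \<in> Z \<Longrightarrow> \<exists>u\<in>P. \<exists>v\<in>P. u \<otimes> v = z \<otimes> v \<otimes> u"
    and comm_Q: "\<lbrakk>u \<in> Q; v \<in> Q\<rbrakk> \<Longrightarrow> \<exists>z\<in>P. u \<otimes> v = z \<otimes> v \<otimes> u"
    and comm_G: "\<lbrakk>u \<in> carrier G; v \<in> carrier G\<rbrakk> \<Longrightarrow> \<exists>z\<in>Q. u \<otimes> v = z \<otimes> v \<otimes> u"
    and free: "\<lbrakk>g \<in> carrier G; g \<notin> P; u \<in> P\<rbrakk> \<Longrightarrow>
      \<exists>v\<in>P. \<forall>z\<in>Z. \<exists>z'\<in>Z. g \<otimes> (v \<otimes> z) = (u \<otimes> z') \<otimes> (v \<otimes> z) \<otimes> g"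
    and D_sub: "D \<subseteq> carrier G" "D \<inter> P = {}" "D \<noteq> {}"
    and D_comm: "c \<in> D \<Longrightarrow> \<exists>x\<in>carrier G. \<exists>d\<in>D. c \<otimes> x = d \<otimes> x \<otimes> c"
begin

lemma subP: "subgroup P G" and subQ: "subgroup Q G"
  using nP nQ by (simp_all add: normal_imp_subgroup)

text \<open>Commutators with \<open>g\<close> cover \<open>P\<close> modulo \<open>Z\<close> by
  \<open>free\<close>, and \<open>Z\<close> is made of commutators of \<open>P\<close>. One element
  of \<open>L\<close> outside \<open>P\<close> is therefore enough, which lets the lemma be used for
  \<open>G\<close> and again for its derived subgroup.\<close>

lemma P_le_derived:
  assumes L: "subgroup L G" and PL: "P \<subseteq> L" and g: "g \<in> L" "g \<notin> P"
  shows "P \<subseteq> derived G L"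
proof
  have LG: "L \<subseteq> carrier G" using L by (rule subgroup.subset)
  have sd: "subgroup (derived G L) G" using derived_is_subgroup[OF LG] .
  have ZL: "Z \<subseteq> derived G L"
  proof
    fix z assume "z \<in> Z"
    then show "z \<in> derived G L"
      using Z_comm[of z] mem_derived[of _ L _ z] PL LG subgroup.mem_carrier[OF subZ] by blast
  qed
  fix u assume u: "u \<in> P"
  obtain v z where v: "v \<in> P" "z \<in> Z" "g \<otimes> (v \<otimes> \<one>) = (u \<otimes> z) \<otimes> (v \<otimes> \<one>) \<otimes> g"
    using free[of g u] g LG u subgroup.one_closed[OF subZ] by blast
  note mem = subgroup.mem_carrier[OF subZ] subgroup.mem_carrier[OF subP]
  have "u \<otimes> z \<in> derived G L"
    by (rule mem_derived[of g _ v]) (use v u mem PL g LG in auto)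
  then have "u \<otimes> z \<otimes> inv z \<in> derived G L"
    using ZL v sd by (metis subgroup.m_closed subgroup.m_inv_closed subsetD)
  then show "u \<in> derived G L" using u v mem by (simp add: m_assoc)
qed

text \<open>The lower bound on the derived length. The first two derived subgroups contain
  \<open>P\<close>: an element \<open>c\<close> of \<open>D\<close> lies in \<open>G\<close>, a
  commutator \<open>d\<close> of it lies in the derived subgroup, and both are outside
  \<open>P\<close>. The third then contains the commutators of \<open>P\<close>, hence
  \<open>Z\<close>.\<close>

lemma derived_seq_contains_Z:
  assumes "n \<le> 3" shows "Z \<subseteq> (derived G ^^ n) (carrier G)"
proof -
  obtain c where c: "c \<in> D" using D_sub by blast
  then obtain x d where x: "x \<in> carrier G" "d \<in> D" "c \<otimes> x = d \<otimes> x \<otimes> c" using D_comm by blast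
  have d: "d \<in> derived G (carrier G)"
    by (rule mem_derived[of c _ x]) (use x c D_sub in auto)
  have 1: "P \<subseteq> derived G (carrier G)"
    by (rule P_le_derived[of _ c])
      (use c D_sub subgroup.subset[OF subP] in \<open>auto intro: subgroup_self\<close>)
  have 2: "P \<subseteq> derived G (derived G (carrier G))"
    by (rule P_le_derived[of _ d]) (use 1 d x D_sub in \<open>auto intro: derived_is_subgroup\<close>)
  have PG: "P \<subseteq> carrier G" using subP by (rule subgroup.subset)
  have "Z \<subseteq> derived G P"
  proof
    fix z assume "z \<in> Z"
    then show "z \<in> derived G P"
      using Z_comm[of z] mem_derived[of _ P _ z] PG subgroup.mem_carrier[OF subZ] by blast
  qed
  also have "\<dots> \<subseteq> derived G (derived G (derived G (carrier G)))"
    by (rule mono_derived[OF 2])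
  finally have 3: "Z \<subseteq> derived G (derived G (derived G (carrier G)))" .
  consider "n = 0" | "n = 1" | "n = 2" | "n = 3" using assms by linarith
  then show ?thesis
    by cases (use 1 2 3 ZP PG in \<open>auto simp: numeral_2_eq_2 numeral_3_eq_3\<close>)
qed

lemma derived_seq_4: "(derived G ^^ 4) (carrier G) = {\<one>}"
proof -
  have PG: "P \<subseteq> carrier G" and QG: "Q \<subseteq> carrier G" and ZG: "Z \<subseteq> carrier G"
    using subP subQ subZ by (auto dest: subgroup.subset)
  have 1: "derived G (carrier G) \<subseteq> Q" using comm_G by (intro derived_subset subQ) auto
  have 2: "derived G Q \<subseteq> P" using comm_Q QG by (intro derived_subset subP) auto
  have 3: "derived G P \<subseteq> Z" using comm_P PG by (intro derived_subset subZ) auto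
  have 4: "derived G Z \<subseteq> {\<one>}"
    using Z_central ZP ZG by (intro derived_subset triv_subgroup) (auto simp: subset_iff)
  have "(derived G ^^ 4) (carrier G) = derived G (derived G (derived G (derived G (carrier G))))"
    by (simp add: numeral_eq_Suc)
  also have "\<dots> \<subseteq> {\<one>}"
    using mono_derived[OF 1] 2 3 4 mono_derived by (meson order_trans)
  finally have "(derived G ^^ 4) (carrier G) \<subseteq> {\<one>}" .
  moreover have "\<one> \<in> (derived G ^^ 4) (carrier G)"
    using exp_of_derived_is_subgroup[OF subgroup_self] subgroup.one_closed by blast
  ultimately show ?thesis by blast
qed

theorem derived_length_eq: "derived_length G = 4"
  unfolding derived_length_def
proof (rule Least_equality)
  fix n assume n: "(derived G ^^ n) (carrier G) = {\<one>}"
  show "4 \<le> n"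
  proof (rule ccontr)
    assume "\<not> 4 \<le> n"
    then show False using derived_seq_contains_Z[of n] n Z_nontriv by auto
  qed
qed (rule derived_seq_4)

theorem solvable_tower: "solvable G"
  using derived_seq_4 solvable_iff_trivial_derived_seq by blast

text \<open>If \<open>g \<in> N - P\<close>, then commutators with \<open>g\<close> reproduce all of \<open>P/Z\<close>, so every term of the lower
  central series of \<open>N\<close> covers \<open>P/Z\<close>.\<close>

lemma nilpotent_normal_le_P:
  assumes N: "N \<lhd> G" and n: "lower_central (G\<lparr>carrier := N\<rparr>) n \<subseteq> {\<one>}"
  shows "N \<subseteq> P"
proof (rule ccontr)
  assume "\<not> N \<subseteq> P"
  then obtain g where g: "g \<in> N" "g \<notin> P" by blast
  have sN: "subgroup N G" using N by (simp add: normal_imp_subgroup)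
  have gG: "g \<in> carrier G" using g sN by (meson subgroup.mem_carrier)
  have grN: "group (G\<lparr>carrier := N\<rparr>)" using sN is_group by (rule subgroup.subgroup_is_group)
  note mem = subgroup.mem_carrier[OF subZ] subgroup.mem_carrier[OF subP]
  have key: "\<exists>z\<in>Z. u \<otimes> z \<in> lower_central (G\<lparr>carrier := N\<rparr>) n" if "u \<in> P" for u n
    using that
  proof (induction n arbitrary: u)
    case 0
    obtain v z where v: "v \<in> P" "z \<in> Z" "g \<otimes> (v \<otimes> \<one>) = (u \<otimes> z) \<otimes> (v \<otimes> \<one>) \<otimes> g"
      using free[of g u] g gG 0 subgroup.one_closed[OF subZ] by blast
    have "u \<otimes> z = g \<otimes> v \<otimes> inv g \<otimes> inv v"
      using commutator_eqI[of g v "u \<otimes> z"] v gG mem 0 by auto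
    \<comment> \<open>The element \<open>v\<close> need not lie in \<open>N\<close>; the commutator
      does, since the normal subgroup \<open>N\<close> contains the conjugate of
      \<open>inv g\<close> by \<open>v\<close>.\<close>
    also have "\<dots> = g \<otimes> (v \<otimes> inv g \<otimes> inv v)" using v(1) gG mem by (simp add: m_assoc)
    also have "\<dots> \<in> N"
      using g v mem normal.inv_op_closed2[OF N] sN by (meson subgroup.m_closed subgroup.m_inv_closed)
    finally show ?case using v by auto
  next
    case (Suc n)
    \<comment> \<open>The commutator of \<open>v z\<close> with \<open>g\<close> is the inverse of
      that of \<open>g\<close> with \<open>v z\<close>, so \<open>free\<close> is applied to
      \<open>inv u\<close>. It has to supply \<open>v\<close> before \<open>z\<close> is known,
      because the induction hypothesis controls only the coset of \<open>v\<close> modulo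
      \<open>Z\<close>.\<close>
    have iu: "inv u \<in> P" using Suc.prems subP by (meson subgroup.m_inv_closed)
    obtain v where v: "v \<in> P"
      "\<And>z. z \<in> Z \<Longrightarrow> \<exists>z'\<in>Z. g \<otimes> (v \<otimes> z) = (inv u \<otimes> z') \<otimes> (v \<otimes> z) \<otimes> g"
      using free[of g "inv u"] g gG iu by blast
    obtain z where z: "z \<in> Z" "v \<otimes> z \<in> lower_central (G\<lparr>carrier := N\<rparr>) n"
      using Suc.IH v by blast
    obtain z' where z': "z' \<in> Z" "g \<otimes> (v \<otimes> z) = (inv u \<otimes> z') \<otimes> (v \<otimes> z) \<otimes> g"
      using v z by blast
    let ?x = "v \<otimes> z"
    have c: "?x \<in> carrier G" "inv u \<in> carrier G" "u \<in> carrier G" "z' \<in> carrier G"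
      using v z z' mem iu Suc.prems by auto
    have "inv z' \<otimes> u \<otimes> (g \<otimes> ?x) = inv z' \<otimes> (u \<otimes> (inv u \<otimes> (z' \<otimes> (?x \<otimes> g))))"
      using z' c gG by (simp add: m_assoc)
    also have "u \<otimes> (inv u \<otimes> (z' \<otimes> (?x \<otimes> g))) = z' \<otimes> (?x \<otimes> g)"
      using c(1,3,4) gG by (simp flip: m_assoc)
    also have "inv z' \<otimes> (z' \<otimes> (?x \<otimes> g)) = ?x \<otimes> g"
      using c(1,4) gG by (simp flip: m_assoc)
    finally have "?x \<otimes> g = inv z' \<otimes> u \<otimes> (g \<otimes> ?x)" by simp
    then have "?x \<otimes> g = (inv z' \<otimes> u) \<otimes> g \<otimes> ?x" using c gG by (simp add: m_assoc)
    moreover have "inv z' \<otimes> u = u \<otimes> inv z'"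
      using Z_central Suc.prems z' subZ by (meson subgroup.m_inv_closed)
    ultimately have "?x \<otimes> g = (u \<otimes> inv z') \<otimes> g \<otimes> ?x" by simp
    then have "u \<otimes> inv z' \<in> lower_central (G\<lparr>carrier := N\<rparr>) (Suc n)"
      using mem_lower_central_Suc[OF grN sN z(2) g(1)] c by auto
    then show ?case using z' subZ by (meson subgroup.m_inv_closed)
  qed
  obtain c where "c \<in> P" "c \<notin> Z"
  proof -
    \<comment> \<open>\<open>P \<noteq> Z\<close>, since \<open>Z\<close> is abelian and \<open>P\<close> is not\<close>
    obtain z where z: "z \<in> Z" "z \<noteq> \<one>" using Z_nontriv by blast
    then obtain u v where uv: "u \<in> P" "v \<in> P" "u \<otimes> v = z \<otimes> v \<otimes> u" using Z_comm by blast
    have "u \<notin> Z"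
    proof
      assume "u \<in> Z"
      then have "v \<otimes> u = z \<otimes> v \<otimes> u" using Z_central[of u v] uv by simp
      also have "\<dots> = z \<otimes> (v \<otimes> u)" using uv mem z by (intro m_assoc) auto
      finally have "v \<otimes> u = z \<otimes> (v \<otimes> u)" .
      then show False using z uv mem by (metis m_closed r_cancel_one')
    qed
    then show thesis using that uv by blast
  qed
  with key[of c n] n obtain z where "z \<in> Z" "c \<otimes> z = \<one>" by blast
  then have "c = inv z" using \<open>c \<in> P\<close> mem by (metis inv_equality)
  then show False using \<open>c \<notin> Z\<close> \<open>z \<in> Z\<close> subZ by (simp add: subgroup.m_inv_closed)
qed

text \<open>\<open>D\<close> reproduces itself under suitable commutators, so every term of the
  lower central series meets it. As \<open>D\<close> avoids \<open>P\<close>, no quotient of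
  \<open>G\<close> by a normal subgroup inside \<open>P\<close> is nilpotent.\<close>

lemma D_meets_lower_central: "D \<inter> lower_central G n \<noteq> {}"
proof (induction n)
  case 0
  then show ?case using D_sub by auto
next
  case (Suc n)
  then obtain c where c: "c \<in> D" "c \<in> lower_central G n" by blast
  then obtain x d where x: "x \<in> carrier G" "d \<in> D" "c \<otimes> x = d \<otimes> x \<otimes> c" using D_comm by blast
  have "d \<in> lower_central (G\<lparr>carrier := carrier G\<rparr>) (Suc n)"
    by (rule mem_lower_central_Suc[of _ c _ x]) (use x c D_sub in \<open>auto simp: subgroup_self is_group\<close>)
  then show ?case using x by auto
qed

text \<open>Three layers suffice by the chain through \<open>P\<close> and \<open>Q\<close>. In a
  shorter series the first layer is a nilpotent normal subgroup, so it lies in \<open>P\<close>;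
  this rules out one layer since \<open>P\<close> is proper, and two since \<open>G\<close> modulo
  that layer is not nilpotent.\<close>

theorem fitting_height_eq: "fitting_height G = 3"
  unfolding fitting_height_def
proof (rule Least_equality)
  let ?N = "\<lambda>i. if i = 0 then {\<one>} else if i = 1 then P else if i = 2 then Q else carrier G"
  have PG: "P \<subseteq> carrier G" and QG: "Q \<subseteq> carrier G" and ZG: "Z \<subseteq> carrier G"
    using subP subQ subZ by (auto dest: subgroup.subset)
  have gP: "group (G\<lparr>carrier := P\<rparr>)" and gQ: "group (G\<lparr>carrier := Q\<rparr>)"
    using subP subQ by (simp_all add: subgroup_imp_group)
  have n1: "nilpotent_group (G\<lparr>carrier := P\<rparr> Mod {\<one>})"
  proof (subst nilpotent_group_Mod_iff[OF gP], goal_cases)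
    case 1 then show ?case using group.one_is_normal[OF gP] by simp
  next
    case 2
    have "lower_central (G\<lparr>carrier := P\<rparr>) (Suc 0) \<subseteq> Z"
      using comm_P by (intro lower_central_Suc_subset gP subP subZ) auto
    then have "lower_central (G\<lparr>carrier := P\<rparr>) (Suc (Suc 0)) \<subseteq> {\<one>}"
      using Z_central ZG PG
      by (intro lower_central_Suc_subset gP subP triv_subgroup) (auto simp: subset_iff)
    then show ?case by blast
  qed
  have n2: "nilpotent_group (G\<lparr>carrier := Q\<rparr> Mod P)"
  proof (subst nilpotent_group_Mod_iff[OF gQ], goal_cases)
    case 1 then show ?case using nP PQ subQ by (simp add: normal_restrict_supergroup)
  next
    case 2
    have "lower_central (G\<lparr>carrier := Q\<rparr>) (Suc 0) \<subseteq> P"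
      using comm_Q by (intro lower_central_Suc_subset gQ subP subQ) auto
    then show ?case by blast
  qed
  have n3: "nilpotent_group (G\<lparr>carrier := carrier G\<rparr> Mod Q)"
  proof (subst nilpotent_group_Mod_iff, goal_cases)
    case 1 then show ?case by (simp add: is_group)
  next
    case 2 then show ?case using nQ by simp
  next
    case 3
    have "lower_central (G\<lparr>carrier := carrier G\<rparr>) (Suc 0) \<subseteq> Q"
      using comm_G by (intro lower_central_Suc_subset subgroup_self subQ) (auto simp: is_group)
    then show ?case by blast
  qed
  have "\<forall>i<3. ?N i \<subseteq> ?N (Suc i) \<and> nilpotent_group (G\<lparr>carrier := ?N (Suc i)\<rparr> Mod ?N i)"
  proof (intro allI impI)
    fix i :: nat assume "i < 3"
    then consider "i = 0" | "i = 1" | "i = 2" by linarith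
    then show "?N i \<subseteq> ?N (Suc i) \<and> nilpotent_group (G\<lparr>carrier := ?N (Suc i)\<rparr> Mod ?N i)"
    proof cases
      case 1
      then show ?thesis using n1 subgroup.one_closed[OF subP] by simp
    next
      case 2
      then show ?thesis using n2 PQ by simp
    next
      case 3
      then show ?thesis using n3 QG by simp
    qed
  qed
  moreover have "\<forall>i\<le>3. ?N i \<lhd> G" using one_is_normal nP nQ normal_self by auto
  ultimately show "\<exists>N. N 0 = {\<one>} \<and> N 3 = carrier G \<and> (\<forall>i\<le>3. N i \<lhd> G) \<and>
      (\<forall>i<3. N i \<subseteq> N (Suc i) \<and> nilpotent_group (G\<lparr>carrier := N (Suc i)\<rparr> Mod N i))"
    by (intro exI[of _ ?N]) auto
next
  fix h :: nat
  assume "\<exists>N. N 0 = {\<one>} \<and> N h = carrier G \<and> (\<forall>i\<le>h. N i \<lhd> G) \<and>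
      (\<forall>i<h. N i \<subseteq> N (Suc i) \<and> nilpotent_group (G\<lparr>carrier := N (Suc i)\<rparr> Mod N i))"
  then obtain N where N: "N 0 = {\<one>}" "N h = carrier G" "\<And>i. i \<le> h \<Longrightarrow> N i \<lhd> G"
    "\<And>i. i < h \<Longrightarrow> nilpotent_group (G\<lparr>carrier := N (Suc i)\<rparr> Mod N i)" by blast
  obtain d where d: "d \<in> carrier G" "d \<notin> P" using D_sub by blast
  show "3 \<le> h"
  proof (rule ccontr)
    assume "\<not> 3 \<le> h"
    moreover have "h \<noteq> 0"
      using N d subgroup.one_closed[OF subP] by (metis singletonD)
    ultimately have h: "h = 1 \<or> h = 2" by linarith
    have N1: "N 1 \<lhd> G" using N(3) h by auto
    then have sN1: "subgroup (N 1) G" by (rule normal_imp_subgroup)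
    have gN1: "group (G\<lparr>carrier := N 1\<rparr>)" using sN1 by (rule subgroup_imp_group)
    have "nilpotent_group (G\<lparr>carrier := N 1\<rparr> Mod {\<one>})" using N(4)[of 0] N(1) h by auto
    then obtain n where "lower_central (G\<lparr>carrier := N 1\<rparr>) n \<subseteq> {\<one>}"
      using nilpotent_group_Mod_iff[OF gN1] group.one_is_normal[OF gN1] by auto
    then have le: "N 1 \<subseteq> P" by (rule nilpotent_normal_le_P[OF N1])
    then have h2: "h = 2" using h N(2) d by auto
    then have "nilpotent_group (G\<lparr>carrier := N 2\<rparr> Mod N 1)"
      using N(4)[of 1] by (simp add: numeral_2_eq_2)
    then have "nilpotent_group (G Mod N 1)" using N(2) h2 by simp
    then obtain n where "lower_central G n \<subseteq> N 1"
      using nilpotent_group_Mod_iff[OF is_group N1] by blast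
    then show False using D_meets_lower_central[of n] le D_sub by blast
  qed
qed

end

section \<open>Monomial representations\<close>

definition vsum :: "nat \<Rightarrow> ('i \<Rightarrow> complex vec) \<Rightarrow> 'i set \<Rightarrow> complex vec" where
  "vsum n f I = vec n (\<lambda>r. \<Sum>i\<in>I. f i $ r)"

lemma vsum_carrier [simp]: "vsum n f I \<in> carrier_vec n"
  by (simp add: vsum_def)

lemma vsum_index [simp]: "r < n \<Longrightarrow> vsum n f I $ r = (\<Sum>i\<in>I. f i $ r)"
  by (simp add: vsum_def)

lemma dim_vsum [simp]: "dim_vec (vsum n f I) = n"
  by (simp add: vsum_def)

lemma vsum_cong: "(\<And>i. i \<in> I \<Longrightarrow> f i = g i) \<Longrightarrow> vsum n f I = vsum n g I"
  by (simp add: vsum_def)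

lemma vsum_in_subspace:
  assumes W: "is_subspace n W" and "finite I" "\<And>i. i \<in> I \<Longrightarrow> f i \<in> W"
  shows "vsum n f I \<in> W"
  using assms(2,3)
proof (induction I rule: finite_induct)
  case empty
  have "vsum n f {} = 0\<^sub>v n" by (auto simp: vsum_def)
  then show ?case using W by (simp add: is_subspace_def)
next
  case (insert i I)
  have "vsum n f (insert i I) = f i + vsum n f I"
  proof (rule eq_vecI)
    fix r assume "r < dim_vec (f i + vsum n f I)"
    then show "vsum n f (insert i I) $ r = (f i + vsum n f I) $ r"
      using insert by simp
  qed simp
  then show ?case using W insert by (simp add: is_subspace_def)
qed

lemma mult_mat_vec_vsum:
  assumes M: "M \<in> carrier_mat m n" and f: "\<And>i. i \<in> I \<Longrightarrow> f i \<in> carrier_vec n"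
  shows "M *\<^sub>v vsum n f I = vsum m (\<lambda>i. M *\<^sub>v f i) I"
proof (rule eq_vecI)
  fix r assume "r < dim_vec (vsum m (\<lambda>i. M *\<^sub>v f i) I)"
  then have r: "r < m" by simp
  have "(M *\<^sub>v vsum n f I) $ r = (\<Sum>j<n. M $$ (r, j) * (\<Sum>i\<in>I. f i $ j))"
    using M r by (simp add: scalar_prod_def lessThan_atLeast0)
  also have "\<dots> = (\<Sum>i\<in>I. \<Sum>j<n. M $$ (r, j) * f i $ j)"
    by (simp add: sum_distrib_left sum.swap[of _ I])
  also have "\<dots> = (\<Sum>i\<in>I. (M *\<^sub>v f i) $ r)"
  proof (rule sum.cong)
    fix i assume "i \<in> I"
    with f have "dim_vec (f i) = n" by fastforce
    then show "(\<Sum>j<n. M $$ (r, j) * f i $ j) = (M *\<^sub>v f i) $ r"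
      using M r by (simp add: scalar_prod_def lessThan_atLeast0)
  qed simp
  finally show "(M *\<^sub>v vsum n f I) $ r = vsum m (\<lambda>i. M *\<^sub>v f i) I $ r" using r by simp
qed (use M in simp)

lemma smult_vsum:
  assumes "\<And>i. i \<in> I \<Longrightarrow> f i \<in> carrier_vec n"
  shows "c \<cdot>\<^sub>v vsum n f I = vsum n (\<lambda>i. c \<cdot>\<^sub>v f i) I"
proof (rule eq_vecI)
  fix r assume "r < dim_vec (vsum n (\<lambda>i. c \<cdot>\<^sub>v f i) I)"
  moreover have "dim_vec (f i) = n" if "i \<in> I" for i using assms[OF that] by simp
  ultimately show "(c \<cdot>\<^sub>v vsum n f I) $ r = vsum n (\<lambda>i. c \<cdot>\<^sub>v f i) I $ r"
    by (simp add: sum_distrib_left)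
qed simp

lemma is_subspace_zero: "is_subspace n {0\<^sub>v n}"
  by (auto simp: is_subspace_def)

lemma smult_in_subspaceD:
  assumes W: "is_subspace n W" and "c \<noteq> 0" "v \<in> carrier_vec n" "c \<cdot>\<^sub>v v \<in> W"
  shows "v \<in> W"
proof -
  have "inverse c \<cdot>\<^sub>v (c \<cdot>\<^sub>v v) \<in> W" using assms by (simp add: is_subspace_def)
  moreover have "inverse c \<cdot>\<^sub>v (c \<cdot>\<^sub>v v) = v" using assms by (simp add: smult_smult_assoc)
  ultimately show ?thesis by simp
qed

text \<open>Applying \<open>M a - \<theta> j a\<close>, with \<open>a\<close> separating
  \<open>i\<close> from \<open>j\<close>, deletes the summand \<open>j\<close> and rescales the
  summand \<open>i\<close> by a nonzero factor; induction removes all the others. For the zero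
  subspace this is linear independence of eigenvectors, for an invariant subspace it extracts
  components; both uses occur.\<close>

lemma eigenvector_summand_in_subspace:
  assumes W: "is_subspace n W" and M: "\<And>a. a \<in> A \<Longrightarrow> M a \<in> carrier_mat n n"
    and inv: "\<And>a w. a \<in> A \<Longrightarrow> w \<in> W \<Longrightarrow> M a *\<^sub>v w \<in> W"
    and "finite I" "\<And>i. i \<in> I \<Longrightarrow> u i \<in> carrier_vec n"
    and "\<And>i a. i \<in> I \<Longrightarrow> a \<in> A \<Longrightarrow> M a *\<^sub>v u i = \<theta> i a \<cdot>\<^sub>v u i"
    and "\<And>i j. i \<in> I \<Longrightarrow> j \<in> I \<Longrightarrow> i \<noteq> j \<Longrightarrow> \<exists>a\<in>A. \<theta> i a \<noteq> \<theta> j a"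
    and "vsum n u I \<in> W" "i \<in> I"
  shows "u i \<in> W"
  using assms(4-)
proof (induction I arbitrary: u rule: finite_psubset_induct)
  case (psubset I u)
  show ?case
  proof (cases "I = {i}")
    case True
    then have "vsum n u I = u i" using psubset.prems(1)[of i] by (auto simp: vsum_def)
    then show ?thesis using psubset.prems by simp
  next
    case False
    then obtain j where j: "j \<in> I" "j \<noteq> i" using psubset.prems by blast
    then obtain a where a: "a \<in> A" "\<theta> i a \<noteq> \<theta> j a" using psubset.prems(3)[of i j] psubset.prems(5) by auto
    define u' where "u' l = (\<theta> l a - \<theta> j a) \<cdot>\<^sub>v u l" for l
    have u'c: "u' l \<in> carrier_vec n" if "l \<in> I" for l
      using psubset.prems(1)[OF that] by (simp add: u'_def)
    have "vsum n u' (I - {j}) = M a *\<^sub>v vsum n u I + (- \<theta> j a) \<cdot>\<^sub>v vsum n u I"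
    proof (rule eq_vecI)
      fix r assume "r < dim_vec (M a *\<^sub>v vsum n u I + (- \<theta> j a) \<cdot>\<^sub>v vsum n u I)"
      then have r: "r < n" by simp
      have dim: "dim_vec (u l) = n" if "l \<in> I" for l
        using psubset.prems(1)[OF that] by simp
      have "vsum n u' (I - {j}) $ r = (\<Sum>l\<in>I. u' l $ r)"
        using r j psubset.hyps dim by (simp add: sum.remove[of I j] u'_def)
      also have "\<dots> = (\<Sum>l\<in>I. (M a *\<^sub>v u l) $ r) - \<theta> j a * (\<Sum>l\<in>I. u l $ r)"
        using r dim psubset.prems(2)[OF _ a(1)]
        by (simp add: u'_def sum_distrib_left left_diff_distrib flip: sum_subtractf)
      also have "\<dots> = (M a *\<^sub>v vsum n u I + (- \<theta> j a) \<cdot>\<^sub>v vsum n u I) $ r"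
        using r M[OF a(1)] psubset.prems(1) by (simp add: mult_mat_vec_vsum[OF M[OF a(1)]])
      finally show "vsum n u' (I - {j}) $ r = (M a *\<^sub>v vsum n u I + (- \<theta> j a) \<cdot>\<^sub>v vsum n u I) $ r" .
    qed simp
    also have "\<dots> \<in> W" using W inv[OF a(1)] psubset.prems(4) by (simp add: is_subspace_def)
    finally have mem: "vsum n u' (I - {j}) \<in> W" .
    have "u' i \<in> W"
    proof (rule psubset.IH[of "I - {j}"])
      show "I - {j} \<subset> I" using j by blast
      show "M b *\<^sub>v u' l = \<theta> l b \<cdot>\<^sub>v u' l" if "l \<in> I - {j}" "b \<in> A" for l b
        using that psubset.prems(2)
        by (simp add: u'_def mult_mat_vec[OF M psubset.prems(1)] smult_smult_assoc mult.commute)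
    qed (use u'c psubset.prems j mem in auto)
    then show ?thesis
      using smult_in_subspaceD[OF W, of "\<theta> i a - \<theta> j a" "u i"] a psubset.prems(1,5) by (simp add: u'_def)
  qed
qed

lemma is_repD:
  assumes "is_rep G n \<rho>"
  shows "g \<in> carrier G \<Longrightarrow> \<rho> g \<in> carrier_mat n n" "\<rho> \<one>\<^bsub>G\<^esub> = 1\<^sub>m n"
    "g \<in> carrier G \<Longrightarrow> h \<in> carrier G \<Longrightarrow> \<rho> (g \<otimes>\<^bsub>G\<^esub> h) = \<rho> g * \<rho> h"
    "g \<in> carrier G \<Longrightarrow> h \<in> carrier G \<Longrightarrow> v \<in> carrier_vec n \<Longrightarrow>
      \<rho> (g \<otimes>\<^bsub>G\<^esub> h) *\<^sub>v v = \<rho> g *\<^sub>v (\<rho> h *\<^sub>v v)"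
    "g \<in> carrier G \<Longrightarrow> v \<in> carrier_vec n \<Longrightarrow> \<rho> g *\<^sub>v v \<in> carrier_vec n"
    "v \<in> carrier_vec n \<Longrightarrow> \<rho> \<one>\<^bsub>G\<^esub> *\<^sub>v v = v"
  using assms by (auto simp: is_rep_def intro: mult_mat_vec_carrier assoc_mult_mat_vec)

section \<open>Eigencomponents for an element of finite order\<close>

lemma sum_roots_of_unity:
  assumes "0 < m" "k < m"
  shows "(\<Sum>j<m. cis (- (2 * pi * real j * real k / real m))) = (if k = 0 then of_nat m else 0)"
proof (cases "k = 0")
  case False
  define x where "x = cis (- (2 * pi * real k / real m))"
  have pw: "cis (- (2 * pi * real j * real k / real m)) = x ^ j" for j
    by (simp add: x_def DeMoivre mult_ac)
  have "x ^ m = cis (- (2 * pi * real k))" using assms by (simp add: x_def DeMoivre)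
  also have "\<dots> = 1" using cis_multiple_2pi[of "- real k"] by (simp add: mult_ac)
  finally have xm: "x ^ m = 1" .
  have "x \<noteq> 1"
  proof
    assume "x = 1"
    then have "cis (2 * pi * real k / real m) = 1" unfolding x_def by (metis cis_cnj complex_cnj_one_iff minus_minus)
    then have "cos (2 * pi * real k / real m) = 1" by (metis cis.sel(1) one_complex.sel(1))
    then obtain l :: int where "2 * pi * real k / real m = l * 2 * pi" using cos_one_2pi_int by auto
    then have "real k = l * real m" using assms by (simp add: field_simps)
    then have "int k = l * int m" by (metis of_int_eq_iff of_int_mult of_int_of_nat_eq)
    then have "int m dvd int k" by simp
    then show False using assms False by (auto dest: dvd_imp_le)
  qed
  then show ?thesis using False geometric_sum[of x m] xm by (simp add: pw)
qed simp

text \<open>If the \<open>m\<close>-th power of \<open>b\<close> is one, this is \<open>m\<close>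
  times the projection onto the eigenspace of \<open>\<rho> b\<close> for the eigenvalue
  \<open>exp (2 pi i j / m)\<close>. The division by \<open>m\<close> is left out; the factor
  reappears in \<open>sum_eigen_proj\<close>.\<close>

definition eigen_proj :: "('a, 'b) monoid_scheme \<Rightarrow> nat \<Rightarrow> ('a \<Rightarrow> complex mat) \<Rightarrow> 'a \<Rightarrow> nat \<Rightarrow> nat
    \<Rightarrow> complex vec \<Rightarrow> complex vec" where
  "eigen_proj G n \<rho> b m j v =
     vsum n (\<lambda>k. cis (- (2 * pi * real j * real k / real m)) \<cdot>\<^sub>v (\<rho> (b [^]\<^bsub>G\<^esub> k) *\<^sub>v v)) {..<m}"

lemma eigen_proj_carrier [simp]: "eigen_proj G n \<rho> b m j v \<in> carrier_vec n"
  by (simp add: eigen_proj_def)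

context group
begin

lemma sum_eigen_proj:
  assumes rep: "is_rep G n \<rho>" and b: "b \<in> carrier G" and v: "v \<in> carrier_vec n" and m: "0 < m"
  shows "vsum n (\<lambda>j. eigen_proj G n \<rho> b m j v) {..<m} = of_nat m \<cdot>\<^sub>v v"
proof (rule eq_vecI)
  fix r assume "r < dim_vec (of_nat m \<cdot>\<^sub>v v)"
  then have r: "r < n" using v by simp
  have c: "\<rho> (b [^] k) *\<^sub>v v \<in> carrier_vec n" for k :: nat
    using is_repD(5)[OF rep] b v by simp
  then have d: "dim_row (\<rho> (b [^] k)) = n" for k :: nat by (metis carrier_vecD dim_mult_mat_vec)
  have "vsum n (\<lambda>j. eigen_proj G n \<rho> b m j v) {..<m} $ r =
    (\<Sum>j<m. \<Sum>k<m. cis (- (2 * pi * real j * real k / real m)) * (\<rho> (b [^] k) *\<^sub>v v) $ r)"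
    using r d by (simp add: eigen_proj_def)
  also have "\<dots> = (\<Sum>k<m. (\<Sum>j<m. cis (- (2 * pi * real j * real k / real m))) * (\<rho> (b [^] k) *\<^sub>v v) $ r)"
    by (subst sum.swap) (simp add: sum_distrib_right)
  also have "\<dots> = (\<Sum>k<m. if k = 0 then of_nat m * (\<rho> (b [^] k) *\<^sub>v v) $ r else 0)"
    by (rule sum.cong) (use m sum_roots_of_unity in auto)
  also have "\<dots> = of_nat m * v $ r" using m is_repD(6)[OF rep v] by (simp add: sum.delta)
  finally show "vsum n (\<lambda>j. eigen_proj G n \<rho> b m j v) {..<m} $ r = (of_nat m \<cdot>\<^sub>v v) $ r"
    using r v by simp
qed (use v in simp)

lemma eigen_proj_eigen:
  assumes rep: "is_rep G n \<rho>" and b: "b \<in> carrier G" and v: "v \<in> carrier_vec n"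
    and m: "0 < m" "b [^] m = \<one>"
  shows "\<rho> b *\<^sub>v eigen_proj G n \<rho> b m j v = cis (2 * pi * real j / real m) \<cdot>\<^sub>v eigen_proj G n \<rho> b m j v"
proof (rule eq_vecI)
  let ?c = "\<lambda>k. cis (- (2 * pi * real j * real k / real m))"
  let ?w = "\<lambda>k. \<rho> (b [^] (k::nat)) *\<^sub>v v"
  fix r assume "r < dim_vec (cis (2 * pi * real j / real m) \<cdot>\<^sub>v eigen_proj G n \<rho> b m j v)"
  then have r: "r < n" by (simp add: eigen_proj_def)
  have c: "?w k \<in> carrier_vec n" for k using is_repD(5)[OF rep] b v by simp
  have d: "dim_row (\<rho> (b [^] k)) = n" for k :: nat using c by (metis carrier_vecD dim_mult_mat_vec)
  have d': "dim_row (\<rho> (b [^] k \<otimes> b)) = n" for k :: nat using d[of "Suc k"] by simp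
  have "\<rho> b *\<^sub>v eigen_proj G n \<rho> b m j v = vsum n (\<lambda>k. ?c k \<cdot>\<^sub>v ?w (Suc k)) {..<m}"
    unfolding eigen_proj_def
    using is_repD(1,4)[OF rep b] b v c nat_pow_Suc2[OF b]
    by (subst mult_mat_vec_vsum[of _ n]) (auto intro!: vsum_cong simp: mult_mat_vec simp del: nat_pow_Suc)
  then have "(\<rho> b *\<^sub>v eigen_proj G n \<rho> b m j v) $ r = (\<Sum>k<m. ?c k * ?w (Suc k) $ r)"
    using r d' by simp
  also have "\<dots> = (\<Sum>k<m. cis (2 * pi * real j / real m) * (?c (Suc k) * ?w (Suc k) $ r))"
  proof (rule sum.cong)
    fix k
    have "?c k = cis (2 * pi * real j / real m) * ?c (Suc k)"
      by (simp add: cis_mult field_simps flip: diff_divide_distrib)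
    then show "?c k * ?w (Suc k) $ r = cis (2 * pi * real j / real m) * (?c (Suc k) * ?w (Suc k) $ r)"
      by simp
  qed simp
  also have "\<dots> = cis (2 * pi * real j / real m) * (\<Sum>k<m. ?c (Suc k) * ?w (Suc k) $ r)"
    by (simp add: sum_distrib_left)
  \<comment> \<open>The summation index runs modulo \<open>m\<close>: the terms for \<open>m\<close>
    and \<open>0\<close> coincide because the \<open>m\<close>-th power of \<open>b\<close> is
    one.\<close>
  also have "(\<Sum>k<m. ?c (Suc k) * ?w (Suc k) $ r) = (\<Sum>k<m. ?c k * ?w k $ r)"
  proof -
    have "?c m = ?c 0" using m cis_multiple_2pi[of "- real j"] by (simp add: mult_ac)
    moreover have "?w m = ?w 0" using m(2) by simp
    ultimately have "?c m * ?w m $ r = ?c 0 * ?w 0 $ r" by metis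
    then show ?thesis using sum.lessThan_Suc_shift[of "\<lambda>k. ?c k * ?w k $ r" m]
      by (simp del: nat_pow_Suc)
  qed
  finally show "(\<rho> b *\<^sub>v eigen_proj G n \<rho> b m j v) $ r =
      (cis (2 * pi * real j / real m) \<cdot>\<^sub>v eigen_proj G n \<rho> b m j v) $ r"
    using r d by (simp add: eigen_proj_def)
qed (use is_repD(1)[OF rep b] in \<open>simp add: eigen_proj_def\<close>)

text \<open>Elements of \<open>B\<close> are adjoined one at a time: some eigencomponent for the new
  element is nonzero, stays in \<open>W\<close>, and remains an eigenvector for the earlier elements
  because the images commute. Commutation is asked of the images under \<open>\<rho>\<close>, so
  subgroups that are abelian only modulo the kernel are covered.\<close>

lemma common_eigenvector:
  assumes fin: "finite (carrier G)" and rep: "is_rep G n \<rho>" and W: "is_subspace n W"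
    and w: "w \<in> W" "w \<noteq> 0\<^sub>v n" and B: "B \<subseteq> carrier G"
    and comm: "\<And>a b. a \<in> B \<Longrightarrow> b \<in> B \<Longrightarrow> \<rho> (a \<otimes> b) = \<rho> (b \<otimes> a)"
    and inv: "\<And>b x. b \<in> B \<Longrightarrow> x \<in> W \<Longrightarrow> \<rho> b *\<^sub>v x \<in> W"
  shows "\<exists>v\<in>W. v \<noteq> 0\<^sub>v n \<and> (\<forall>b\<in>B. \<exists>c. \<rho> b *\<^sub>v v = c \<cdot>\<^sub>v v)"
proof -
  have "finite B" using B fin by (rule finite_subset)
  then show ?thesis using B comm inv
  proof (induction B rule: finite_induct)
    case empty
    then show ?case using w by auto
  next
    case (insert b B)
    then obtain v where v: "v \<in> W" "v \<noteq> 0\<^sub>v n" "\<And>a. a \<in> B \<Longrightarrow> \<exists>c. \<rho> a *\<^sub>v v = c \<cdot>\<^sub>v v" by auto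
    have bG: "b \<in> carrier G" using insert by auto
    obtain m :: nat where m: "m > 0" "b [^] m = \<one>"
      using pow_order_eq_1[OF bG] fin order_gt_0_iff_finite by blast
    have vc: "v \<in> carrier_vec n" using v W by (auto simp: is_subspace_def)
    have "\<exists>j. eigen_proj G n \<rho> b m j v \<noteq> 0\<^sub>v n"
    proof (rule ccontr)
      assume "\<not> ?thesis"
      then have "vsum n (\<lambda>j. eigen_proj G n \<rho> b m j v) {..<m} \<in> {0\<^sub>v n}"
        by (intro vsum_in_subspace is_subspace_zero) auto
      then have "of_nat m \<cdot>\<^sub>v v \<in> {0\<^sub>v n}" using sum_eigen_proj[OF rep bG vc m(1)] by simp
      then have "v \<in> {0\<^sub>v n}"
        by (rule smult_in_subspaceD[OF is_subspace_zero, rotated 2]) (use m(1) vc in simp_all)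
      then show False using v by simp
    qed
    then obtain j where j: "eigen_proj G n \<rho> b m j v \<noteq> 0\<^sub>v n" by blast
    let ?u = "eigen_proj G n \<rho> b m j v"
    have invpow: "\<rho> (b [^] k) *\<^sub>v v \<in> W" for k :: nat
    proof (induction k)
      case 0
      then show ?case using v is_repD(6)[OF rep vc] by simp
    next
      case (Suc k)
      then show ?case using insert.prems(3)[of b "\<rho> (b [^] k) *\<^sub>v v"] is_repD(4)[OF rep bG _ vc, of "b [^] k"] bG nat_pow_Suc2[OF bG]
        by (simp del: nat_pow_Suc)
    qed
    have "?u \<in> W" unfolding eigen_proj_def
      by (rule vsum_in_subspace[OF W]) (use W invpow in \<open>auto simp: is_subspace_def\<close>)
    moreover have "\<exists>c. \<rho> a *\<^sub>v ?u = c \<cdot>\<^sub>v ?u" if aB: "a \<in> B" for a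
    proof -
      have aG: "a \<in> carrier G" using aB insert by auto
      obtain c where c: "\<rho> a *\<^sub>v v = c \<cdot>\<^sub>v v" using v(3)[OF aB] by blast
      have ab: "\<rho> a * \<rho> b = \<rho> b * \<rho> a"
        using insert.prems(2)[of a b] aB is_repD(3)[OF rep] aG bG by simp
      have pw: "\<rho> a *\<^sub>v (\<rho> (b [^] k) *\<^sub>v v) = c \<cdot>\<^sub>v (\<rho> (b [^] k) *\<^sub>v v)" for k :: nat
      proof (induction k)
        case 0
        then show ?case using c is_repD(6)[OF rep vc] by simp
      next
        case (Suc k)
        let ?x = "\<rho> (b [^] k) *\<^sub>v v"
        have x: "?x \<in> carrier_vec n" using is_repD(5)[OF rep _ vc] bG by simp
        have "\<rho> a *\<^sub>v (\<rho> b *\<^sub>v ?x) = \<rho> b *\<^sub>v (\<rho> a *\<^sub>v ?x)"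
          unfolding assoc_mult_mat_vec[OF is_repD(1)[OF rep aG] is_repD(1)[OF rep bG] x, symmetric]
            assoc_mult_mat_vec[OF is_repD(1)[OF rep bG] is_repD(1)[OF rep aG] x, symmetric] ab ..
        also have "\<dots> = c \<cdot>\<^sub>v (\<rho> b *\<^sub>v ?x)"
          unfolding Suc using is_repD(1)[OF rep bG] x by (rule mult_mat_vec)
        finally show ?case using is_repD(4)[OF rep bG _ vc, of "b [^] k"] bG nat_pow_Suc2[OF bG]
          by (simp del: nat_pow_Suc)
      qed
      have x: "\<rho> (b [^] k) *\<^sub>v v \<in> carrier_vec n" for k :: nat
        using is_repD(5)[OF rep _ vc] bG by simp
      have "\<rho> a *\<^sub>v ?u = c \<cdot>\<^sub>v ?u"
        unfolding eigen_proj_def using is_repD(1)[OF rep aG] x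
        by (subst mult_mat_vec_vsum[of _ n], simp, simp)
           (auto simp: smult_vsum mult_mat_vec pw smult_smult_assoc mult.commute intro!: vsum_cong)
      then show ?thesis by blast
    qed
    moreover have "\<rho> b *\<^sub>v ?u = cis (2 * pi * real j / real m) \<cdot>\<^sub>v ?u"
      by (rule eigen_proj_eigen[OF rep bG vc m])
    ultimately show ?case using j by blast
  qed
qed

text \<open>A matrix of finite order is diagonalizable: if \<open>1\<close> were the only
  eigenvalue, every eigencomponent of a vector would be fixed, hence so would their sum, a positive
  multiple of the vector.\<close>

lemma nontrivial_eigenvector:
  assumes fin: "finite (carrier G)" and rep: "is_rep G n \<rho>" and d: "d \<in> carrier G" "\<rho> d \<noteq> 1\<^sub>m n"
  shows "\<exists>v c. v \<in> carrier_vec n \<and> v \<noteq> 0\<^sub>v n \<and> \<rho> d *\<^sub>v v = c \<cdot>\<^sub>v v \<and> c \<noteq> 1"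
proof (rule ccontr)
  assume neg: "\<not> ?thesis"
  obtain m :: nat where m: "m > 0" "d [^] m = \<one>"
    using pow_order_eq_1[OF d(1)] fin order_gt_0_iff_finite by blast
  have fixed: "\<rho> d *\<^sub>v v = v" if v: "v \<in> carrier_vec n" for v
  proof -
    let ?U = "{u \<in> carrier_vec n. \<rho> d *\<^sub>v u = u}"
    have M: "\<rho> d \<in> carrier_mat n n" using is_repD(1)[OF rep d(1)] .
    have U: "is_subspace n ?U" unfolding is_subspace_def
      using M by (auto simp: mult_add_distrib_mat_vec mult_mat_vec)
    have "eigen_proj G n \<rho> d m j v \<in> ?U" for j
    proof (cases "cis (2 * pi * real j / real m) = 1")
      case True
      then show ?thesis using eigen_proj_eigen[OF rep d(1) v m, of j] by (simp add: one_smult_vec)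
    next
      case False
      have "eigen_proj G n \<rho> d m j v = 0\<^sub>v n"
      proof (rule ccontr)
        assume "eigen_proj G n \<rho> d m j v \<noteq> 0\<^sub>v n"
        with False neg show False
          using eigen_proj_eigen[OF rep d(1) v m, of j] eigen_proj_carrier[of G n \<rho> d m j v] by iprover
      qed
      then show ?thesis using U by (simp add: is_subspace_def)
    qed
    then have "of_nat m \<cdot>\<^sub>v v \<in> ?U"
      unfolding sum_eigen_proj[OF rep d(1) v m(1), symmetric]
      by (intro vsum_in_subspace[OF U]) auto
    then have "v \<in> ?U" by (rule smult_in_subspaceD[OF U, rotated 2]) (use v m in auto)
    then show ?thesis by simp
  qed
  have M: "\<rho> d \<in> carrier_mat n n" using is_repD(1)[OF rep d(1)] .
  have "\<rho> d = 1\<^sub>m n"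
  proof (rule eq_matI)
    fix i j assume ij: "i < dim_row (1\<^sub>m n :: complex mat)" "j < dim_col (1\<^sub>m n :: complex mat)"
    have "(\<rho> d *\<^sub>v unit_vec n j) $ i = unit_vec n j $ i" using fixed[of "unit_vec n j"] by simp
    moreover have "(\<rho> d *\<^sub>v unit_vec n j) $ i = \<rho> d $$ (i, j)" using M ij by simp
    ultimately show "\<rho> d $$ (i, j) = 1\<^sub>m n $$ (i, j)" using ij by auto
  qed (use M in auto)
  then show False using d by simp
qed

section \<open>Degrees as indices of subgroups\<close>

lemma coset_representatives:
  assumes fin: "finite (carrier G)" and S: "subgroup S G" and k: "k * card S = card (carrier G)"
  obtains r :: "nat \<Rightarrow> 'a" where "\<And>i. i < k \<Longrightarrow> r i \<in> carrier G"
    "\<And>g. g \<in> carrier G \<Longrightarrow> \<exists>!i. i < k \<and> inv (r i) \<otimes> g \<in> S"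
proof -
  have finS: "finite S" using fin S by (meson finite_subset subgroup.subset)
  have "card S > 0" using finS S by (metis card_gt_0_iff empty_iff subgroup.one_closed)
  moreover have "card (rcosets S) * card S = k * card S"
    using lagrange[OF S] by (simp add: k Coset.order_def)
  ultimately have card: "card (rcosets S) = k" by simp
  have "finite (rcosets S)" using fin by (simp add: RCOSETS_def)
  then obtain c where c: "bij_betw c {..<k} (rcosets S)"
    using card by (metis atLeast0LessThan ex_bij_betw_nat_finite)
  have "\<exists>x\<in>carrier G. c i = S #> x" if "i < k" for i
    using bij_betwE[OF c] that by (auto simp: RCOSETS_def)
  then obtain x where x: "\<And>i. i < k \<Longrightarrow> x i \<in> carrier G" "\<And>i. i < k \<Longrightarrow> c i = S #> x i" by metis
  have *: "x i \<otimes> g \<in> S \<longleftrightarrow> c i = S #> inv g" if "i < k" "g \<in> carrier G" for i g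
  proof -
    have "c i = S #> inv g \<longleftrightarrow> x i \<in> S #> inv g"
      using x that S by (metis inv_closed repr_independence rcos_self)
    also have "\<dots> \<longleftrightarrow> x i \<otimes> inv (inv g) \<in> S"
      using x that S
      by (metis (no_types, lifting) inv_closed subgroup.rcos_module is_group)
    finally show ?thesis using that by simp
  qed
  show thesis
  \<comment> \<open>\<open>rcosets\<close> consists of the sets \<open>S #> x\<close>; inverting the
    representatives gives representatives of left cosets, which is what membership of
    \<open>inv (r i) \<otimes> g\<close> in \<open>S\<close> expresses.\<close>
  proof (rule that[of "\<lambda>i. inv (x i)"])
    fix g assume g: "g \<in> carrier G"
    have "S #> inv g \<in> rcosets S" using g by (auto simp: RCOSETS_def)
    then obtain i where i: "i < k" "c i = S #> inv g"
      using bij_betw_imp_surj_on[OF c] by (metis imageE lessThan_iff)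
    show "\<exists>!i. i < k \<and> inv (inv (x i)) \<otimes> g \<in> S"
    proof (rule ex1I[of _ i])
      show "i < k \<and> inv (inv (x i)) \<otimes> g \<in> S" using i * g x by simp
      fix j assume j: "j < k \<and> inv (inv (x j)) \<otimes> g \<in> S"
      then have "c j = c i" using *[of j g] g x(1)[of j] i(2) by simp
      then show "j = i" using inj_onD[OF bij_betw_imp_inj_on[OF c]] i j by simp
    qed
  qed (use x in simp)
qed

end

lemma mult_mat_vec_zero: "M \<in> carrier_mat m n \<Longrightarrow> M *\<^sub>v 0\<^sub>v n = (0\<^sub>v m :: complex vec)"
  by (intro eq_vecI) auto

text \<open>The preimages of the unit vectors form a two-sided inverse \<open>Y\<close> of
  \<open>X\<close>. The traces of \<open>X * Y\<close> and \<open>Y * X\<close> agree, and they are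
  \<open>n\<close> and \<open>k\<close> as complex numbers, so \<open>n = k\<close> by
  characteristic zero.\<close>

lemma card_eq_if_bijective_matrix:
  assumes X: "X \<in> carrier_mat n k" and surj: "\<And>w. w \<in> carrier_vec n \<Longrightarrow> \<exists>c\<in>carrier_vec k. X *\<^sub>v c = (w :: complex vec)"
    and inj: "\<And>c. c \<in> carrier_vec k \<Longrightarrow> X *\<^sub>v c = 0\<^sub>v n \<Longrightarrow> c = 0\<^sub>v k"
  shows "n = k"
proof -
  obtain y where y: "\<And>j. y j \<in> carrier_vec k" "\<And>j. X *\<^sub>v y j = unit_vec n j"
    using surj[of "unit_vec n _"] by (metis unit_vec_carrier)
  define Y where "Y = mat k n (\<lambda>(i, j). y j $ i)"
  have Y: "Y \<in> carrier_mat k n" by (simp add: Y_def)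
  have colY: "col Y j = y j" if "j < n" for j
    using that y(1)[of j] by (auto simp: Y_def)
  have XY: "X * Y = 1\<^sub>m n"
  proof (rule mat_col_eqI)
    fix j assume "j < dim_col (1\<^sub>m n :: complex mat)"
    then have j: "j < n" by simp
    then show "col (X * Y) j = col (1\<^sub>m n) j"
      using X Y colY y(2)[of j] by (simp add: col_mult2[of _ n k _ n])
  qed (use X Y in auto)
  have YX: "Y * X = 1\<^sub>m k"
  proof (rule mat_col_eqI)
    fix j assume "j < dim_col (1\<^sub>m k :: complex mat)"
    then have j: "j < k" by simp
    let ?d = "col (Y * X) j - unit_vec k j"
    have cYX: "col (Y * X) j \<in> carrier_vec k" using X Y by (simp add: carrier_vecI)
    then have d: "?d \<in> carrier_vec k" by simp
    have "X *\<^sub>v ?d = X *\<^sub>v col (Y * X) j - X *\<^sub>v unit_vec k j"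
      by (rule mult_minus_distrib_mat_vec[OF X cYX]) simp
    also have "X *\<^sub>v col (Y * X) j = col (X * (Y * X)) j"
      using X Y j by (simp add: col_mult2[of _ n k _ k])
    also have "X * (Y * X) = X" using X Y XY by (metis assoc_mult_mat left_mult_one_mat)
    also have "X *\<^sub>v unit_vec k j = col X j"
      using X j by (intro eq_vecI) auto
    finally have "X *\<^sub>v ?d = 0\<^sub>v n" using X by auto
    then have "?d = 0\<^sub>v k" using inj d by blast
    have "col (Y * X) j $ t = unit_vec k j $ t" if "t < k" for t
    proof -
      have "?d $ t = 0" using \<open>?d = 0\<^sub>v k\<close> that by simp
      then show ?thesis using that cYX by simp
    qed
    then have "col (Y * X) j = unit_vec k j" using cYX Y by (intro eq_vecI) auto
    then show "col (Y * X) j = col (1\<^sub>m k) j" using j by simp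
  qed (use X Y in auto)
  have "(of_nat n :: complex) = (\<Sum>i<n. (X * Y) $$ (i, i))" using XY by simp
  also have "\<dots> = (\<Sum>i<n. \<Sum>j<k. X $$ (i, j) * Y $$ (j, i))"
    using X Y by (simp add: scalar_prod_def lessThan_atLeast0)
  also have "\<dots> = (\<Sum>j<k. \<Sum>i<n. Y $$ (j, i) * X $$ (i, j))"
    by (subst sum.swap) (simp add: mult.commute)
  also have "\<dots> = (\<Sum>j<k. (Y * X) $$ (j, j))"
    using X Y by (simp add: scalar_prod_def lessThan_atLeast0)
  also have "\<dots> = of_nat k" using YX by simp
  finally show ?thesis by simp
qed

context group
begin

text \<open>If the conjugates of \<open>\<chi>\<close> by \<open>r i\<close> and \<open>r j\<close>
  agreed on \<open>A\<close>, then \<open>inv (r i) \<otimes> r j\<close> would stabilize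
  \<open>\<chi>\<close> on \<open>A\<close> and so lie in \<open>S\<close>, putting both
  representatives in one coset. Both directions of the degree computation use the stabilizer
  condition through this lemma.\<close>

lemma conjugate_characters_distinct:
  assumes S: "subgroup S G" and A: "A \<lhd> G" and AS: "A \<subseteq> S"
    and stab: "\<And>g. g \<in> carrier G \<Longrightarrow>
      (\<And>a a'. a \<in> A \<Longrightarrow> a' \<in> A \<Longrightarrow> a \<otimes> g = g \<otimes> a' \<Longrightarrow> \<chi> a = \<chi> a') \<Longrightarrow> g \<in> S"
    and r: "\<And>i. i < k \<Longrightarrow> r i \<in> carrier G"
      "\<And>g. g \<in> carrier G \<Longrightarrow> \<exists>!i. i < k \<and> inv (r i) \<otimes> g \<in> S"
    and ij: "i < k" "j < k" "i \<noteq> j"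
  shows "\<exists>a\<in>A. \<chi> (inv (r i) \<otimes> a \<otimes> r i) \<noteq> \<chi> (inv (r j) \<otimes> a \<otimes> r j)"
proof (rule ccontr)
  assume neg: "\<not> ?thesis"
  have AG: "A \<subseteq> carrier G" using A by (meson normal_imp_subgroup subgroup.subset)
  have ri: "r i \<in> carrier G" "r j \<in> carrier G" using r ij by auto
  have "inv (r i) \<otimes> r j \<in> S"
  proof (rule stab)
    fix a a' assume a: "a \<in> A" "a' \<in> A" and eq: "a \<otimes> (inv (r i) \<otimes> r j) = (inv (r i) \<otimes> r j) \<otimes> a'"
    \<comment> \<open>Evaluated at \<open>?b\<close>, the two conjugate characters give
      \<open>\<chi> a\<close> and \<open>\<chi> a'\<close>.\<close>
    let ?b = "r i \<otimes> a \<otimes> inv (r i)"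
    have aG: "a \<in> carrier G" "a' \<in> carrier G" using a AG by auto
    have b: "?b \<in> A" using normal.inv_op_closed2[OF A ri(1) a(1)] .
    have 1: "inv (r i) \<otimes> ?b \<otimes> r i = a"
    proof -
      have "inv (r i) \<otimes> ?b \<otimes> r i = inv (r i) \<otimes> (r i \<otimes> (a \<otimes> (inv (r i) \<otimes> r i)))"
        using aG ri by (simp add: m_assoc del: l_inv Units_l_inv)
      also have "\<dots> = (inv (r i) \<otimes> r i) \<otimes> a" 
        unfolding l_inv[OF ri(1)] using aG ri by (simp flip: m_assoc)
      finally show ?thesis using aG ri by simp
    qed
    have 2: "inv (r j) \<otimes> ?b \<otimes> r j = a'"
    proof -
      have "inv (r j) \<otimes> ?b \<otimes> r j = inv (r j) \<otimes> (r i \<otimes> (a \<otimes> (inv (r i) \<otimes> r j)))"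
        using aG ri by (simp add: m_assoc del: l_inv Units_l_inv)
      also have "\<dots> = inv (r j) \<otimes> ((r i \<otimes> inv (r i)) \<otimes> (r j \<otimes> a'))"
        unfolding eq using aG ri by (simp add: m_assoc del: r_inv Units_r_inv)
      also have "\<dots> = (inv (r j) \<otimes> r j) \<otimes> a'"
        unfolding r_inv[OF ri(1)] using aG ri by (simp add: m_assoc del: l_inv Units_l_inv)
      finally show ?thesis using aG ri by simp
    qed
    show "\<chi> a = \<chi> a'" using neg b 1 2 by metis
  qed (use ri in simp)
  moreover have "inv (r j) \<otimes> r j \<in> S" using ri S by (simp add: subgroup.one_closed)
  ultimately show False using r(2)[OF ri(2)] ij by blast
qed

text \<open>Here and below, stability of \<open>\<chi>\<close> under \<open>g\<close> is phrased without inverses: \<open>a \<otimes> g = g \<otimes> a'\<close> says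
  that \<open>a'\<close> is the conjugate of \<open>a\<close> by \<open>g\<close>. Translates of \<open>v\<close> by different cosets of \<open>S\<close> are
  eigenvectors for different characters of \<open>A\<close>, so they form a basis.\<close>

lemma irreducible_degree_eq_index:
  assumes fin: "finite (carrier G)" and irr: "irreducible_rep G n \<rho>"
    and S: "subgroup S G" and k: "k * card S = card (carrier G)"
    and A: "A \<lhd> G" and AS: "A \<subseteq> S"
    and v: "v \<in> carrier_vec n" "v \<noteq> 0\<^sub>v n" "\<And>s. s \<in> S \<Longrightarrow> \<rho> s *\<^sub>v v = \<chi> s \<cdot>\<^sub>v v"
    and stab: "\<And>g. g \<in> carrier G \<Longrightarrow>
      (\<And>a a'. a \<in> A \<Longrightarrow> a' \<in> A \<Longrightarrow> a \<otimes> g = g \<otimes> a' \<Longrightarrow> \<chi> a = \<chi> a') \<Longrightarrow> g \<in> S"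
  shows "n = k"
proof -
  obtain r :: "nat \<Rightarrow> 'a" where r: "\<And>i. i < k \<Longrightarrow> r i \<in> carrier G"
    "\<And>g. g \<in> carrier G \<Longrightarrow> \<exists>!i. i < k \<and> inv (r i) \<otimes> g \<in> S"
    by (rule coset_representatives[OF fin S k]) blast
  have rep: "is_rep G n \<rho>" using irr by (simp add: irreducible_rep_def)
  have SG: "S \<subseteq> carrier G" and AG: "A \<subseteq> carrier G" using S A
    by (meson normal_imp_subgroup subgroup.subset)+
  define u where "u i = \<rho> (r i) *\<^sub>v v" for i
  have uc: "u i \<in> carrier_vec n" if "i < k" for i
    unfolding u_def using is_repD(5)[OF rep r(1)[OF that] v(1)] .
  have translate: "\<exists>c. \<exists>j<k. \<rho> g *\<^sub>v v = c \<cdot>\<^sub>v u j" if g: "g \<in> carrier G" for g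
  proof -
    obtain j where j: "j < k" "inv (r j) \<otimes> g \<in> S" using r(2)[OF g] by blast
    let ?s = "inv (r j) \<otimes> g"
    have "r j \<otimes> ?s = g" using r(1)[OF j(1)] g by (simp flip: m_assoc)
    then have "\<rho> g *\<^sub>v v = \<rho> (r j) *\<^sub>v (\<rho> ?s *\<^sub>v v)"
      using is_repD(4)[OF rep r(1)[OF j(1)] _ v(1), of ?s] j SG by auto
    also have "\<dots> = \<chi> ?s \<cdot>\<^sub>v u j"
      unfolding u_def v(3)[OF j(2)] by (rule mult_mat_vec[OF is_repD(1)[OF rep r(1)[OF j(1)]] v(1)])
    finally show ?thesis using j by blast
  qed
  define W where "W = {vsum n (\<lambda>i. c i \<cdot>\<^sub>v u i) {..<k} | c. True}"
  have W: "is_subspace n W"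
    unfolding is_subspace_def
  proof (intro conjI ballI allI)
    show "W \<subseteq> carrier_vec n" by (auto simp: W_def)
    have "vsum n (\<lambda>i. 0 \<cdot>\<^sub>v u i) {..<k} = 0\<^sub>v n"
      using uc[THEN carrier_vecD] by (intro eq_vecI) auto
    then show "0\<^sub>v n \<in> W" unfolding W_def by (intro CollectI exI[of _ "\<lambda>_. 0"]) simp
  next
    fix x y assume "x \<in> W" "y \<in> W"
    then obtain c d where xy: "x = vsum n (\<lambda>i. c i \<cdot>\<^sub>v u i) {..<k}" "y = vsum n (\<lambda>i. d i \<cdot>\<^sub>v u i) {..<k}"
      by (auto simp: W_def)
    have "x + y = vsum n (\<lambda>i. (c i + d i) \<cdot>\<^sub>v u i) {..<k}"
      unfolding xy using uc[THEN carrier_vecD]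
      by (intro eq_vecI) (auto simp: distrib_right sum.distrib)
    then show "x + y \<in> W" by (force simp: W_def)
  next
    fix c :: complex and x assume "x \<in> W"
    then obtain d where x: "x = vsum n (\<lambda>i. d i \<cdot>\<^sub>v u i) {..<k}" by (auto simp: W_def)
    have "c \<cdot>\<^sub>v x = vsum n (\<lambda>i. (c * d i) \<cdot>\<^sub>v u i) {..<k}"
      unfolding x using uc by (subst smult_vsum) (auto simp: smult_smult_assoc)
    then show "c \<cdot>\<^sub>v x \<in> W" by (force simp: W_def)
  qed
  have uW: "u j \<in> W" if "j < k" for j
  proof -
    have "u j = vsum n (\<lambda>i. (if i = j then 1 else 0) \<cdot>\<^sub>v u i) {..<k}"
    proof (rule eq_vecI)
      fix t assume "t < dim_vec (vsum n (\<lambda>i. (if i = j then 1 else 0) \<cdot>\<^sub>v u i) {..<k})"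
      then have "t < n" by simp
      moreover have "(\<Sum>i<k. ((if i = j then 1 else 0) \<cdot>\<^sub>v u i) $ t) = (\<Sum>i<k. if i = j then u i $ t else 0)"
        using uc[THEN carrier_vecD] \<open>t < n\<close> by (intro sum.cong) auto
      ultimately show "u j $ t = vsum n (\<lambda>i. (if i = j then 1 else 0) \<cdot>\<^sub>v u i) {..<k} $ t"
        using that by (simp add: sum.delta)
    qed (use uc[OF that] in simp)
    then show ?thesis unfolding W_def by (intro CollectI exI[of _ "\<lambda>i. if i = j then 1 else 0"]) simp
  qed
  have inv: "\<rho> g *\<^sub>v w \<in> W" if g: "g \<in> carrier G" and "w \<in> W" for g w
  proof -
    obtain c where w: "w = vsum n (\<lambda>i. c i \<cdot>\<^sub>v u i) {..<k}" using \<open>w \<in> W\<close> by (auto simp: W_def)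
    have "\<rho> g *\<^sub>v w = vsum n (\<lambda>i. \<rho> g *\<^sub>v (c i \<cdot>\<^sub>v u i)) {..<k}"
      unfolding w by (rule mult_mat_vec_vsum[OF is_repD(1)[OF rep g]]) (use uc in auto)
    also have "\<dots> \<in> W"
    proof (rule vsum_in_subspace[OF W])
      fix i assume "i \<in> {..<k}"
      then have i: "i < k" by simp
      have "\<rho> g *\<^sub>v (c i \<cdot>\<^sub>v u i) = c i \<cdot>\<^sub>v (\<rho> g *\<^sub>v u i)"
        by (rule mult_mat_vec[OF is_repD(1)[OF rep g] uc[OF i]])
      moreover have "\<rho> g *\<^sub>v u i = \<rho> (g \<otimes> r i) *\<^sub>v v"
        unfolding u_def using is_repD(4)[OF rep g r(1)[OF i] v(1)] by simp
      moreover obtain d j where "j < k" "\<rho> (g \<otimes> r i) *\<^sub>v v = d \<cdot>\<^sub>v u j"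
        using translate[of "g \<otimes> r i"] g r(1)[OF i] by auto
      ultimately show "\<rho> g *\<^sub>v (c i \<cdot>\<^sub>v u i) \<in> W" using uW W by (simp add: is_subspace_def)
    qed simp
    finally show ?thesis .
  qed
  have un0: "u i \<noteq> 0\<^sub>v n" if "i < k" for i
  proof
    assume "u i = 0\<^sub>v n"
    have ri: "r i \<in> carrier G" using r that by blast
    have "v = \<rho> (inv (r i)) *\<^sub>v u i"
      unfolding u_def using is_repD(4)[OF rep _ ri v(1), of "inv (r i)"] is_repD(6)[OF rep v(1)] ri by simp
    also have "\<dots> = 0\<^sub>v n"
      unfolding \<open>u i = 0\<^sub>v n\<close> using is_repD(1)[OF rep, of "inv (r i)"] ri by (intro mult_mat_vec_zero) simp
    finally show False using v by simp
  qed
  have "k \<noteq> 0" using k fin by (metis card_0_eq mult_0 one_closed empty_iff)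
  then have "W \<noteq> {0\<^sub>v n}" using uW[of 0] un0[of 0] by auto
  then have Wall: "W = carrier_vec n"
    using irr W inv by (auto simp: irreducible_rep_def)
  \<comment> \<open>The columns are the translates of \<open>v\<close>. The map is onto because its
    image \<open>W\<close> is a nonzero invariant subspace, and injective because the translates are
    eigenvectors for distinct characters of \<open>A\<close>; so their number is the degree.\<close>
  define X where "X = mat n k (\<lambda>(t, i). u i $ t)"
  have X: "X \<in> carrier_mat n k" by (simp add: X_def)
  have Xc: "X *\<^sub>v vec k c = vsum n (\<lambda>i. c i \<cdot>\<^sub>v u i) {..<k}" for c
    using uc[THEN carrier_vecD]
    by (intro eq_vecI) (auto simp: X_def scalar_prod_def lessThan_atLeast0 mult.commute)
  show "n = k"
  proof (rule card_eq_if_bijective_matrix[OF X])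
    fix w :: "complex vec" assume "w \<in> carrier_vec n"
    then have "w \<in> W" using Wall by simp
    then obtain c where "w = X *\<^sub>v vec k c" unfolding W_def Xc by blast
    then show "\<exists>c\<in>carrier_vec k. X *\<^sub>v c = w" by (intro bexI[of _ "vec k c"]) simp_all
  next
    fix c assume c: "c \<in> carrier_vec k" "X *\<^sub>v c = 0\<^sub>v n"
    define e where "e i = c $ i" for i
    have ce: "c = vec k e" using c by (intro eq_vecI) (auto simp: e_def)
    then have 0: "vsum n (\<lambda>i. e i \<cdot>\<^sub>v u i) {..<k} \<in> {0\<^sub>v n}" using c Xc by simp
    have "e i \<cdot>\<^sub>v u i \<in> {0\<^sub>v n}" if i: "i < k" for i
    proof (rule eigenvector_summand_in_subspace[where M = \<rho> and A = A and I = "{..<k}"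
          and u = "\<lambda>i. e i \<cdot>\<^sub>v u i" and \<theta> = "\<lambda>i a. \<chi> (inv (r i) \<otimes> a \<otimes> r i)", OF is_subspace_zero _ _ _ _ _ _ 0])
      show M: "\<rho> a \<in> carrier_mat n n" if "a \<in> A" for a using is_repD(1)[OF rep] that AG by auto
      show "\<rho> a *\<^sub>v w \<in> {0\<^sub>v n}" if "a \<in> A" "w \<in> {0\<^sub>v n}" for a w
        using that M[OF that(1)] by (simp add: mult_mat_vec_zero)
      show "\<rho> a *\<^sub>v (e i \<cdot>\<^sub>v u i) = \<chi> (inv (r i) \<otimes> a \<otimes> r i) \<cdot>\<^sub>v (e i \<cdot>\<^sub>v u i)"
        if i: "i \<in> {..<k}" and a: "a \<in> A" for i a
      proof -
        have ri: "r i \<in> carrier G" and aG: "a \<in> carrier G" using i r a AG by auto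
        let ?s = "inv (r i) \<otimes> a \<otimes> r i"
        have s: "?s \<in> S" using normal.inv_op_closed1[OF A ri a] AS by auto
        have "r i \<otimes> ?s = (r i \<otimes> inv (r i)) \<otimes> (a \<otimes> r i)" using ri aG by (simp add: m_assoc del: r_inv Units_r_inv)
        then have e1: "r i \<otimes> ?s = a \<otimes> r i" using ri aG by simp
        have "\<rho> a *\<^sub>v u i = \<rho> (r i \<otimes> ?s) *\<^sub>v v"
          unfolding e1 u_def using is_repD(4)[OF rep aG ri v(1)] by simp
        also have "\<dots> = \<rho> (r i) *\<^sub>v (\<chi> ?s \<cdot>\<^sub>v v)"
          using is_repD(4)[OF rep ri _ v(1), of ?s] s SG v(3)[OF s] by auto
        also have "\<dots> = \<chi> ?s \<cdot>\<^sub>v u i"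
          unfolding u_def by (rule mult_mat_vec[OF is_repD(1)[OF rep ri] v(1)])
        finally show ?thesis
          using mult_mat_vec[OF M[OF a] uc[of i], of "e i"] i
          by (simp add: smult_smult_assoc mult.commute)
      qed
      show "\<exists>a\<in>A. \<chi> (inv (r i) \<otimes> a \<otimes> r i) \<noteq> \<chi> (inv (r j) \<otimes> a \<otimes> r j)"
        if "i \<in> {..<k}" "j \<in> {..<k}" "i \<noteq> j" for i j
        by (rule conjugate_characters_distinct[OF S A AS stab r]) (use that in auto)
    qed (use uc i in auto)
    then have "e i = 0" if "i < k" for i
      using that smult_in_subspaceD[OF is_subspace_zero, of "e i" "u i" n] uc un0 by blast
    then show "c = 0\<^sub>v k" unfolding ce by auto
  qed
qed

text \<open>The representation induced from \<open>\<chi>\<close>, written in the basis indexed by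
  cosets. It is irreducible because \<open>A\<close> acts on the coordinate lines by distinct
  characters, so a nonzero invariant subspace contains a coordinate vector, and \<open>G\<close>
  moves that vector to all the others.\<close>

lemma index_in_char_degrees:
  assumes fin: "finite (carrier G)"
    and S: "subgroup S G" and k: "k * card S = card (carrier G)"
    and A: "A \<lhd> G" and AS: "A \<subseteq> S"
    and hom: "\<And>s t. s \<in> S \<Longrightarrow> t \<in> S \<Longrightarrow> \<chi> (s \<otimes> t) = \<chi> s * \<chi> t" and \<chi>1: "\<chi> \<one> = (1::complex)"
    and stab: "\<And>g. g \<in> carrier G \<Longrightarrow>
      (\<And>a a'. a \<in> A \<Longrightarrow> a' \<in> A \<Longrightarrow> a \<otimes> g = g \<otimes> a' \<Longrightarrow> \<chi> a = \<chi> a') \<Longrightarrow> g \<in> S"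
  shows "k \<in> char_degrees G"
proof -
  obtain r :: "nat \<Rightarrow> 'a" where r: "\<And>i. i < k \<Longrightarrow> r i \<in> carrier G"
    "\<And>g. g \<in> carrier G \<Longrightarrow> \<exists>!i. i < k \<and> inv (r i) \<otimes> g \<in> S"
    by (rule coset_representatives[OF fin S k]) blast
  have SG: "S \<subseteq> carrier G" and AG: "A \<subseteq> carrier G" using S A
    by (meson normal_imp_subgroup subgroup.subset)+
  \<comment> \<open>Extending \<open>\<chi>\<close> by zero outside \<open>S\<close> gives the usual
    formula for an induced matrix; each column then has a single nonzero entry.\<close>
  define \<chi>0 where "\<chi>0 x = (if x \<in> S then \<chi> x else 0)" for x
  define \<rho> where "\<rho> g = mat k k (\<lambda>(i, j). \<chi>0 (inv (r i) \<otimes> g \<otimes> r j))" for g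
  have k0: "k \<noteq> 0" using k fin by (metis card_0_eq mult_0 one_closed empty_iff)
  have rr: "inv (r i) \<otimes> r j \<in> S \<longleftrightarrow> i = j" if "i < k" "j < k" for i j
    using r(2)[OF r(1)[OF that(2)]] that r(1) S by (metis l_inv subgroup.one_closed)
  have \<chi>0r: "\<chi>0 (inv (r i) \<otimes> r j) = (if i = j then 1 else 0)" if "i < k" "j < k" for i j
    using rr[OF that] r(1)[OF that(2)] \<chi>1 S by (auto simp: \<chi>0_def subgroup.one_closed)
  have \<chi>0_mult: "\<chi>0 (x \<otimes> s) = \<chi>0 x * \<chi> s" if "x \<in> carrier G" "s \<in> S" for x s
  proof (cases "x \<in> S")
    case True
    then show ?thesis using that hom S by (simp add: \<chi>0_def subgroup.m_closed)
  next
    case False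
    have "x \<otimes> s \<notin> S"
    proof
      assume "x \<otimes> s \<in> S"
      then have "x \<otimes> s \<otimes> inv s \<in> S" using S that by (simp add: subgroup.m_closed subgroup.m_inv_closed)
      then show False using False that SG by (simp add: m_assoc subset_iff)
    qed
    then show ?thesis using False by (simp add: \<chi>0_def)
  qed
  have \<rho>c: "\<rho> g \<in> carrier_mat k k" for g by (simp add: \<rho>_def)
  have rep: "is_rep G k \<rho>"
    unfolding is_rep_def
  proof (intro conjI ballI)
    show "\<rho> \<one> = 1\<^sub>m k"
      using r(1) \<chi>0r by (intro eq_matI) (auto simp: \<rho>_def)
  next
    fix g h assume g: "g \<in> carrier G" and h: "h \<in> carrier G"
    show "\<rho> (g \<otimes> h) = \<rho> g * \<rho> h"
    proof (rule eq_matI)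
      fix i j assume "i < dim_row (\<rho> g * \<rho> h)" "j < dim_col (\<rho> g * \<rho> h)"
      then have i: "i < k" and j: "j < k" by (simp_all add: \<rho>_def)
      note ri = r(1)[OF i] and rj = r(1)[OF j]
      obtain l where l: "l < k" "inv (r l) \<otimes> (h \<otimes> r j) \<in> S"
        and uniq: "\<And>t. t < k \<Longrightarrow> inv (r t) \<otimes> (h \<otimes> r j) \<in> S \<Longrightarrow> t = l"
        using r(2)[of "h \<otimes> r j"] h rj by blast
      note rl = r(1)[OF l(1)]
      let ?x = "inv (r i) \<otimes> g \<otimes> r l" and ?y = "inv (r l) \<otimes> h \<otimes> r j"
      have y: "?y \<in> S" using l rl h rj by (simp add: m_assoc)
      have z: "\<chi>0 (inv (r t) \<otimes> h \<otimes> r j) = 0" if "t < k" "t \<noteq> l" for t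
        using uniq[of t] that r(1)[OF that(1)] h rj by (auto simp: \<chi>0_def m_assoc)
      have "(\<rho> g * \<rho> h) $$ (i, j) = (\<Sum>t<k. \<chi>0 (inv (r i) \<otimes> g \<otimes> r t) * \<chi>0 (inv (r t) \<otimes> h \<otimes> r j))"
        using i j by (simp add: \<rho>_def scalar_prod_def lessThan_atLeast0)
      also have "\<dots> = (\<Sum>t<k. if t = l then \<chi>0 ?x * \<chi>0 ?y else 0)"
        by (rule sum.cong) (use z in auto)
      also have "\<dots> = \<chi>0 ?x * \<chi> ?y" using l y by (simp add: \<chi>0_def sum.delta)
      also have "\<dots> = \<chi>0 (?x \<otimes> ?y)" using \<chi>0_mult[OF _ y, of ?x] ri g rl by simp
      also have "?x \<otimes> ?y = inv (r i) \<otimes> g \<otimes> ((r l \<otimes> inv (r l)) \<otimes> (h \<otimes> r j))"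
        using ri rl rj g h by (simp add: m_assoc del: r_inv Units_r_inv)
      also have "\<dots> = inv (r i) \<otimes> (g \<otimes> h) \<otimes> r j"
        unfolding r_inv[OF rl] using ri rj g h by (simp add: m_assoc)
      finally show "\<rho> (g \<otimes> h) $$ (i, j) = (\<rho> g * \<rho> h) $$ (i, j)" using i j by (simp add: \<rho>_def)
    qed (simp_all add: \<rho>_def)
  qed (rule \<rho>c)
  have "irreducible_rep G k \<rho>"
    unfolding irreducible_rep_def
  proof (intro conjI allI impI)
    fix W assume "is_subspace k W \<and> (\<forall>g\<in>carrier G. \<forall>w\<in>W. \<rho> g *\<^sub>v w \<in> W)"
    then have W: "is_subspace k W" and inv: "\<And>g w. g \<in> carrier G \<Longrightarrow> w \<in> W \<Longrightarrow> \<rho> g *\<^sub>v w \<in> W" by auto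
    have decomp: "w = vsum k (\<lambda>i. w $ i \<cdot>\<^sub>v unit_vec k i) {..<k}" if "w \<in> carrier_vec k" for w
    proof (rule eq_vecI)
      fix t assume "t < dim_vec (vsum k (\<lambda>i. w $ i \<cdot>\<^sub>v unit_vec k i) {..<k})"
      then have t: "t < k" by simp
      have "(\<Sum>i<k. (w $ i \<cdot>\<^sub>v unit_vec k i) $ t) = (\<Sum>i<k. if i = t then w $ i else 0)"
        using t by (intro sum.cong) auto
      then show "w $ t = vsum k (\<lambda>i. w $ i \<cdot>\<^sub>v unit_vec k i) {..<k} $ t"
        using t by (simp add: sum.delta)
    qed (use that in simp)
    show "W = {0\<^sub>v k} \<or> W = carrier_vec k"
    proof (cases "W = {0\<^sub>v k}")
      case False
      then obtain w where w: "w \<in> W" "w \<noteq> 0\<^sub>v k" using W by (auto simp: is_subspace_def)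
      then have wc: "w \<in> carrier_vec k" using W by (auto simp: is_subspace_def)
      obtain i where i: "i < k" "w $ i \<noteq> 0" using w(2) wc by (metis carrier_vecD eq_vecI index_zero_vec)
      have "w $ i \<cdot>\<^sub>v unit_vec k i \<in> W"
      proof (rule eigenvector_summand_in_subspace[where M = \<rho> and A = A and I = "{..<k}"
          and u = "\<lambda>i. w $ i \<cdot>\<^sub>v unit_vec k i" and \<theta> = "\<lambda>i a. \<chi> (inv (r i) \<otimes> a \<otimes> r i)", OF W])
        show "\<rho> a *\<^sub>v (w $ i \<cdot>\<^sub>v unit_vec k i) = \<chi> (inv (r i) \<otimes> a \<otimes> r i) \<cdot>\<^sub>v (w $ i \<cdot>\<^sub>v unit_vec k i)"
          if "i \<in> {..<k}" and a: "a \<in> A" for i a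
        proof -
          have i: "i < k" using that by simp
          have ri: "r i \<in> carrier G" and aG: "a \<in> carrier G" using i r a AG by auto
          let ?s = "inv (r i) \<otimes> a \<otimes> r i"
          have s: "?s \<in> S" using normal.inv_op_closed1[OF A ri a] AS by auto
          have "\<rho> a *\<^sub>v unit_vec k i = \<chi> ?s \<cdot>\<^sub>v unit_vec k i"
          proof (rule eq_vecI)
            fix t assume "t < dim_vec (\<chi> ?s \<cdot>\<^sub>v unit_vec k i)"
            then have t: "t < k" by simp
            have rt: "r t \<in> carrier G" using r t by blast
            have "(\<rho> a *\<^sub>v unit_vec k i) $ t = \<chi>0 (inv (r t) \<otimes> a \<otimes> r i)"
              using i t by (simp add: \<rho>_def)
            also have "inv (r t) \<otimes> a \<otimes> r i = (inv (r t) \<otimes> r i) \<otimes> ?s"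
            proof -
              have "(inv (r t) \<otimes> r i) \<otimes> ?s = inv (r t) \<otimes> ((r i \<otimes> inv (r i)) \<otimes> (a \<otimes> r i))"
                using ri rt aG by (simp add: m_assoc del: r_inv Units_r_inv)
              then show ?thesis unfolding r_inv[OF ri] using ri rt aG by (simp add: m_assoc)
            qed
            also have "\<chi>0 \<dots> = (if t = i then 1 else 0) * \<chi> ?s"
              using \<chi>0_mult[OF _ s, of "inv (r t) \<otimes> r i"] \<chi>0r[OF t i] ri rt by simp
            finally show "(\<rho> a *\<^sub>v unit_vec k i) $ t = (\<chi> ?s \<cdot>\<^sub>v unit_vec k i) $ t" using t i by simp
          qed (simp add: \<rho>_def)
          then show ?thesis
            using mult_mat_vec[OF \<rho>c[of a] unit_vec_carrier[of k i], of "w $ i"] by (simp add: smult_smult_assoc mult.commute)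
        qed
        show "\<exists>a\<in>A. \<chi> (inv (r i) \<otimes> a \<otimes> r i) \<noteq> \<chi> (inv (r j) \<otimes> a \<otimes> r j)"
          if "i \<in> {..<k}" "j \<in> {..<k}" "i \<noteq> j" for i j
          by (rule conjugate_characters_distinct[OF S A AS stab r]) (use that in auto)
        show "vsum k (\<lambda>i. w $ i \<cdot>\<^sub>v unit_vec k i) {..<k} \<in> W" using decomp[OF wc] w by simp
      qed (use \<rho>c i inv AG in auto)
      then have ei: "unit_vec k i \<in> W" using i smult_in_subspaceD[OF W] by auto
      have e: "unit_vec k j \<in> W" if j: "j < k" for j
      proof -
        have ri: "r i \<in> carrier G" "r j \<in> carrier G" using i j r by auto
        let ?g = "r j \<otimes> inv (r i)"
        have "\<rho> ?g *\<^sub>v unit_vec k i = unit_vec k j"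
        proof (rule eq_vecI)
          fix t assume "t < dim_vec (unit_vec k j :: complex vec)"
          then have t: "t < k" by simp
          have rt: "r t \<in> carrier G" using r t by blast
          have "inv (r t) \<otimes> ?g \<otimes> r i = inv (r t) \<otimes> r j" using ri rt by (simp add: m_assoc)
          then show "(\<rho> ?g *\<^sub>v unit_vec k i) $ t = unit_vec k j $ t"
            using i t j \<chi>0r[OF t j] by (simp add: \<rho>_def)
        qed (simp add: \<rho>_def)
        then show ?thesis using inv[OF _ ei, of ?g] ri by simp
      qed
      have "carrier_vec k \<subseteq> W"
      proof
        fix x :: "complex vec" assume x: "x \<in> carrier_vec k"
        show "x \<in> W"
          by (subst decomp[OF x], rule vsum_in_subspace[OF W]) (use e W in \<open>auto simp: is_subspace_def\<close>)
      qed
      then show ?thesis using W by (auto simp: is_subspace_def)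
    qed simp
  qed (use rep k0 in auto)
  then show ?thesis by (auto simp: char_degrees_def)
qed

end

section \<open>The semidirect product of a Heisenberg group\<close>

text \<open>The map sending \<open>x\<close> to \<open>h x - x\<close> is additive with trivial
  kernel, hence injective and, on a finite set, onto. The subset \<open>S\<close> allows its use on
  \<open>Z\<close> as well as on all of \<open>K\<close>.\<close>

lemma (in abelian_group) fixed_point_free_surj:
  assumes S: "S \<subseteq> carrier G" "finite S" "\<And>x y. x \<in> S \<Longrightarrow> y \<in> S \<Longrightarrow> x \<oplus> y \<in> S"
      "\<And>x. x \<in> S \<Longrightarrow> \<ominus> x \<in> S"
    and h: "\<And>x. x \<in> S \<Longrightarrow> h x \<in> S" "\<And>x y. x \<in> S \<Longrightarrow> y \<in> S \<Longrightarrow> h (x \<oplus> y) = h x \<oplus> h y"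
    and fpf: "\<And>x. x \<in> S \<Longrightarrow> h x = x \<Longrightarrow> x = \<zero>" and u: "u \<in> S"
  shows "\<exists>x\<in>S. h x = u \<oplus> x"
proof -
  let ?f = "\<lambda>x. h x \<oplus> \<ominus> x"
  have c: "x \<in> S \<Longrightarrow> x \<in> carrier G" "x \<in> S \<Longrightarrow> h x \<in> carrier G" for x using S h by auto
  have "inj_on ?f S"
  proof (rule inj_onI)
    fix x y assume xy: "x \<in> S" "y \<in> S" and eq: "?f x = ?f y"
    have "h x = h x \<oplus> \<ominus> x \<oplus> x" using c xy by (simp add: a_assoc l_neg)
    also have "\<dots> = h y \<oplus> (\<ominus> y \<oplus> x)" unfolding eq using c xy by (simp add: a_assoc)
    finally have 1: "h x = h y \<oplus> (\<ominus> y \<oplus> x)" .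
    have m: "\<ominus> y \<oplus> x \<in> S" using S xy by simp
    have "y \<oplus> (\<ominus> y \<oplus> x) = x" using c xy by (simp add: r_neg2)
    then have "h x = h y \<oplus> h (\<ominus> y \<oplus> x)" using h(2)[OF xy(2) m] by simp
    then have "h (\<ominus> y \<oplus> x) = \<ominus> y \<oplus> x" using 1 c xy m by (metis r_neg1)
    then have "\<ominus> y \<oplus> x = \<zero>" using fpf m by blast
    then show "x = y" using c xy by (metis \<open>y \<oplus> (\<ominus> y \<oplus> x) = x\<close> r_zero)
  qed
  moreover have "?f ` S \<subseteq> S" using S h by auto
  ultimately have "?f ` S = S" using S(2) endo_inj_surj by blast
  then obtain x where x: "x \<in> S" "u = h x \<oplus> \<ominus> x" using u by blast
  then have "h x = u \<oplus> x" using c by (simp add: a_assoc l_neg)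
  then show ?thesis using x by blast
qed

lemma (in abelian_group) additive_zero:
  assumes "\<And>x y. x \<in> S \<Longrightarrow> y \<in> S \<Longrightarrow> h (x \<oplus> y) = h x \<oplus> h y" "\<zero> \<in> S" "h \<zero> \<in> carrier G"
  shows "h \<zero> = \<zero>"
  using assms(1)[of \<zero> \<zero>] assms(2,3) by (metis add.r_cancel_one' l_zero zero_closed)

lemma (in abelian_group) add_minus_cancel_mid:
  "x \<in> carrier G \<Longrightarrow> y \<in> carrier G \<Longrightarrow> x \<oplus> (y \<oplus> \<ominus> x) = y"
  by (metis a_comm a_inv_closed r_neg2)

text \<open>By Lagrange the prime index \<open>q\<close> is the product of the index of
  \<open>T\<close> and the index of \<open>Q\<close> in \<open>T\<close>.\<close>

lemma (in group) prime_index_maximal: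
  assumes fin: "finite (carrier G)" and Q: "subgroup Q G" and T: "subgroup T G" and QT: "Q \<subseteq> T"
    and q: "prime q" "q * card Q = card (carrier G)" and ne: "T \<noteq> carrier G"
  shows "T = Q"
proof -
  have TG: "T \<subseteq> carrier G" using T by (rule subgroup.subset)
  have finT: "finite T" using TG fin by (rule finite_subset)
  obtain t where t: "t * card T = card (carrier G)" using lagrange[OF T] by (auto simp: Coset.order_def)
  have gT: "group (G\<lparr>carrier := T\<rparr>)" using T by (rule subgroup_imp_group)
  have "subgroup Q (G\<lparr>carrier := T\<rparr>)" using Q T QT by (rule subgroup_incl)
  from group.lagrange[OF gT this] obtain s where s: "s * card Q = card T" by (auto simp: Coset.order_def)
  have "card Q \<noteq> 0" using Q finT QT by (metis card_0_eq empty_iff finite_subset subgroup.one_closed)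
  moreover have "(t * s) * card Q = q * card Q" using s t q by (simp add: mult.assoc)
  ultimately have "t * s = q" by simp
  then have "t = 1 \<or> s = 1" using q(1) by (metis prime_product)
  then show ?thesis
  proof
    assume "t = 1"
    then have "T = carrier G" using t fin TG by (simp add: card_subset_eq)
    then show ?thesis using ne by simp
  next
    assume "s = 1"
    then show ?thesis using s card_subset_eq[OF finT QT] by simp
  qed
qed

text \<open>The elements of \<open>G\<close> are \<open>(w, f, z, b)\<close>, where \<open>(w, f, z)\<close> lies in the Heisenberg group of the
  pairing \<open>T\<close> (so the second copy of \<open>K\<close> plays the role of its dual), and \<open>b \<in> H\<close> acts on the three
  components by \<open>A b\<close>, \<open>B b\<close> and \<open>m b\<close>. The injection \<open>enc\<close> only serves to put \<open>G\<close> on the type \<open>nat\<close>.\<close>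

locale heis = K: abelian_group K + H: group H
  for K (structure) and H (structure) +
  fixes Z and A B m :: "'c \<Rightarrow> 'a \<Rightarrow> 'a" and T :: "'a \<Rightarrow> 'a \<Rightarrow> 'a" and q :: nat
    and enc :: "'a \<times> 'a \<times> 'a \<times> 'c \<Rightarrow> 'e"
  assumes finK: "finite (carrier K)" and finH: "finite (carrier H)"
    and Z_sub: "Z \<subseteq> carrier K" and Z_zero: "\<zero> \<in> Z"
    and Z_add: "\<lbrakk>x \<in> Z; y \<in> Z\<rbrakk> \<Longrightarrow> x \<oplus> y \<in> Z" and Z_neg: "x \<in> Z \<Longrightarrow> \<ominus> x \<in> Z"
    and Z_ne: "\<exists>z\<in>Z. z \<noteq> \<zero>"
    and A_closed: "\<lbrakk>b \<in> carrier H; w \<in> carrier K\<rbrakk> \<Longrightarrow> A b w \<in> carrier K"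
    and A_add: "\<lbrakk>b \<in> carrier H; w \<in> carrier K; w' \<in> carrier K\<rbrakk> \<Longrightarrow> A b (w \<oplus> w') = A b w \<oplus> A b w'"
    and A_one: "w \<in> carrier K \<Longrightarrow> A \<one>\<^bsub>H\<^esub> w = w"
    and A_mult: "\<lbrakk>b \<in> carrier H; c \<in> carrier H; w \<in> carrier K\<rbrakk> \<Longrightarrow> A (b \<otimes>\<^bsub>H\<^esub> c) w = A b (A c w)"
    and A_free: "\<lbrakk>b \<in> carrier H; w \<in> carrier K; w \<noteq> \<zero>; A b w = w\<rbrakk> \<Longrightarrow> b = \<one>\<^bsub>H\<^esub>"
    and B_closed: "\<lbrakk>b \<in> carrier H; w \<in> carrier K\<rbrakk> \<Longrightarrow> B b w \<in> carrier K"
    and B_add: "\<lbrakk>b \<in> carrier H; w \<in> carrier K; w' \<in> carrier K\<rbrakk> \<Longrightarrow> B b (w \<oplus> w') = B b w \<oplus> B b w'"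
    and B_one: "w \<in> carrier K \<Longrightarrow> B \<one>\<^bsub>H\<^esub> w = w"
    and B_mult: "\<lbrakk>b \<in> carrier H; c \<in> carrier H; w \<in> carrier K\<rbrakk> \<Longrightarrow> B (b \<otimes>\<^bsub>H\<^esub> c) w = B b (B c w)"
    and B_free: "\<lbrakk>b \<in> carrier H; w \<in> carrier K; w \<noteq> \<zero>; B b w = w\<rbrakk> \<Longrightarrow> b = \<one>\<^bsub>H\<^esub>"
    and m_closed: "\<lbrakk>b \<in> carrier H; z \<in> Z\<rbrakk> \<Longrightarrow> m b z \<in> Z"
    and m_add: "\<lbrakk>b \<in> carrier H; z \<in> Z; z' \<in> Z\<rbrakk> \<Longrightarrow> m b (z \<oplus> z') = m b z \<oplus> m b z'"
    and m_one: "z \<in> Z \<Longrightarrow> m \<one>\<^bsub>H\<^esub> z = z"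
    and m_mult: "\<lbrakk>b \<in> carrier H; c \<in> carrier H; z \<in> Z\<rbrakk> \<Longrightarrow> m (b \<otimes>\<^bsub>H\<^esub> c) z = m b (m c z)"
    and m_comm: "\<lbrakk>b \<in> carrier H; c \<in> carrier H; z \<in> Z\<rbrakk> \<Longrightarrow> m b (m c z) = m c (m b z)"
    and m_free: "\<lbrakk>b \<in> carrier H; z \<in> Z; z \<noteq> \<zero>; m b z = z; z' \<in> Z\<rbrakk> \<Longrightarrow> m b z' = z'"
    and T_closed: "\<lbrakk>f \<in> carrier K; w \<in> carrier K\<rbrakk> \<Longrightarrow> T f w \<in> Z"
    and T_addl: "\<lbrakk>f \<in> carrier K; f' \<in> carrier K; w \<in> carrier K\<rbrakk> \<Longrightarrow> T (f \<oplus> f') w = T f w \<oplus> T f' w"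
    and T_addr: "\<lbrakk>f \<in> carrier K; w \<in> carrier K; w' \<in> carrier K\<rbrakk> \<Longrightarrow> T f (w \<oplus> w') = T f w \<oplus> T f w'"
    and T_equiv: "\<lbrakk>b \<in> carrier H; f \<in> carrier K; w \<in> carrier K\<rbrakk> \<Longrightarrow> T (B b f) (A b w) = m b (T f w)"
    and T_surjl: "\<lbrakk>w \<in> carrier K; w \<noteq> \<zero>; z \<in> Z\<rbrakk> \<Longrightarrow> \<exists>f\<in>carrier K. T f w = z"
    and T_surjr: "\<lbrakk>f \<in> carrier K; f \<noteq> \<zero>; z \<in> Z\<rbrakk> \<Longrightarrow> \<exists>w\<in>carrier K. T f w = z"
    and prime_q: "prime q"
    and card_C: "q * card {b \<in> carrier H. \<forall>z\<in>Z. m b z = z} = card (carrier H)"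
    and C_comm: "\<lbrakk>b \<in> carrier H; \<forall>z\<in>Z. m b z = z; c \<in> carrier H; \<forall>z\<in>Z. m c z = z\<rbrakk> \<Longrightarrow>
      b \<otimes>\<^bsub>H\<^esub> c = c \<otimes>\<^bsub>H\<^esub> b"
    and ex_lambda: "\<exists>\<theta> :: 'a \<Rightarrow> complex. (\<forall>x\<in>Z. \<forall>y\<in>Z. \<theta> (x \<oplus> y) = \<theta> x * \<theta> y) \<and>
      \<theta> \<zero> = 1 \<and> (\<exists>z\<in>Z. \<theta> z \<noteq> 1)"
    \<comment> \<open>A linear character of the kernel of the action on \<open>Z\<close> that is
      moved by every element outside this kernel; it produces the degree \<open>q\<close>.\<close>
    and ex_kappa: "\<exists>\<kappa> :: 'c \<Rightarrow> complex.
      (\<forall>b\<in>{b \<in> carrier H. \<forall>z\<in>Z. m b z = z}. \<forall>c\<in>{b \<in> carrier H. \<forall>z\<in>Z. m b z = z}.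
         \<kappa> (b \<otimes>\<^bsub>H\<^esub> c) = \<kappa> b * \<kappa> c) \<and> \<kappa> \<one>\<^bsub>H\<^esub> = 1 \<and>
      (\<forall>b\<in>carrier H. b \<notin> {b \<in> carrier H. \<forall>z\<in>Z. m b z = z} \<longrightarrow>
        (\<exists>c\<in>{b \<in> carrier H. \<forall>z\<in>Z. m b z = z}. \<exists>c'\<in>{b \<in> carrier H. \<forall>z\<in>Z. m b z = z}.
          c \<otimes>\<^bsub>H\<^esub> b = b \<otimes>\<^bsub>H\<^esub> c' \<and> \<kappa> c \<noteq> \<kappa> c'))"
    \<comment> \<open>Witnesses that \<open>H\<close> is not nilpotent: \<open>D\<close> avoids the
      identity and reproduces itself under commutators.\<close>
    and ex_D: "\<exists>D \<subseteq> carrier H - {\<one>\<^bsub>H\<^esub>}. D \<noteq> {} \<and>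
      (\<forall>c\<in>D. \<exists>x\<in>carrier H. \<exists>d\<in>D. c \<otimes>\<^bsub>H\<^esub> x = d \<otimes>\<^bsub>H\<^esub> x \<otimes>\<^bsub>H\<^esub> c)"
    and enc_inj: "inj_on enc (carrier K \<times> carrier K \<times> Z \<times> carrier H)"
begin

section \<open>The group operation on quadruples\<close>

definition C where "C = {b \<in> carrier H. \<forall>z\<in>Z. m b z = z}"

definition X where "X = carrier K \<times> carrier K \<times> Z \<times> carrier H"

definition dec where "dec = inv_into X enc"

text \<open>The cocycle \<open>T f w'\<close> is bilinear but not alternating. It vanishes when both
  factors come from the same copy of \<open>K\<close>, so each copy is an abelian subgroup, and the
  commutator of two elements of \<open>P\<close> is \<open>T f w' - T f' w\<close>.\<close>

definition tmult where
  "tmult x y = (case x of (w, f, z, b) \<Rightarrow> case y of (w', f', z', b') \<Rightarrow>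
     (w \<oplus> A b w', f \<oplus> B b f', z \<oplus> m b z' \<oplus> T f (A b w'), b \<otimes>\<^bsub>H\<^esub> b'))"

definition G :: "'e monoid" where
  "G = \<lparr>carrier = enc ` X, monoid.mult = (\<lambda>x y. enc (tmult (dec x) (dec y))),
        one = enc (\<zero>, \<zero>, \<zero>, \<one>\<^bsub>H\<^esub>)\<rparr>"

abbreviation E where "E w f z b \<equiv> enc (w, f, z, b)"

lemma dec_E [simp]:
  "\<lbrakk>w \<in> carrier K; f \<in> carrier K; z \<in> Z; b \<in> carrier H\<rbrakk> \<Longrightarrow> dec (E w f z b) = (w, f, z, b)"
  unfolding dec_def X_def using enc_inj by (intro inv_into_f_f) auto

lemma Z_carrier [simp]: "z \<in> Z \<Longrightarrow> z \<in> carrier K"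
  using Z_sub by blast

lemmas closed [simp] = A_closed B_closed m_closed T_closed Z_add Z_neg Z_zero

lemma E_mem [simp]:
  "\<lbrakk>w \<in> carrier K; f \<in> carrier K; z \<in> Z; b \<in> carrier H\<rbrakk> \<Longrightarrow> E w f z b \<in> carrier G"
  by (auto simp: G_def X_def)

lemma E_cases:
  assumes "x \<in> carrier G"
  obtains w f z b where "w \<in> carrier K" "f \<in> carrier K" "z \<in> Z" "b \<in> carrier H" "x = E w f z b"
  using assms by (auto simp: G_def X_def)

lemma E_eq_iff [simp]:
  "\<lbrakk>w \<in> carrier K; f \<in> carrier K; z \<in> Z; b \<in> carrier H;
    w' \<in> carrier K; f' \<in> carrier K; z' \<in> Z; b' \<in> carrier H\<rbrakk> \<Longrightarrow>
    E w f z b = E w' f' z' b' \<longleftrightarrow> w = w' \<and> f = f' \<and> z = z' \<and> b = b'"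
  using enc_inj by (auto simp: inj_on_def)

lemma mult_E [simp]:
  "\<lbrakk>w \<in> carrier K; f \<in> carrier K; z \<in> Z; b \<in> carrier H;
    w' \<in> carrier K; f' \<in> carrier K; z' \<in> Z; b' \<in> carrier H\<rbrakk> \<Longrightarrow>
    E w f z b \<otimes>\<^bsub>G\<^esub> E w' f' z' b' =
    E (w \<oplus> A b w') (f \<oplus> B b f') (z \<oplus> m b z' \<oplus> T f (A b w')) (b \<otimes>\<^bsub>H\<^esub> b')"
  by (simp add: G_def tmult_def)

lemma one_E: "\<one>\<^bsub>G\<^esub> = E \<zero> \<zero> \<zero> \<one>\<^bsub>H\<^esub>"
  by (simp add: G_def)

lemma neg_zero [simp]: "\<ominus> \<zero> = \<zero>"
  by (metis K.a_inv_closed K.l_zero K.r_neg K.zero_closed)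

lemma A_zero [simp]: "b \<in> carrier H \<Longrightarrow> A b \<zero> = \<zero>"
  by (rule K.additive_zero[of "carrier K"]) (simp_all add: A_add)

lemma B_zero [simp]: "b \<in> carrier H \<Longrightarrow> B b \<zero> = \<zero>"
  by (rule K.additive_zero[of "carrier K"]) (simp_all add: B_add)

lemma m_zero [simp]: "b \<in> carrier H \<Longrightarrow> m b \<zero> = \<zero>"
  by (rule K.additive_zero[of Z]) (simp_all add: m_add)

lemma T_zero_left [simp]: "w \<in> carrier K \<Longrightarrow> T \<zero> w = \<zero>"
  by (rule K.additive_zero[of "carrier K" "\<lambda>f. T f w"]) (simp_all add: T_addl)

lemma T_zero_right [simp]: "f \<in> carrier K \<Longrightarrow> T f \<zero> = \<zero>"
  by (rule K.additive_zero[of "carrier K" "\<lambda>w. T f w"]) (simp_all add: T_addr)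

lemmas act_one [simp] = A_one B_one m_one

text \<open>In the Heisenberg group the inverse is \<open>(- w, - f, T f w - z)\<close>, the term
  \<open>T f w\<close> cancelling the cocycle \<open>T (- f) w\<close>. It is moved by
  \<open>inv b\<close> because the component in \<open>H\<close> stands on the right.\<close>

lemma inverse_mult_E:
  assumes "w \<in> carrier K" "f \<in> carrier K" "z \<in> Z" "b \<in> carrier H"
  shows "E (A (inv\<^bsub>H\<^esub> b) (\<ominus> w)) (B (inv\<^bsub>H\<^esub> b) (\<ominus> f)) (m (inv\<^bsub>H\<^esub> b) (T f w \<oplus> \<ominus> z)) (inv\<^bsub>H\<^esub> b)
    \<otimes>\<^bsub>G\<^esub> E w f z b = \<one>\<^bsub>G\<^esub>"
proof -
  let ?i = "inv\<^bsub>H\<^esub> b"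
  have i: "?i \<in> carrier H" using assms by simp
  have w: "A ?i (\<ominus> w) \<oplus> A ?i w = \<zero>"
    using assms i A_add[of ?i "\<ominus> w" w] by (simp add: K.l_neg)
  have f: "B ?i (\<ominus> f) \<oplus> B ?i f = \<zero>"
    using assms i B_add[of ?i "\<ominus> f" f] by (simp add: K.l_neg)
  have "T (\<ominus> f) w \<oplus> T f w = \<zero>"
    using assms T_addl[of "\<ominus> f" f w] by (simp add: K.l_neg)
  then have neg: "T f w \<oplus> T (\<ominus> f) w = \<zero>" using assms by (simp add: K.a_comm)
  have "m ?i (T f w \<oplus> \<ominus> z) \<oplus> m ?i z \<oplus> T (B ?i (\<ominus> f)) (A ?i w)
      = m ?i (T f w \<oplus> \<ominus> z \<oplus> z \<oplus> T (\<ominus> f) w)"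
    using assms i by (simp add: T_equiv m_add)
  also have "T f w \<oplus> \<ominus> z \<oplus> z \<oplus> T (\<ominus> f) w = \<zero>"
    using assms neg by (simp add: K.a_assoc K.r_neg1 K.r_neg2)
  finally show ?thesis using assms i w f by (simp add: one_E)
qed

sublocale G: group G
proof (rule groupI)
  show "\<one>\<^bsub>G\<^esub> \<in> carrier G" by (simp add: one_E)
next
  fix x y assume "x \<in> carrier G" "y \<in> carrier G"
  then show "x \<otimes>\<^bsub>G\<^esub> y \<in> carrier G" by (elim E_cases) simp
next
  fix x y z assume "x \<in> carrier G" "y \<in> carrier G" "z \<in> carrier G"
  then show "x \<otimes>\<^bsub>G\<^esub> y \<otimes>\<^bsub>G\<^esub> z = x \<otimes>\<^bsub>G\<^esub> (y \<otimes>\<^bsub>G\<^esub> z)"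
    by (elim E_cases)
       (simp add: A_add B_add m_add T_addl T_addr A_mult B_mult m_mult T_equiv K.a_ac H.m_assoc)
next
  fix x assume "x \<in> carrier G"
  then show "\<one>\<^bsub>G\<^esub> \<otimes>\<^bsub>G\<^esub> x = x" by (elim E_cases) (simp add: one_E)
next
  fix x assume "x \<in> carrier G"
  then obtain w f z b where x: "w \<in> carrier K" "f \<in> carrier K" "z \<in> Z" "b \<in> carrier H" "x = E w f z b"
    by (rule E_cases)
  show "\<exists>y\<in>carrier G. y \<otimes>\<^bsub>G\<^esub> x = \<one>\<^bsub>G\<^esub>"
    unfolding x(5) by (rule bexI, rule inverse_mult_E[OF x(1-4)]) (use x in simp)
qed

lemma inv_E:
  assumes "w \<in> carrier K" "f \<in> carrier K" "z \<in> Z" "b \<in> carrier H"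
  shows "inv\<^bsub>G\<^esub> E w f z b =
    E (A (inv\<^bsub>H\<^esub> b) (\<ominus> w)) (B (inv\<^bsub>H\<^esub> b) (\<ominus> f)) (m (inv\<^bsub>H\<^esub> b) (T f w \<oplus> \<ominus> z)) (inv\<^bsub>H\<^esub> b)"
  by (rule G.inv_equality[OF inverse_mult_E[OF assms]]) (use assms in simp_all)

lemma carrier_G: "carrier G = enc ` (carrier K \<times> carrier K \<times> Z \<times> carrier H)"
  by (simp add: G_def X_def)

lemma finZ: "finite Z"
  using Z_sub finK by (rule finite_subset)

lemma fin_G: "finite (carrier G)"
  using finK finH finZ by (simp add: carrier_G)

lemma card_enc_image:
  assumes "W \<subseteq> carrier K" "F \<subseteq> carrier K" "L \<subseteq> carrier H"
  shows "card (enc ` (W \<times> F \<times> Z \<times> L)) = card W * (card F * (card Z * card L))"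
proof -
  have "inj_on enc (W \<times> F \<times> Z \<times> L)" using enc_inj by (rule inj_on_subset) (use assms in auto)
  then show ?thesis by (simp add: card_image card_cartesian_product)
qed

lemma C_I: "b \<in> carrier H \<Longrightarrow> (\<And>z. z \<in> Z \<Longrightarrow> m b z = z) \<Longrightarrow> b \<in> C"
  unfolding C_def by blast

lemma C_carrier [simp]: "c \<in> C \<Longrightarrow> c \<in> carrier H"
  by (simp add: C_def)

lemma C_act [simp]: "c \<in> C \<Longrightarrow> z \<in> Z \<Longrightarrow> m c z = z"
  unfolding C_def by blast

lemma C_subgroup: "subgroup C H"
proof (rule H.subgroupI)
  show "C \<subseteq> carrier H" by (simp add: subsetI)
  have "\<one>\<^bsub>H\<^esub> \<in> C" by (rule C_I) simp_all
  then show "C \<noteq> {}" by blast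
next
  fix a assume a: "a \<in> C"
  have "m (inv\<^bsub>H\<^esub> a) z = z" if "z \<in> Z" for z
    using that a m_mult[of "inv\<^bsub>H\<^esub> a" a z] by simp
  then show "inv\<^bsub>H\<^esub> a \<in> C" using a by (intro C_I) simp_all
next
  fix a b assume "a \<in> C" "b \<in> C"
  then show "a \<otimes>\<^bsub>H\<^esub> b \<in> C" by (intro C_I) (simp_all add: m_mult)
qed

lemma one_C [simp]: "\<one>\<^bsub>H\<^esub> \<in> C"
  using C_subgroup by (rule subgroup.one_closed)

lemma C_conj:
  assumes "b \<in> carrier H" "c \<in> C" shows "b \<otimes>\<^bsub>H\<^esub> c \<otimes>\<^bsub>H\<^esub> inv\<^bsub>H\<^esub> b \<in> C"
proof -
  have "m (b \<otimes>\<^bsub>H\<^esub> c \<otimes>\<^bsub>H\<^esub> inv\<^bsub>H\<^esub> b) z = z" if "z \<in> Z" for z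
    using that assms m_mult[of b "inv\<^bsub>H\<^esub> b" z] by (simp add: m_mult)
  then show ?thesis using assms by (intro C_I) simp_all
qed

text \<open>\<open>H\<close> modulo \<open>C\<close> is abelian, as it acts faithfully on
  \<open>Z\<close> through the commuting maps \<open>m b\<close>.\<close>

lemma C_commutator:
  assumes "b \<in> carrier H" "c \<in> carrier H"
  shows "b \<otimes>\<^bsub>H\<^esub> c \<otimes>\<^bsub>H\<^esub> inv\<^bsub>H\<^esub> (c \<otimes>\<^bsub>H\<^esub> b) \<in> C"
proof -
  have "m (b \<otimes>\<^bsub>H\<^esub> c \<otimes>\<^bsub>H\<^esub> inv\<^bsub>H\<^esub> (c \<otimes>\<^bsub>H\<^esub> b)) z = z" if z: "z \<in> Z" for z
  proof -
    let ?y = "m (inv\<^bsub>H\<^esub> (c \<otimes>\<^bsub>H\<^esub> b)) z"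
    have y: "?y \<in> Z" using z assms by simp
    have "m (b \<otimes>\<^bsub>H\<^esub> c \<otimes>\<^bsub>H\<^esub> inv\<^bsub>H\<^esub> (c \<otimes>\<^bsub>H\<^esub> b)) z = m (b \<otimes>\<^bsub>H\<^esub> c) ?y"
      using assms z by (simp add: m_mult del: H.inv_mult_group)
    also have "\<dots> = m (c \<otimes>\<^bsub>H\<^esub> b) ?y" using assms y m_comm[of b c ?y] by (simp add: m_mult)
    also have "\<dots> = m ((c \<otimes>\<^bsub>H\<^esub> b) \<otimes>\<^bsub>H\<^esub> inv\<^bsub>H\<^esub> (c \<otimes>\<^bsub>H\<^esub> b)) z"
      using assms z by (subst m_mult) auto
    finally show ?thesis using assms z by simp
  qed
  then show ?thesis using assms by (intro C_I) simp_all
qed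

section \<open>The subgroups of the tower and their commutators\<close>

definition \<beta> where "\<beta> x = snd (snd (snd (dec x)))"

lemma \<beta>_E [simp]:
  "\<lbrakk>w \<in> carrier K; f \<in> carrier K; z \<in> Z; b \<in> carrier H\<rbrakk> \<Longrightarrow> \<beta> (E w f z b) = b"
  by (simp add: \<beta>_def)

sublocale \<beta>: group_hom G H \<beta>
proof (unfold_locales, rule homI)
  fix x assume "x \<in> carrier G" then show "\<beta> x \<in> carrier H" by (elim E_cases) simp
next
  fix x y assume "x \<in> carrier G" "y \<in> carrier G"
  then show "\<beta> (x \<otimes>\<^bsub>G\<^esub> y) = \<beta> x \<otimes>\<^bsub>H\<^esub> \<beta> y" by (elim E_cases) simp
qed

definition Zg where "Zg = enc ` ({\<zero>} \<times> {\<zero>} \<times> Z \<times> {\<one>\<^bsub>H\<^esub>})"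
definition Mg where "Mg = enc ` ({\<zero>} \<times> carrier K \<times> Z \<times> {\<one>\<^bsub>H\<^esub>})"
definition Pg where "Pg = enc ` (carrier K \<times> carrier K \<times> Z \<times> {\<one>\<^bsub>H\<^esub>})"
definition Qg where "Qg = enc ` (carrier K \<times> carrier K \<times> Z \<times> C)"
definition Sg where "Sg = enc ` ({\<zero>} \<times> carrier K \<times> Z \<times> C)"

lemma Qg_iff: "x \<in> Qg \<longleftrightarrow> x \<in> carrier G \<and> \<beta> x \<in> C"
  by (auto simp: Qg_def elim!: E_cases)

lemma Pg_iff: "x \<in> Pg \<longleftrightarrow> x \<in> carrier G \<and> \<beta> x = \<one>\<^bsub>H\<^esub>"
  by (auto simp: Pg_def elim!: E_cases)

lemma sub_Z: "subgroup Zg G"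
proof (rule G.subgroupI)
  fix x assume "x \<in> Zg" then show "inv\<^bsub>G\<^esub> x \<in> Zg" by (auto simp: Zg_def inv_E)
next
  fix x y assume "x \<in> Zg" "y \<in> Zg" then show "x \<otimes>\<^bsub>G\<^esub> y \<in> Zg" by (auto simp: Zg_def)
qed (use Z_ne in \<open>auto simp: Zg_def\<close>)

lemma sub_M: "subgroup Mg G"
proof (rule G.subgroupI)
  fix x assume "x \<in> Mg" then show "inv\<^bsub>G\<^esub> x \<in> Mg" by (auto simp: Mg_def inv_E)
next
  fix x y assume "x \<in> Mg" "y \<in> Mg" then show "x \<otimes>\<^bsub>G\<^esub> y \<in> Mg" by (auto simp: Mg_def)
qed (use Z_ne in \<open>auto simp: Mg_def\<close>)

lemma sub_S: "subgroup Sg G"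
proof (rule G.subgroupI)
  fix x assume "x \<in> Sg" then show "inv\<^bsub>G\<^esub> x \<in> Sg"
    using subgroup.m_inv_closed[OF C_subgroup] by (auto simp: Sg_def inv_E)
next
  fix x y assume "x \<in> Sg" "y \<in> Sg" then show "x \<otimes>\<^bsub>G\<^esub> y \<in> Sg"
    using subgroup.m_closed[OF C_subgroup] by (auto simp: Sg_def)
next
  have "E \<zero> \<zero> \<zero> \<one>\<^bsub>H\<^esub> \<in> Sg" unfolding Sg_def by (intro imageI) simp
  then show "Sg \<noteq> {}" by blast
qed (auto simp: Sg_def)

lemma normal_P: "Pg \<lhd> G"
proof -
  have "Pg = kernel G H \<beta>" by (auto simp: kernel_def Pg_iff)
  then show ?thesis using \<beta>.normal_kernel by simp
qed

lemma normal_Q: "Qg \<lhd> G"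
  unfolding G.normal_inv_iff
proof (intro conjI ballI)
  show "subgroup Qg G"
  proof (rule G.subgroupI)
    show "Qg \<noteq> {}" using G.one_closed Qg_iff \<beta>.hom_one one_C by fastforce
  qed (use subgroup.m_inv_closed[OF C_subgroup] subgroup.m_closed[OF C_subgroup] in
         \<open>auto simp: Qg_iff\<close>)
qed (use C_conj in \<open>auto simp: Qg_iff\<close>)

text \<open>Conjugation by \<open>w\<close> shifts the central coordinate by
  \<open>- T (B b f') w\<close>. This shows that \<open>Mg\<close> is normal, and later that a
  nontrivial character of \<open>Z\<close>, extended trivially over the dual copy of
  \<open>K\<close>, is moved by every nonzero \<open>w\<close>.\<close>

lemma M_conj:
  assumes "w \<in> carrier K" "f \<in> carrier K" "z \<in> Z" "b \<in> carrier H" "f' \<in> carrier K" "z' \<in> Z"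
  shows "E w f z b \<otimes>\<^bsub>G\<^esub> E \<zero> f' z' \<one>\<^bsub>H\<^esub> =
    E \<zero> (B b f') (m b z' \<oplus> \<ominus> T (B b f') w) \<one>\<^bsub>H\<^esub> \<otimes>\<^bsub>G\<^esub> E w f z b"
proof -
  have "m b z' \<oplus> \<ominus> T (B b f') w \<oplus> z \<oplus> T (B b f') w = z \<oplus> m b z'"
    using assms by (simp add: K.a_ac K.r_neg K.r_neg1 K.r_neg2)
  then show ?thesis using assms by (simp add: K.a_comm)
qed

lemma normal_M: "Mg \<lhd> G"
  unfolding G.normal_inv_iff
proof (intro conjI ballI sub_M)
  fix x h assume x: "x \<in> carrier G" and h: "h \<in> Mg"
  obtain w f z b where X: "w \<in> carrier K" "f \<in> carrier K" "z \<in> Z" "b \<in> carrier H" "x = E w f z b"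
    using x by (rule E_cases)
  obtain f' z' where F: "f' \<in> carrier K" "z' \<in> Z" "h = E \<zero> f' z' \<one>\<^bsub>H\<^esub>"
    using h by (auto simp: Mg_def)
  let ?a = "E \<zero> (B b f') (m b z' \<oplus> \<ominus> T (B b f') w) \<one>\<^bsub>H\<^esub>"
  have a: "?a \<in> Mg" using X F by (auto simp: Mg_def)
  have aG: "?a \<in> carrier G" using X F by simp
  have "x \<otimes>\<^bsub>G\<^esub> h = ?a \<otimes>\<^bsub>G\<^esub> x" unfolding X(5) F(3) using X F by (intro M_conj)
  then have "x \<otimes>\<^bsub>G\<^esub> h \<otimes>\<^bsub>G\<^esub> inv\<^bsub>G\<^esub> x = ?a" using aG x by (simp add: G.m_assoc)
  then show "x \<otimes>\<^bsub>G\<^esub> h \<otimes>\<^bsub>G\<^esub> inv\<^bsub>G\<^esub> x \<in> Mg" using a by simp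
qed

text \<open>With the commutator written out explicitly, its membership in \<open>Pg\<close> or
  \<open>Qg\<close> is decided by its image under \<open>\<beta>\<close> alone.\<close>

lemma commutator_form:
  assumes "u \<in> carrier G" "v \<in> carrier G"
  shows "u \<otimes>\<^bsub>G\<^esub> v = (u \<otimes>\<^bsub>G\<^esub> v \<otimes>\<^bsub>G\<^esub> inv\<^bsub>G\<^esub> (v \<otimes>\<^bsub>G\<^esub> u)) \<otimes>\<^bsub>G\<^esub> v \<otimes>\<^bsub>G\<^esub> u"
proof -
  let ?y = "v \<otimes>\<^bsub>G\<^esub> u"
  have "u \<otimes>\<^bsub>G\<^esub> v \<otimes>\<^bsub>G\<^esub> inv\<^bsub>G\<^esub> ?y \<otimes>\<^bsub>G\<^esub> v \<otimes>\<^bsub>G\<^esub> u = u \<otimes>\<^bsub>G\<^esub> v \<otimes>\<^bsub>G\<^esub> (inv\<^bsub>G\<^esub> ?y \<otimes>\<^bsub>G\<^esub> ?y)"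
    using assms by (simp add: G.m_assoc del: G.inv_mult_group G.l_inv G.Units_l_inv)
  then show ?thesis using assms by simp
qed

text \<open>An element outside \<open>P\<close> has \<open>b\<close> different from one, which acts
  without nonzero fixed points on both copies of \<open>K\<close>; so both coordinates of
  \<open>v\<close> can be solved for. The remaining discrepancy is central and is absorbed by
  \<open>z'\<close>, which may depend on \<open>z\<close>.\<close>

lemma P_act_free:
  assumes "g \<in> carrier G" "g \<notin> Pg" "u \<in> Pg"
  shows "\<exists>v\<in>Pg. \<forall>z\<in>Zg. \<exists>z'\<in>Zg. g \<otimes>\<^bsub>G\<^esub> (v \<otimes>\<^bsub>G\<^esub> z) = (u \<otimes>\<^bsub>G\<^esub> z') \<otimes>\<^bsub>G\<^esub> (v \<otimes>\<^bsub>G\<^esub> z) \<otimes>\<^bsub>G\<^esub> g"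
proof -
  obtain w0 f0 z0 b where g: "w0 \<in> carrier K" "f0 \<in> carrier K" "z0 \<in> Z" "b \<in> carrier H" "g = E w0 f0 z0 b"
    using assms(1) by (rule E_cases)
  then have b1: "b \<noteq> \<one>\<^bsub>H\<^esub>" using assms(1,2) by (auto simp: Pg_iff)
  obtain w1 f1 z1 where u: "w1 \<in> carrier K" "f1 \<in> carrier K" "z1 \<in> Z" "u = E w1 f1 z1 \<one>\<^bsub>H\<^esub>"
    using assms(3) by (auto simp: Pg_def)
  obtain w where w: "w \<in> carrier K" "A b w = w1 \<oplus> w"
    using K.fixed_point_free_surj[of "carrier K" "A b" w1] finK A_free[of b] b1 g u by (auto simp: A_add)
  obtain f where f: "f \<in> carrier K" "B b f = f1 \<oplus> f"
    using K.fixed_point_free_surj[of "carrier K" "B b" f1] finK B_free[of b] b1 g u by (auto simp: B_add)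
  let ?v = "E w f \<zero> \<one>\<^bsub>H\<^esub>"
  have "\<exists>z'\<in>Zg. g \<otimes>\<^bsub>G\<^esub> (?v \<otimes>\<^bsub>G\<^esub> z) = (u \<otimes>\<^bsub>G\<^esub> z') \<otimes>\<^bsub>G\<^esub> (?v \<otimes>\<^bsub>G\<^esub> z) \<otimes>\<^bsub>G\<^esub> g" if zZ: "z \<in> Zg" for z
  proof -
    obtain \<zeta> where z: "\<zeta> \<in> Z" "z = E \<zero> \<zero> \<zeta> \<one>\<^bsub>H\<^esub>" using zZ by (auto simp: Zg_def)
    \<comment> \<open>\<open>l\<close> and \<open>r\<close> are the central coordinates of the two
      sides before \<open>z'\<close> is inserted, so \<open>z'\<close> has to be their
      difference.\<close>
    define l where "l = z0 \<oplus> m b \<zeta> \<oplus> T f0 (w1 \<oplus> w)"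
    define r where "r = z1 \<oplus> \<zeta> \<oplus> T f1 w \<oplus> z0 \<oplus> T (f1 \<oplus> f) w0"
    have lr: "l \<in> Z" "r \<in> Z" using g u w f z by (simp_all add: l_def r_def)
    let ?z' = "E \<zero> \<zero> (l \<oplus> \<ominus> r) \<one>\<^bsub>H\<^esub>"
    have "g \<otimes>\<^bsub>G\<^esub> (?v \<otimes>\<^bsub>G\<^esub> z) = E (w0 \<oplus> (w1 \<oplus> w)) (f0 \<oplus> (f1 \<oplus> f)) l b"
      using g w f z u by (simp add: l_def)
    moreover have "(u \<otimes>\<^bsub>G\<^esub> ?z') \<otimes>\<^bsub>G\<^esub> (?v \<otimes>\<^bsub>G\<^esub> z) \<otimes>\<^bsub>G\<^esub> g
      = E (w1 \<oplus> w \<oplus> w0) (f1 \<oplus> f \<oplus> f0) (z1 \<oplus> (l \<oplus> \<ominus> r) \<oplus> \<zeta> \<oplus> T f1 w \<oplus> z0 \<oplus> T (f1 \<oplus> f) w0) b"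
      using g w(1) f(1) z u lr by simp
    moreover have "z1 \<oplus> (l \<oplus> \<ominus> r) \<oplus> \<zeta> \<oplus> T f1 w \<oplus> z0 \<oplus> T (f1 \<oplus> f) w0 = (l \<oplus> \<ominus> r) \<oplus> r"
      unfolding r_def[symmetric]
      using lr g w(1) f(1) z u by (subst (2) r_def) (simp add: K.a_ac)
    moreover have "(l \<oplus> \<ominus> r) \<oplus> r = l" using lr by (simp add: K.a_assoc K.l_neg)
    ultimately have "g \<otimes>\<^bsub>G\<^esub> (?v \<otimes>\<^bsub>G\<^esub> z) = (u \<otimes>\<^bsub>G\<^esub> ?z') \<otimes>\<^bsub>G\<^esub> (?v \<otimes>\<^bsub>G\<^esub> z) \<otimes>\<^bsub>G\<^esub> g"
      using g w(1) f(1) u by (simp add: K.a_ac)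
    then show ?thesis using lr by (auto simp: Zg_def)
  qed
  moreover have "?v \<in> Pg" using w f by (auto simp: Pg_def)
  ultimately show ?thesis by blast
qed

lemma Z_subset_P: "Zg \<subseteq> Pg" and P_subset_Q: "Pg \<subseteq> Qg"
  by (auto simp: Zg_def Pg_def Qg_def)

lemma Z_central: "\<lbrakk>z \<in> Zg; u \<in> Pg\<rbrakk> \<Longrightarrow> z \<otimes>\<^bsub>G\<^esub> u = u \<otimes>\<^bsub>G\<^esub> z"
  by (auto simp: Zg_def Pg_def K.a_comm)

lemma comm_P: 
  assumes "u \<in> Pg" "v \<in> Pg" shows "\<exists>z\<in>Zg. u \<otimes>\<^bsub>G\<^esub> v = z \<otimes>\<^bsub>G\<^esub> v \<otimes>\<^bsub>G\<^esub> u"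
proof -
  obtain w f z where u: "w \<in> carrier K" "f \<in> carrier K" "z \<in> Z" "u = E w f z \<one>\<^bsub>H\<^esub>"
    using assms by (auto simp: Pg_def)
  obtain w' f' z' where v: "w' \<in> carrier K" "f' \<in> carrier K" "z' \<in> Z" "v = E w' f' z' \<one>\<^bsub>H\<^esub>"
    using assms by (auto simp: Pg_def)
  let ?z = "E \<zero> \<zero> (T f w' \<oplus> \<ominus> T f' w) \<one>\<^bsub>H\<^esub>"
  have "T f w' \<oplus> \<ominus> T f' w \<oplus> z' \<oplus> z \<oplus> T f' w = z \<oplus> z' \<oplus> T f w'"
    using u v by (simp add: K.a_ac K.r_neg K.r_neg1 K.r_neg2 K.add_minus_cancel_mid)
  then have "u \<otimes>\<^bsub>G\<^esub> v = ?z \<otimes>\<^bsub>G\<^esub> v \<otimes>\<^bsub>G\<^esub> u" using u v by (simp add: K.a_comm)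
  then show ?thesis using u v by (auto simp: Zg_def)
qed

lemma comm_Q:
  assumes "u \<in> Qg" "v \<in> Qg" shows "\<exists>z\<in>Pg. u \<otimes>\<^bsub>G\<^esub> v = z \<otimes>\<^bsub>G\<^esub> v \<otimes>\<^bsub>G\<^esub> u"
proof -
  have uv: "u \<in> carrier G" "v \<in> carrier G" "\<beta> u \<in> C" "\<beta> v \<in> C" using assms by (auto simp: Qg_iff)
  then have "\<beta> u \<otimes>\<^bsub>H\<^esub> \<beta> v = \<beta> v \<otimes>\<^bsub>H\<^esub> \<beta> u" using C_comm[of "\<beta> u" "\<beta> v"] by simp
  then have "u \<otimes>\<^bsub>G\<^esub> v \<otimes>\<^bsub>G\<^esub> inv\<^bsub>G\<^esub> (v \<otimes>\<^bsub>G\<^esub> u) \<in> Pg"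
    using uv by (simp add: Pg_iff del: G.inv_mult_group H.inv_mult_group)
  then show ?thesis using commutator_form[OF uv(1,2)] by blast
qed

lemma comm_G:
  assumes "u \<in> carrier G" "v \<in> carrier G" shows "\<exists>z\<in>Qg. u \<otimes>\<^bsub>G\<^esub> v = z \<otimes>\<^bsub>G\<^esub> v \<otimes>\<^bsub>G\<^esub> u"
proof -
  have "u \<otimes>\<^bsub>G\<^esub> v \<otimes>\<^bsub>G\<^esub> inv\<^bsub>G\<^esub> (v \<otimes>\<^bsub>G\<^esub> u) \<in> Qg"
    using assms C_commutator by (simp add: Qg_iff del: G.inv_mult_group H.inv_mult_group)
  then show ?thesis using commutator_form[OF assms] by blast
qed

lemma nonzero_exists: "\<exists>w\<in>carrier K. w \<noteq> \<zero>"
  using Z_ne Z_sub by blast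

lemma Z_commutators:
  assumes "z \<in> Zg" shows "\<exists>u\<in>Pg. \<exists>v\<in>Pg. u \<otimes>\<^bsub>G\<^esub> v = z \<otimes>\<^bsub>G\<^esub> v \<otimes>\<^bsub>G\<^esub> u"
proof -
  obtain \<zeta> where z: "\<zeta> \<in> Z" "z = E \<zero> \<zero> \<zeta> \<one>\<^bsub>H\<^esub>" using assms by (auto simp: Zg_def)
  obtain w where w: "w \<in> carrier K" "w \<noteq> \<zero>" using nonzero_exists by blast
  obtain f where f: "f \<in> carrier K" "T f w = \<zeta>" using T_surjl w z by blast
  show ?thesis
  proof (intro bexI)
    show "E \<zero> f \<zero> \<one>\<^bsub>H\<^esub> \<otimes>\<^bsub>G\<^esub> E w \<zero> \<zero> \<one>\<^bsub>H\<^esub> = z \<otimes>\<^bsub>G\<^esub> E w \<zero> \<zero> \<one>\<^bsub>H\<^esub> \<otimes>\<^bsub>G\<^esub> E \<zero> f \<zero> \<one>\<^bsub>H\<^esub>"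
      using z w f by simp
  qed (use w f in \<open>auto simp: Pg_def\<close>)
qed

text \<open>The set \<open>D\<close> of the tower is the full preimage of the one in
  \<open>H\<close>; it avoids \<open>Pg\<close> because \<open>Pg\<close> is the kernel of
  \<open>\<beta>\<close>.\<close>

lemma tower_G: "\<exists>D. tower G Zg Pg Qg D"
proof -
  obtain D where D: "D \<subseteq> carrier H - {\<one>\<^bsub>H\<^esub>}" "D \<noteq> {}"
    and D_step: "\<forall>c\<in>D. \<exists>x\<in>carrier H. \<exists>d\<in>D. c \<otimes>\<^bsub>H\<^esub> x = d \<otimes>\<^bsub>H\<^esub> x \<otimes>\<^bsub>H\<^esub> c"
    using ex_D by (elim exE conjE)
  have "tower G Zg Pg Qg {x \<in> carrier G. \<beta> x \<in> D}"
  proof (intro tower.intro tower_axioms.intro, goal_cases)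
    case 7
    obtain z where "z \<in> Z" "z \<noteq> \<zero>" using Z_ne by blast
    then show ?case by (intro bexI[of _ "E \<zero> \<zero> z \<one>\<^bsub>H\<^esub>"]) (auto simp: Zg_def one_E)
  next
    case 15
    then show ?case using D by (auto simp: Pg_iff)
  next
    case 16
    obtain d where "d \<in> D" using D by blast
    then have "E \<zero> \<zero> \<zero> d \<in> {x \<in> carrier G. \<beta> x \<in> D}" using D by auto
    then show ?case by blast
  next
    case (17 c)
    then have c: "c \<in> carrier G" "\<beta> c \<in> D" by auto
    obtain x d where x: "x \<in> carrier H" "d \<in> D" "\<beta> c \<otimes>\<^bsub>H\<^esub> x = d \<otimes>\<^bsub>H\<^esub> x \<otimes>\<^bsub>H\<^esub> \<beta> c"
      using D_step c(2) by blast
    have dH: "d \<in> carrier H" "\<beta> c \<in> carrier H" using x D c by auto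
    let ?x = "E \<zero> \<zero> \<zero> x"
    let ?d = "c \<otimes>\<^bsub>G\<^esub> ?x \<otimes>\<^bsub>G\<^esub> inv\<^bsub>G\<^esub> (?x \<otimes>\<^bsub>G\<^esub> c)"
    have xG: "?x \<in> carrier G" using x by simp
    have "\<beta> ?d = \<beta> c \<otimes>\<^bsub>H\<^esub> x \<otimes>\<^bsub>H\<^esub> inv\<^bsub>H\<^esub> (x \<otimes>\<^bsub>H\<^esub> \<beta> c)"
      using c x xG by (simp del: G.inv_mult_group H.inv_mult_group)
    also have "\<dots> = d \<otimes>\<^bsub>H\<^esub> ((x \<otimes>\<^bsub>H\<^esub> \<beta> c) \<otimes>\<^bsub>H\<^esub> inv\<^bsub>H\<^esub> (x \<otimes>\<^bsub>H\<^esub> \<beta> c))"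
      unfolding x(3) using x dH by (simp add: H.m_assoc del: H.inv_mult_group H.r_inv H.Units_r_inv)
    also have "\<dots> = d" using x dH by (simp del: H.inv_mult_group)
    finally have "?d \<in> {x \<in> carrier G. \<beta> x \<in> D}" using c xG x by simp
    then show ?case using commutator_form[OF c(1) xG] xG by blast
  qed (use sub_Z normal_P normal_Q Z_subset_P P_subset_Q Z_central comm_P comm_Q comm_G Z_commutators
      P_act_free G.is_group in auto)
  then show ?thesis by blast
qed

end

lemma (in abelian_group) additive_character_sum_zero:
  assumes fin: "finite (carrier G)"
    and h: "\<And>x y. x \<in> carrier G \<Longrightarrow> y \<in> carrier G \<Longrightarrow> h (x \<oplus> y) = h x * (h y :: complex)"
    and w: "w \<in> carrier G" "h w \<noteq> 1"
  shows "(\<Sum>x\<in>carrier G. h x) = 0"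
proof -
  have bij: "bij_betw (\<lambda>x. w \<oplus> x) (carrier G) (carrier G)"
    by (rule bij_betwI[of _ _ _ "\<lambda>x. \<ominus> w \<oplus> x"]) (use w in \<open>auto simp: r_neg1 r_neg2\<close>)
  have "(\<Sum>x\<in>carrier G. h x) = (\<Sum>x\<in>carrier G. h (w \<oplus> x))"
    using sum.reindex_bij_betw[OF bij, of h] by simp
  also have "\<dots> = h w * (\<Sum>x\<in>carrier G. h x)" using h w by (simp add: sum_distrib_left)
  finally show ?thesis using w by simp
qed

lemma eigenspace_subspace:
  assumes "M \<in> carrier_mat n n"
  shows "is_subspace n {v \<in> carrier_vec n. M *\<^sub>v v = (c::complex) \<cdot>\<^sub>v v}"
  unfolding is_subspace_def
  using assms by (auto simp: mult_add_distrib_mat_vec mult_mat_vec smult_add_distrib_vec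
      smult_smult_assoc mult.commute mult_mat_vec_zero)

lemma smult_vec_cancel:
  assumes "v \<in> carrier_vec n" "v \<noteq> 0\<^sub>v n" "a \<cdot>\<^sub>v v = b \<cdot>\<^sub>v (v :: complex vec)"
  shows "a = b"
proof -
  obtain i where i: "i < n" "v $ i \<noteq> 0" using assms(1,2) by (metis carrier_vecD eq_vecI index_zero_vec)
  have "(a \<cdot>\<^sub>v v) $ i = (b \<cdot>\<^sub>v v) $ i" using assms(3) by simp
  then show ?thesis using i assms(1) by simp
qed

lemma rep_commute:
  assumes "is_rep G n \<rho>" "a \<in> carrier G" "b \<in> carrier G" "\<rho> (a \<otimes>\<^bsub>G\<^esub> b) = \<rho> (b \<otimes>\<^bsub>G\<^esub> a)" "v \<in> carrier_vec n"
  shows "\<rho> a *\<^sub>v (\<rho> b *\<^sub>v v) = \<rho> b *\<^sub>v (\<rho> a *\<^sub>v v)"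
  using is_repD(4)[OF assms(1-3,5)] is_repD(4)[OF assms(1,3,2,5)] assms(4) by simp

text \<open>The search for a common eigenvector is confined to an eigenspace of
  \<open>\<rho> d\<close> with eigenvalue other than one. It is invariant because the images
  commute, and the resulting character is nontrivial at \<open>d\<close> by construction.\<close>

lemma (in group) common_eigenvector_nontrivial:
  assumes fin: "finite (carrier G)" and rep: "is_rep G n \<rho>" and Q: "subgroup Q G"
    and comm: "\<And>a b. a \<in> Q \<Longrightarrow> b \<in> Q \<Longrightarrow> \<rho> (a \<otimes> b) = \<rho> (b \<otimes> a)"
    and d: "d \<in> Q" "\<rho> d \<noteq> 1\<^sub>m n"
  obtains v \<chi> where "v \<in> carrier_vec n" "v \<noteq> 0\<^sub>v n" "\<And>s. s \<in> Q \<Longrightarrow> \<rho> s *\<^sub>v v = \<chi> s \<cdot>\<^sub>v v"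
    "\<chi> d \<noteq> 1" "\<And>a b. a \<in> Q \<Longrightarrow> b \<in> Q \<Longrightarrow> \<chi> (a \<otimes> b) = \<chi> a * \<chi> b" "\<chi> \<one> = 1"
    "\<And>s. s \<in> Q \<Longrightarrow> \<chi> s \<noteq> 0" "\<And>s. s \<in> Q \<Longrightarrow> \<rho> s = 1\<^sub>m n \<Longrightarrow> \<chi> s = 1"
proof -
  have QG: "Q \<subseteq> carrier G" using Q by (rule subgroup.subset)
  then have dG: "d \<in> carrier G" using d by auto
  obtain v0 c0 where v0: "v0 \<in> carrier_vec n" "v0 \<noteq> 0\<^sub>v n" "\<rho> d *\<^sub>v v0 = c0 \<cdot>\<^sub>v v0" "c0 \<noteq> 1"
    using nontrivial_eigenvector[OF fin rep dG d(2)] by blast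
  let ?W = "{v \<in> carrier_vec n. \<rho> d *\<^sub>v v = c0 \<cdot>\<^sub>v v}"
  have W: "is_subspace n ?W" by (rule eigenspace_subspace) (rule is_repD(1)[OF rep dG])
  have inv: "\<rho> b *\<^sub>v x \<in> ?W" if b: "b \<in> Q" and x: "x \<in> ?W" for b x
  proof -
    have bG: "b \<in> carrier G" using b QG by auto
    have xc: "x \<in> carrier_vec n" "\<rho> d *\<^sub>v x = c0 \<cdot>\<^sub>v x" using x by auto
    have "\<rho> d *\<^sub>v (\<rho> b *\<^sub>v x) = \<rho> b *\<^sub>v (\<rho> d *\<^sub>v x)"
      by (rule rep_commute[OF rep dG bG comm[OF d(1) b] xc(1)])
    also have "\<dots> = c0 \<cdot>\<^sub>v (\<rho> b *\<^sub>v x)"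
      unfolding xc(2) by (rule mult_mat_vec[OF is_repD(1)[OF rep bG] xc(1)])
    finally show ?thesis using is_repD(5)[OF rep bG xc(1)] by simp
  qed
  obtain v where v: "v \<in> ?W" "v \<noteq> 0\<^sub>v n" "\<forall>b\<in>Q. \<exists>c. \<rho> b *\<^sub>v v = c \<cdot>\<^sub>v v"
    using common_eigenvector[OF fin rep W, of v0 Q] v0 QG comm inv by blast
  then have vc: "v \<in> carrier_vec n" and vd: "\<rho> d *\<^sub>v v = c0 \<cdot>\<^sub>v v" by auto
  obtain \<chi> where \<chi>: "\<And>s. s \<in> Q \<Longrightarrow> \<rho> s *\<^sub>v v = \<chi> s \<cdot>\<^sub>v v" using v(3) by metis
  have mult: "\<chi> (a \<otimes> b) = \<chi> a * \<chi> b" if ab: "a \<in> Q" "b \<in> Q" for a b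
  proof (rule smult_vec_cancel[OF vc v(2)])
    have G: "a \<in> carrier G" "b \<in> carrier G" using ab QG by auto
    have "\<chi> (a \<otimes> b) \<cdot>\<^sub>v v = \<rho> a *\<^sub>v (\<rho> b *\<^sub>v v)"
      using \<chi>[of "a \<otimes> b"] is_repD(4)[OF rep G vc] ab Q by (simp add: subgroup.m_closed)
    also have "\<dots> = \<chi> b \<cdot>\<^sub>v (\<rho> a *\<^sub>v v)"
      unfolding \<chi>[OF ab(2)] by (rule mult_mat_vec[OF is_repD(1)[OF rep G(1)] vc])
    finally show "\<chi> (a \<otimes> b) \<cdot>\<^sub>v v = (\<chi> a * \<chi> b) \<cdot>\<^sub>v v"
      using \<chi>[OF ab(1)] by (simp add: smult_smult_assoc mult.commute)
  qed
  have triv: "\<chi> s = 1" if s: "s \<in> Q" "\<rho> s = 1\<^sub>m n" for s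
    using \<chi>[OF s(1)] s(2) vc by (intro smult_vec_cancel[OF vc v(2)]) simp
  have oneQ: "\<one> \<in> Q" using Q by (rule subgroup.one_closed)
  have one: "\<chi> \<one> = 1" using triv[OF oneQ] is_repD(2)[OF rep] by blast
  have nz: "\<chi> s \<noteq> 0" if s: "s \<in> Q" for s
  proof -
    have "\<chi> s * \<chi> (inv s) = 1" using mult[OF s subgroup.m_inv_closed[OF Q s]] s QG one by auto
    then show ?thesis by auto
  qed
  have "\<chi> d = c0" using \<chi>[OF d(1)] vd by (intro smult_vec_cancel[OF vc v(2)]) simp
  then have "\<chi> d \<noteq> 1" using v0 by simp
  then show thesis using that[OF vc v(2) \<chi> _ mult one nz triv] by blast
qed

section \<open>The four degrees occur\<close>

context heis
begin

lemma card_G: "card (carrier G) = card (carrier K) * (card (carrier K) * (card Z * card (carrier H)))"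
  unfolding carrier_G by (rule card_enc_image) auto

lemma card_Pg: "card (carrier H) * card Pg = card (carrier G)"
  unfolding card_G Pg_def using card_enc_image[of "carrier K" "carrier K" "{\<one>\<^bsub>H\<^esub>}"] by simp

lemma card_Qg: "q * card Qg = card (carrier G)"
  unfolding card_G Qg_def using card_enc_image[of "carrier K" "carrier K" C] card_C
  by (simp add: subsetI C_def[symmetric] mult.left_commute[of q])

lemma card_Sg: "card (carrier K) * q * card Sg = card (carrier G)"
  unfolding card_G Sg_def using card_enc_image[of "{\<zero>}" "carrier K" C] card_C
  by (simp add: subsetI C_def[symmetric] mult.left_commute[of q] mult.assoc)

text \<open>Stability of the character given by \<open>\<theta>\<close> on \<open>Z\<close> and
  trivial on the dual copy is the identity \<open>key\<close>. Taking \<open>f\<close> zero shows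
  that \<open>m b\<close> fixes \<open>\<theta>\<close>; for \<open>b\<close> outside
  \<open>C\<close> the map \<open>m b - 1\<close> is onto \<open>Z\<close>, and
  \<open>\<theta>\<close> would be trivial. Taking \<open>z\<close> zero shows that pairing with
  \<open>w0\<close> stays in the kernel of \<open>\<theta>\<close>, so \<open>w0\<close> is
  zero.\<close>

lemma inertia_S:
  assumes hom: "\<And>x y. x \<in> Z \<Longrightarrow> y \<in> Z \<Longrightarrow> \<theta> (x \<oplus> y) = \<theta> x * (\<theta> y :: complex)" and one: "\<theta> \<zero> = 1"
    and z1: "z1 \<in> Z" "\<theta> z1 \<noteq> 1"
    and \<chi>: "\<And>f z. f \<in> carrier K \<Longrightarrow> z \<in> Z \<Longrightarrow> \<chi> (E \<zero> f z \<one>\<^bsub>H\<^esub>) = \<theta> z"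
    and g: "g \<in> carrier G"
    and inv: "\<And>a a'. a \<in> Mg \<Longrightarrow> a' \<in> Mg \<Longrightarrow> a \<otimes>\<^bsub>G\<^esub> g = g \<otimes>\<^bsub>G\<^esub> a' \<Longrightarrow> \<chi> a = \<chi> a'"
  shows "g \<in> Sg"
proof -
  obtain w0 f0 z0 b where E: "w0 \<in> carrier K" "f0 \<in> carrier K" "z0 \<in> Z" "b \<in> carrier H" "g = E w0 f0 z0 b"
    using g by (rule E_cases)
  have key: "\<theta> (m b z \<oplus> \<ominus> T (B b f) w0) = \<theta> z" if fz: "f \<in> carrier K" "z \<in> Z" for f z
  proof -
    let ?a = "E \<zero> (B b f) (m b z \<oplus> \<ominus> T (B b f) w0) \<one>\<^bsub>H\<^esub>" and ?a' = "E \<zero> f z \<one>\<^bsub>H\<^esub>"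
    have "?a \<otimes>\<^bsub>G\<^esub> g = g \<otimes>\<^bsub>G\<^esub> ?a'" unfolding E(5) by (rule M_conj[symmetric]) (use E fz in auto)
    moreover have "?a \<in> Mg" "?a' \<in> Mg" using E fz by (auto simp: Mg_def)
    ultimately have "\<chi> ?a = \<chi> ?a'" by (intro inv)
    then show ?thesis using \<chi> E fz by simp
  qed
  have nz: "\<theta> x \<noteq> 0" if x: "x \<in> Z" for x
  proof
    assume "\<theta> x = 0"
    then have "\<theta> (x \<oplus> \<ominus> x) = 0" using hom[of x "\<ominus> x"] x by simp
    then show False using one x by (simp add: K.r_neg)
  qed
  have b: "b \<in> C"
  proof (rule ccontr)
    assume "b \<notin> C"
    then have fpf: "z = \<zero>" if "z \<in> Z" "m b z = z" for z
      using that m_free[OF E(4)] C_I[OF E(4)] by blast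
    obtain x where x: "x \<in> Z" "m b x = z1 \<oplus> x"
      using K.fixed_point_free_surj[of Z "m b" z1] Z_sub finZ z1(1) fpf E(4) m_add by auto
    have "\<theta> (z1 \<oplus> x) = \<theta> x" using key[of \<zero> x] x E z1 by simp
    then show False using hom[OF z1(1) x(1)] nz[OF x(1)] z1 by simp
  qed
  have "w0 = \<zero>"
  proof (rule ccontr)
    assume "w0 \<noteq> \<zero>"
    then obtain f where f: "f \<in> carrier K" "T f w0 = \<ominus> z1" using T_surjl[of w0 "\<ominus> z1"] E z1 by auto
    let ?f = "B (inv\<^bsub>H\<^esub> b) f"
    have "B b ?f = f" using f E B_mult[of b "inv\<^bsub>H\<^esub> b" f] by simp
    then have "\<theta> z1 = 1" using key[of ?f \<zero>] f E z1 one by simp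
    then show False using z1 by simp
  qed
  then show ?thesis using E b by (auto simp: Sg_def)
qed

lemma one_in_char_degrees: "1 \<in> char_degrees G"
  by (rule G.index_in_char_degrees[OF fin_G G.subgroup_self _ G.normal_self, of _ "\<lambda>_. 1"]) auto

lemma q_in_char_degrees: "q \<in> char_degrees G"
proof -
  obtain \<kappa> :: "'c \<Rightarrow> complex" where \<kappa>: "\<forall>b\<in>C. \<forall>c\<in>C. \<kappa> (b \<otimes>\<^bsub>H\<^esub> c) = \<kappa> b * \<kappa> c" "\<kappa> \<one>\<^bsub>H\<^esub> = 1"
    "\<forall>b\<in>carrier H. b \<notin> C \<longrightarrow> (\<exists>c\<in>C. \<exists>c'\<in>C. c \<otimes>\<^bsub>H\<^esub> b = b \<otimes>\<^bsub>H\<^esub> c' \<and> \<kappa> c \<noteq> \<kappa> c')"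
    using ex_kappa unfolding C_def[symmetric] by (elim exE conjE)
  show ?thesis
  proof (rule G.index_in_char_degrees[OF fin_G _ card_Qg normal_Q, of "\<lambda>x. \<kappa> (\<beta> x)"])
    show "subgroup Qg G" using normal_Q by (rule normal_imp_subgroup)
    show "\<kappa> (\<beta> (s \<otimes>\<^bsub>G\<^esub> t)) = \<kappa> (\<beta> s) * \<kappa> (\<beta> t)" if "s \<in> Qg" "t \<in> Qg" for s t
      using that \<kappa>(1) by (simp add: Qg_iff)
    show "\<kappa> (\<beta> \<one>\<^bsub>G\<^esub>) = 1" using \<kappa>(2) by simp
  next
    fix g assume g: "g \<in> carrier G"
      and stab: "\<And>a a'. a \<in> Qg \<Longrightarrow> a' \<in> Qg \<Longrightarrow> a \<otimes>\<^bsub>G\<^esub> g = g \<otimes>\<^bsub>G\<^esub> a' \<Longrightarrow> \<kappa> (\<beta> a) = \<kappa> (\<beta> a')"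
    show "g \<in> Qg"
    proof (rule ccontr)
      assume "g \<notin> Qg"
      then have "\<beta> g \<notin> C" "\<beta> g \<in> carrier H" using g by (simp_all add: Qg_iff)
      then obtain c c' where c: "c \<in> C" "c' \<in> C" "c \<otimes>\<^bsub>H\<^esub> \<beta> g = \<beta> g \<otimes>\<^bsub>H\<^esub> c'" "\<kappa> c \<noteq> \<kappa> c'"
        using \<kappa>(3) by blast
      let ?a = "E \<zero> \<zero> \<zero> c"
      let ?a' = "inv\<^bsub>G\<^esub> g \<otimes>\<^bsub>G\<^esub> (?a \<otimes>\<^bsub>G\<^esub> g)"
      have a: "?a \<in> carrier G" using c by simp
      have bc: "\<beta> g \<in> carrier H" "c' \<in> carrier H" using g c by simp_all
      have "\<beta> ?a' = inv\<^bsub>H\<^esub> \<beta> g \<otimes>\<^bsub>H\<^esub> (\<beta> g \<otimes>\<^bsub>H\<^esub> c')" using g a c by simp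
      also have "\<dots> = c'" using bc by (simp flip: H.m_assoc)
      finally have b: "\<beta> ?a' = c'" .
      have "g \<otimes>\<^bsub>G\<^esub> ?a' = ?a \<otimes>\<^bsub>G\<^esub> g" using g a by (simp flip: G.m_assoc)
      moreover have "?a \<in> Qg" "?a' \<in> Qg" using a c g b by (simp_all add: Qg_iff)
      ultimately have "\<kappa> (\<beta> ?a) = \<kappa> (\<beta> ?a')" using stab by metis
      then show False using b c by simp
    qed
  qed simp
qed

lemma obtain_lambda:
  obtains \<theta> :: "'a \<Rightarrow> complex" and z1 where
    "\<And>x y. x \<in> Z \<Longrightarrow> y \<in> Z \<Longrightarrow> \<theta> (x \<oplus> y) = \<theta> x * \<theta> y" "\<theta> \<zero> = 1" "z1 \<in> Z" "\<theta> z1 \<noteq> 1"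
  using ex_lambda by blast

text \<open>If \<open>g\<close> is outside \<open>P\<close>, then \<open>d\<close> is modulo
  \<open>Z\<close> a commutator of \<open>g\<close> with an element of \<open>P\<close>; a character
  stable under \<open>g\<close> and trivial on \<open>Z\<close> would therefore take the value one
  at \<open>d\<close>.\<close>

lemma not_P_nontrivial_on_commutator:
  fixes \<chi> :: "'e \<Rightarrow> complex"
  assumes hom: "\<And>a b. a \<in> Pg \<Longrightarrow> b \<in> Pg \<Longrightarrow> \<chi> (a \<otimes>\<^bsub>G\<^esub> b) = \<chi> a * \<chi> b"
    and nz: "\<And>a. a \<in> Pg \<Longrightarrow> \<chi> a \<noteq> 0" and Z: "\<And>z. z \<in> Zg \<Longrightarrow> \<chi> z = 1"
    and d: "d \<in> Pg" "\<chi> d \<noteq> 1"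
    and g: "g \<in> carrier G"
    and stab: "\<And>a a'. a \<in> Pg \<Longrightarrow> a' \<in> Pg \<Longrightarrow> a \<otimes>\<^bsub>G\<^esub> g = g \<otimes>\<^bsub>G\<^esub> a' \<Longrightarrow> \<chi> a = \<chi> a'"
  shows "g \<in> Pg"
proof (rule ccontr)
  assume "g \<notin> Pg"
  then obtain v where v: "v \<in> Pg"
    "\<forall>z\<in>Zg. \<exists>z'\<in>Zg. g \<otimes>\<^bsub>G\<^esub> (v \<otimes>\<^bsub>G\<^esub> z) = (d \<otimes>\<^bsub>G\<^esub> z') \<otimes>\<^bsub>G\<^esub> (v \<otimes>\<^bsub>G\<^esub> z) \<otimes>\<^bsub>G\<^esub> g"
    using P_act_free[OF g _ d(1)] by blast
  have sP: "subgroup Pg G" using normal_P by (rule normal_imp_subgroup)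
  have "\<one>\<^bsub>G\<^esub> \<in> Zg" using sub_Z by (rule subgroup.one_closed)
  then obtain z where z: "z \<in> Zg"
    "g \<otimes>\<^bsub>G\<^esub> (v \<otimes>\<^bsub>G\<^esub> \<one>\<^bsub>G\<^esub>) = (d \<otimes>\<^bsub>G\<^esub> z) \<otimes>\<^bsub>G\<^esub> (v \<otimes>\<^bsub>G\<^esub> \<one>\<^bsub>G\<^esub>) \<otimes>\<^bsub>G\<^esub> g"
    using v by blast
  have zP: "z \<in> Pg" using z Z_subset_P by auto
  have vG: "v \<in> carrier G" using v by (simp add: Pg_iff)
  have m: "d \<otimes>\<^bsub>G\<^esub> z \<in> Pg" "d \<otimes>\<^bsub>G\<^esub> z \<otimes>\<^bsub>G\<^esub> v \<in> Pg"
    using zP d v sP by (simp_all add: subgroup.m_closed)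
  have "\<chi> (d \<otimes>\<^bsub>G\<^esub> z \<otimes>\<^bsub>G\<^esub> v) = \<chi> v" using stab[OF m(2) v(1)] z vG by simp
  then have "\<chi> d * \<chi> v = \<chi> v" using hom m zP d v Z[OF z(1)] by simp
  then show False using d nz[OF v(1)] by simp
qed

text \<open>Sending \<open>(w, f, z)\<close> to \<open>\<theta> (T f1 w)\<close> is a linear
  character of \<open>P\<close>, trivial on \<open>Z\<close> and nontrivial by nondegeneracy of
  \<open>T\<close>. Its stabilizer is \<open>P\<close>, whose index is the order of
  \<open>H\<close>.\<close>

lemma card_H_in_char_degrees: "card (carrier H) \<in> char_degrees G"
proof -
  obtain \<theta> :: "'a \<Rightarrow> complex" and z1 where
    \<theta>: "\<And>x y. x \<in> Z \<Longrightarrow> y \<in> Z \<Longrightarrow> \<theta> (x \<oplus> y) = \<theta> x * \<theta> y" "\<theta> \<zero> = 1" "z1 \<in> Z" "\<theta> z1 \<noteq> 1"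
    by (rule obtain_lambda) blast
  obtain f1 where f1: "f1 \<in> carrier K" "f1 \<noteq> \<zero>" using nonzero_exists by blast
  obtain w1 where w1: "w1 \<in> carrier K" "T f1 w1 = z1" using T_surjr[OF f1 \<theta>(3)] by blast
  let ?\<chi> = "\<lambda>x. \<theta> (T f1 (fst (dec x)))"
  have hom: "?\<chi> (s \<otimes>\<^bsub>G\<^esub> t) = ?\<chi> s * ?\<chi> t" if "s \<in> Pg" "t \<in> Pg" for s t
    using that f1 by (auto simp: Pg_def T_addr \<theta>)
  have one: "?\<chi> \<one>\<^bsub>G\<^esub> = 1" using \<theta> f1 by (simp add: one_E)
  have sP: "subgroup Pg G" using normal_P by (rule normal_imp_subgroup)
  have nz: "?\<chi> a \<noteq> 0" if a: "a \<in> Pg" for a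
  proof
    assume "?\<chi> a = 0"
    then have "?\<chi> (a \<otimes>\<^bsub>G\<^esub> inv\<^bsub>G\<^esub> a) = 0" using hom[OF a subgroup.m_inv_closed[OF sP a]] by simp
    then show False using one a by (simp add: Pg_iff)
  qed
  show ?thesis
  proof (rule G.index_in_char_degrees[OF fin_G sP card_Pg normal_P order_refl hom one])
    fix g assume g: "g \<in> carrier G"
      and stab: "\<And>a a'. a \<in> Pg \<Longrightarrow> a' \<in> Pg \<Longrightarrow> a \<otimes>\<^bsub>G\<^esub> g = g \<otimes>\<^bsub>G\<^esub> a' \<Longrightarrow> ?\<chi> a = ?\<chi> a'"
    show "g \<in> Pg"
    proof (rule not_P_nontrivial_on_commutator[where \<chi> = ?\<chi> and d = "E w1 \<zero> \<zero> \<one>\<^bsub>H\<^esub>", OF hom nz _ _ _ g stab])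
      show "?\<chi> z = 1" if "z \<in> Zg" for z using that f1 \<theta> by (auto simp: Zg_def)
      show "E w1 \<zero> \<zero> \<one>\<^bsub>H\<^esub> \<in> Pg" using w1 by (simp add: Pg_iff)
      show "?\<chi> (E w1 \<zero> \<zero> \<one>\<^bsub>H\<^esub>) \<noteq> 1" using w1 \<theta> by simp
    qed
  qed
qed

text \<open>On \<open>Sg\<close> the first coordinate vanishes and \<open>C\<close> fixes
  \<open>Z\<close> pointwise, so the central coordinate is a homomorphism onto \<open>Z\<close>,
  through which \<open>\<theta>\<close> extends to \<open>Sg\<close>.\<close>

lemma card_K_q_in_char_degrees: "card (carrier K) * q \<in> char_degrees G"
proof -
  obtain \<theta> :: "'a \<Rightarrow> complex" and z1 where
    \<theta>: "\<And>x y. x \<in> Z \<Longrightarrow> y \<in> Z \<Longrightarrow> \<theta> (x \<oplus> y) = \<theta> x * \<theta> y" "\<theta> \<zero> = 1" "z1 \<in> Z" "\<theta> z1 \<noteq> 1"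
    by (rule obtain_lambda) blast
  let ?\<chi> = "\<lambda>x. \<theta> (fst (snd (snd (dec x))))"
  show ?thesis
  proof (rule G.index_in_char_degrees[OF fin_G sub_S card_Sg normal_M])
    show "Mg \<subseteq> Sg" by (auto simp: Mg_def Sg_def)
    show "?\<chi> (s \<otimes>\<^bsub>G\<^esub> t) = ?\<chi> s * ?\<chi> t" if "s \<in> Sg" "t \<in> Sg" for s t
      using that by (auto simp: Sg_def \<theta>)
    show "?\<chi> \<one>\<^bsub>G\<^esub> = 1" using \<theta> by (simp add: one_E)
  next
    fix g assume g: "g \<in> carrier G"
      and stab: "\<And>a a'. a \<in> Mg \<Longrightarrow> a' \<in> Mg \<Longrightarrow> a \<otimes>\<^bsub>G\<^esub> g = g \<otimes>\<^bsub>G\<^esub> a' \<Longrightarrow> ?\<chi> a = ?\<chi> a'"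
    have \<chi>: "?\<chi> (E \<zero> f z \<one>\<^bsub>H\<^esub>) = \<theta> z" if "f \<in> carrier K" "z \<in> Z" for f z
      using that by simp
    show "g \<in> Sg"
      by (rule inertia_S[of \<theta> z1 ?\<chi> g]) (fact \<theta> | erule (1) \<chi> | fact g | erule (2) stab)+
  qed
qed

end

section \<open>No other degree occurs\<close>

context heis
begin

text \<open>An eigenvector of \<open>Z\<close> is replaced by one on which the dual copy of
  \<open>K\<close> acts trivially, by averaging over that copy. The space \<open>?U\<close> of such
  vectors is preserved by the abelian group \<open>C\<close>, which supplies an eigenvector of all
  of \<open>Sg\<close>; the degree is then the index of \<open>Sg\<close>.\<close>

lemma degree_Z_nontrivial:
  assumes irr: "irreducible_rep G n \<rho>" and d: "d \<in> Zg" "\<rho> d \<noteq> 1\<^sub>m n"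
  shows "n = card (carrier K) * q"
proof -
  have rep: "is_rep G n \<rho>" using irr by (simp add: irreducible_rep_def)
  have Zcomm: "\<rho> (a \<otimes>\<^bsub>G\<^esub> b) = \<rho> (b \<otimes>\<^bsub>G\<^esub> a)" if "a \<in> Zg" "b \<in> Zg" for a b
    using Z_central[OF that(1), of b] that Z_subset_P by auto
  obtain v \<chi> where v: "v \<in> carrier_vec n" "v \<noteq> 0\<^sub>v n" "\<And>s. s \<in> Zg \<Longrightarrow> \<rho> s *\<^sub>v v = \<chi> s \<cdot>\<^sub>v v"
    and \<chi>: "\<chi> d \<noteq> 1" "\<And>a b. a \<in> Zg \<Longrightarrow> b \<in> Zg \<Longrightarrow> \<chi> (a \<otimes>\<^bsub>G\<^esub> b) = \<chi> a * \<chi> b" "\<chi> \<one>\<^bsub>G\<^esub> = 1"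
    by (rule G.common_eigenvector_nontrivial[OF fin_G rep sub_Z _ d])
        (rule Zcomm, assumption+, rule that, assumption+)
  define \<theta> where "\<theta> z = \<chi> (E \<zero> \<zero> z \<one>\<^bsub>H\<^esub>)" for z
  have Zg_mem: "E \<zero> \<zero> z \<one>\<^bsub>H\<^esub> \<in> Zg" if "z \<in> Z" for z using that by (auto simp: Zg_def)
  have \<theta>_add: "\<theta> (x \<oplus> y) = \<theta> x * \<theta> y" if "x \<in> Z" "y \<in> Z" for x y
    using \<chi>(2)[OF Zg_mem[OF that(1)] Zg_mem[OF that(2)]] that by (simp add: \<theta>_def)
  have \<theta>_one: "\<theta> \<zero> = 1" using \<chi>(3) by (simp add: \<theta>_def one_E)
  obtain z1 where z1: "z1 \<in> Z" "\<theta> z1 \<noteq> 1"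
    using d(1) \<chi>(1) by (auto simp: Zg_def \<theta>_def)
  have vZ: "\<rho> (E \<zero> \<zero> z \<one>\<^bsub>H\<^esub>) *\<^sub>v v = \<theta> z \<cdot>\<^sub>v v" if "z \<in> Z" for z
    using v(3)[OF Zg_mem[OF that]] by (simp add: \<theta>_def)
  note act = is_repD(4)[OF rep, symmetric]
  note cl = is_repD(5)[OF rep]
  let ?F = "\<lambda>f. E \<zero> f \<zero> \<one>\<^bsub>H\<^esub>" and ?W = "\<lambda>w. E w \<zero> \<zero> \<one>\<^bsub>H\<^esub>"
  \<comment> \<open>Up to a factor, the projection of the translate of \<open>v\<close> by
    \<open>w\<close> onto the vectors fixed by the dual copy. A single one of these may vanish, so
    all \<open>w\<close> are considered.\<close>
  define u where "u w = vsum n (\<lambda>f. \<rho> (?F f) *\<^sub>v (\<rho> (?W w) *\<^sub>v v)) (carrier K)" for w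
  have uc: "u w \<in> carrier_vec n" for w by (simp add: u_def)
  have sum0: "(\<Sum>w\<in>carrier K. \<theta> (T f w)) = (if f = \<zero> then of_nat (card (carrier K)) else 0)"
    if f: "f \<in> carrier K" for f
  proof (cases "f = \<zero>")
    case True
    then show ?thesis using \<theta>_one by simp
  next
    case False
    obtain w where w: "w \<in> carrier K" "T f w = z1" using T_surjr[OF f False z1(1)] by blast
    have "(\<Sum>w\<in>carrier K. \<theta> (T f w)) = 0"
      by (rule K.additive_character_sum_zero[OF finK _ w(1)])
         (use f w z1 in \<open>auto simp: T_addr \<theta>_add\<close>)
    then show ?thesis using False by simp
  qed
  \<comment> \<open>Some \<open>u w\<close> is nonzero: by orthogonality their translates add up to a multiple of \<open>v\<close>.\<close>
  have "vsum n (\<lambda>w. \<rho> (?W (\<ominus> w)) *\<^sub>v u w) (carrier K) = of_nat (card (carrier K)) \<cdot>\<^sub>v v"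
  proof (rule eq_vecI)
    fix r assume "r < dim_vec (of_nat (card (carrier K)) \<cdot>\<^sub>v v)"
    then have r: "r < n" using v by simp
    have fv: "\<rho> (?F f) *\<^sub>v v \<in> carrier_vec n" if "f \<in> carrier K" for f using that cl v by simp
    have 1: "\<rho> (?W (\<ominus> w)) *\<^sub>v u w = vsum n (\<lambda>f. \<theta> (T f w) \<cdot>\<^sub>v (\<rho> (?F f) *\<^sub>v v)) (carrier K)"
      if w: "w \<in> carrier K" for w
    proof -
      have "\<rho> (?W (\<ominus> w)) *\<^sub>v u w
          = vsum n (\<lambda>f. \<rho> (?W (\<ominus> w)) *\<^sub>v (\<rho> (?F f) *\<^sub>v (\<rho> (?W w) *\<^sub>v v))) (carrier K)"
        unfolding u_def
        by (rule mult_mat_vec_vsum[of _ n]) (use is_repD(1)[OF rep] cl v w in auto)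
      also have "\<dots> = vsum n (\<lambda>f. \<theta> (T f w) \<cdot>\<^sub>v (\<rho> (?F f) *\<^sub>v v)) (carrier K)"
      proof (rule vsum_cong)
        fix f assume f: "f \<in> carrier K"
        have "\<rho> (?W (\<ominus> w)) *\<^sub>v (\<rho> (?F f) *\<^sub>v (\<rho> (?W w) *\<^sub>v v))
            = \<rho> (?F f \<otimes>\<^bsub>G\<^esub> E \<zero> \<zero> (T f w) \<one>\<^bsub>H\<^esub>) *\<^sub>v v"
          using w f v by (simp add: act cl K.l_neg)
        also have "\<dots> = \<rho> (?F f) *\<^sub>v (\<theta> (T f w) \<cdot>\<^sub>v v)"
          using w f v is_repD(4)[OF rep, of "?F f" "E \<zero> \<zero> (T f w) \<one>\<^bsub>H\<^esub>" v] vZ[of "T f w"] by simp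
        also have "\<dots> = \<theta> (T f w) \<cdot>\<^sub>v (\<rho> (?F f) *\<^sub>v v)"
          by (rule mult_mat_vec[OF is_repD(1)[OF rep] v(1)]) (use f in simp)
        finally show "\<rho> (?W (\<ominus> w)) *\<^sub>v (\<rho> (?F f) *\<^sub>v (\<rho> (?W w) *\<^sub>v v))
            = \<theta> (T f w) \<cdot>\<^sub>v (\<rho> (?F f) *\<^sub>v v)" .
      qed
      finally show ?thesis .
    qed
    have dim: "dim_vec (\<rho> (?F f) *\<^sub>v v) = n" if "f \<in> carrier K" for f
      using fv[OF that] by (rule carrier_vecD)
    have "vsum n (\<lambda>w. \<rho> (?W (\<ominus> w)) *\<^sub>v u w) (carrier K) $ r
        = (\<Sum>w\<in>carrier K. \<Sum>f\<in>carrier K. \<theta> (T f w) * (\<rho> (?F f) *\<^sub>v v) $ r)"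
      using r dim 1 by (simp del: dim_mult_mat_vec)
    also have "\<dots> = (\<Sum>f\<in>carrier K. (\<Sum>w\<in>carrier K. \<theta> (T f w)) * (\<rho> (?F f) *\<^sub>v v) $ r)"
      by (subst sum.swap) (simp add: sum_distrib_right)
    also have "\<dots> = (\<Sum>f\<in>carrier K. if f = \<zero> then of_nat (card (carrier K)) * (\<rho> (?F f) *\<^sub>v v) $ r else 0)"
      by (rule sum.cong) (use sum0 in auto)
    also have "\<dots> = of_nat (card (carrier K)) * (\<rho> (?F \<zero>) *\<^sub>v v) $ r"
      using finK by (simp add: sum.delta)
    also have "\<rho> (?F \<zero>) *\<^sub>v v = v" using is_repD(6)[OF rep v(1)] by (simp add: one_E)
    finally show "vsum n (\<lambda>w. \<rho> (?W (\<ominus> w)) *\<^sub>v u w) (carrier K) $ r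
        = (of_nat (card (carrier K)) \<cdot>\<^sub>v v) $ r" using r v by simp
  qed (use v in simp)
  note sum_u = this
  have "\<exists>w\<in>carrier K. u w \<noteq> 0\<^sub>v n"
  proof (rule ccontr)
    assume "\<not> ?thesis"
    then have u0: "u w = 0\<^sub>v n" if "w \<in> carrier K" for w using that by blast
    have "vsum n (\<lambda>w. \<rho> (?W (\<ominus> w)) *\<^sub>v u w) (carrier K) \<in> {0\<^sub>v n}"
    proof (rule vsum_in_subspace[OF is_subspace_zero finK])
      fix w assume w: "w \<in> carrier K"
      have "\<rho> (?W (\<ominus> w)) \<in> carrier_mat n n" using w by (intro is_repD(1)[OF rep]) simp
      then show "\<rho> (?W (\<ominus> w)) *\<^sub>v u w \<in> {0\<^sub>v n}" using u0[OF w] by (simp add: mult_mat_vec_zero)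
    qed
    then have K0: "of_nat (card (carrier K)) \<cdot>\<^sub>v v \<in> {0\<^sub>v n}" unfolding sum_u .
    have "card (carrier K) \<noteq> 0" using finK K.zero_closed by (metis card_0_eq empty_iff)
    then have "v \<in> {0\<^sub>v n}"
      by (intro smult_in_subspaceD[OF is_subspace_zero _ v(1) K0]) simp
    then show False using v by simp
  qed
  then obtain w where w: "w \<in> carrier K" "u w \<noteq> 0\<^sub>v n" by blast
  let ?U = "{x \<in> carrier_vec n. \<forall>f\<in>carrier K. \<forall>z\<in>Z. \<rho> (E \<zero> f z \<one>\<^bsub>H\<^esub>) *\<^sub>v x = \<theta> z \<cdot>\<^sub>v x}"
  have M_mat: "\<rho> (E \<zero> f z \<one>\<^bsub>H\<^esub>) \<in> carrier_mat n n" if "f \<in> carrier K" "z \<in> Z" for f z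
    using that by (intro is_repD(1)[OF rep]) simp
  have U: "is_subspace n ?U"
    unfolding is_subspace_def
    using M_mat by (auto simp: mult_add_distrib_mat_vec[OF M_mat] mult_mat_vec[OF M_mat] smult_add_distrib_vec
      smult_smult_assoc mult.commute mult_mat_vec_zero[OF M_mat])
  have uU: "u w \<in> ?U"
  proof (intro CollectI conjI ballI uc)
    fix f' z assume f': "f' \<in> carrier K" and z: "z \<in> Z"
    let ?y = "\<rho> (?W w) *\<^sub>v v"
    have y: "?y \<in> carrier_vec n" using w v cl by simp
    have yz: "\<rho> (E \<zero> \<zero> z \<one>\<^bsub>H\<^esub>) *\<^sub>v ?y = \<theta> z \<cdot>\<^sub>v ?y"
    proof -
      have "\<rho> (E \<zero> \<zero> z \<one>\<^bsub>H\<^esub>) *\<^sub>v ?y = \<rho> (?W w) *\<^sub>v (\<rho> (E \<zero> \<zero> z \<one>\<^bsub>H\<^esub>) *\<^sub>v v)"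
        by (rule rep_commute[OF rep _ _ _ v(1)]) (use w z in simp_all)
      also have "\<dots> = \<theta> z \<cdot>\<^sub>v ?y"
        unfolding vZ[OF z] by (rule mult_mat_vec[OF is_repD(1)[OF rep] v(1)]) (use w in simp)
      finally show ?thesis .
    qed
    have 1: "\<rho> (E \<zero> f' z \<one>\<^bsub>H\<^esub>) *\<^sub>v (\<rho> (?F f) *\<^sub>v ?y) = \<theta> z \<cdot>\<^sub>v (\<rho> (?F (f' \<oplus> f)) *\<^sub>v ?y)"
      if f: "f \<in> carrier K" for f
    proof -
      have "\<rho> (E \<zero> f' z \<one>\<^bsub>H\<^esub>) *\<^sub>v (\<rho> (?F f) *\<^sub>v ?y)
          = \<rho> (?F (f' \<oplus> f) \<otimes>\<^bsub>G\<^esub> E \<zero> \<zero> z \<one>\<^bsub>H\<^esub>) *\<^sub>v ?y"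
        using f f' z y is_repD(4)[OF rep, of "E \<zero> f' z \<one>\<^bsub>H\<^esub>" "?F f" ?y] by simp
      also have "\<dots> = \<rho> (?F (f' \<oplus> f)) *\<^sub>v (\<theta> z \<cdot>\<^sub>v ?y)"
        using f f' z y yz is_repD(4)[OF rep, of "?F (f' \<oplus> f)" "E \<zero> \<zero> z \<one>\<^bsub>H\<^esub>" ?y] by simp
      also have "\<dots> = \<theta> z \<cdot>\<^sub>v (\<rho> (?F (f' \<oplus> f)) *\<^sub>v ?y)"
        by (rule mult_mat_vec[OF is_repD(1)[OF rep] y]) (use f f' in simp)
      finally show ?thesis .
    qed
    have bij: "bij_betw (\<lambda>x. f' \<oplus> x) (carrier K) (carrier K)"
      by (rule bij_betwI[of _ _ _ "\<lambda>x. \<ominus> f' \<oplus> x"]) (use f' in \<open>auto simp: K.r_neg1 K.r_neg2\<close>)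
    have "\<rho> (E \<zero> f' z \<one>\<^bsub>H\<^esub>) *\<^sub>v u w = vsum n (\<lambda>f. \<rho> (E \<zero> f' z \<one>\<^bsub>H\<^esub>) *\<^sub>v (\<rho> (?F f) *\<^sub>v ?y)) (carrier K)"
      unfolding u_def by (rule mult_mat_vec_vsum[OF M_mat[OF f' z]]) (use cl y in simp)
    also have "\<dots> = vsum n (\<lambda>f. \<theta> z \<cdot>\<^sub>v (\<rho> (?F (f' \<oplus> f)) *\<^sub>v ?y)) (carrier K)"
      by (rule vsum_cong) (rule 1)
    also have "\<dots> = \<theta> z \<cdot>\<^sub>v vsum n (\<lambda>f. \<rho> (?F (f' \<oplus> f)) *\<^sub>v ?y) (carrier K)"
      by (rule smult_vsum[symmetric]) (use f' cl y in simp)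
    also have "vsum n (\<lambda>f. \<rho> (?F (f' \<oplus> f)) *\<^sub>v ?y) (carrier K) = u w"
      unfolding u_def vsum_def
      using sum.reindex_bij_betw[OF bij, of "\<lambda>f. (\<rho> (?F f) *\<^sub>v ?y) $ _"] by simp
    finally show "\<rho> (E \<zero> f' z \<one>\<^bsub>H\<^esub>) *\<^sub>v u w = \<theta> z \<cdot>\<^sub>v u w" .
  qed
  let ?B = "(\<lambda>c. E \<zero> \<zero> \<zero> c) ` C"
  have "\<exists>v\<in>?U. v \<noteq> 0\<^sub>v n \<and> (\<forall>b\<in>?B. \<exists>c. \<rho> b *\<^sub>v v = c \<cdot>\<^sub>v v)"
  proof (rule G.common_eigenvector[OF fin_G rep U uU w(2)])
    show "?B \<subseteq> carrier G" by auto
    show "\<rho> (a \<otimes>\<^bsub>G\<^esub> b) = \<rho> (b \<otimes>\<^bsub>G\<^esub> a)" if "a \<in> ?B" "b \<in> ?B" for a b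
    proof -
      obtain c c' where c: "c \<in> C" "c' \<in> C" "a = E \<zero> \<zero> \<zero> c" "b = E \<zero> \<zero> \<zero> c'" using \<open>a \<in> ?B\<close> \<open>b \<in> ?B\<close> by auto
      then have "c \<otimes>\<^bsub>H\<^esub> c' = c' \<otimes>\<^bsub>H\<^esub> c" using C_comm[of c c'] by simp
      then show ?thesis using c by simp
    qed
  next
    fix b x assume b: "b \<in> ?B" and x: "x \<in> ?U"
    obtain c where c: "c \<in> C" "b = E \<zero> \<zero> \<zero> c" using b by auto
    have bG: "b \<in> carrier G" using c by simp
    have xc: "x \<in> carrier_vec n" using x by simp
    show "\<rho> b *\<^sub>v x \<in> ?U"
    proof (intro CollectI conjI ballI cl bG xc)
      fix f z assume f: "f \<in> carrier K" and z: "z \<in> Z"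
      \<comment> \<open>Moving \<open>c\<close> past an element of \<open>Mg\<close> changes only
        the coordinate \<open>f\<close>; the central coordinate survives because \<open>c\<close>
        lies in \<open>C\<close>. Hence \<open>?U\<close> is invariant.\<close>
      let ?f = "B (inv\<^bsub>H\<^esub> c) f"
      have ff: "?f \<in> carrier K" "B c ?f = f" using f c B_mult[of c "inv\<^bsub>H\<^esub> c" f] by simp_all
      have eq: "E \<zero> f z \<one>\<^bsub>H\<^esub> \<otimes>\<^bsub>G\<^esub> b = b \<otimes>\<^bsub>G\<^esub> E \<zero> ?f z \<one>\<^bsub>H\<^esub>" using f z c ff by simp
      have "\<rho> (E \<zero> f z \<one>\<^bsub>H\<^esub>) *\<^sub>v (\<rho> b *\<^sub>v x) = \<rho> (b \<otimes>\<^bsub>G\<^esub> E \<zero> ?f z \<one>\<^bsub>H\<^esub>) *\<^sub>v x"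
        unfolding eq[symmetric] using is_repD(4)[OF rep _ bG xc, of "E \<zero> f z \<one>\<^bsub>H\<^esub>"] f z by simp
      also have "\<dots> = \<rho> b *\<^sub>v (\<rho> (E \<zero> ?f z \<one>\<^bsub>H\<^esub>) *\<^sub>v x)"
        by (rule is_repD(4)[OF rep bG _ xc]) (use ff z in simp)
      also have "\<rho> (E \<zero> ?f z \<one>\<^bsub>H\<^esub>) *\<^sub>v x = \<theta> z \<cdot>\<^sub>v x" using x ff z by blast
      also have "\<rho> b *\<^sub>v (\<theta> z \<cdot>\<^sub>v x) = \<theta> z \<cdot>\<^sub>v (\<rho> b *\<^sub>v x)"
        by (rule mult_mat_vec[OF is_repD(1)[OF rep bG] xc])
      finally show "\<rho> (E \<zero> f z \<one>\<^bsub>H\<^esub>) *\<^sub>v (\<rho> b *\<^sub>v x) = \<theta> z \<cdot>\<^sub>v (\<rho> b *\<^sub>v x)" .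
    qed
  qed
  then obtain x where x: "x \<in> ?U" "x \<noteq> 0\<^sub>v n" "\<forall>b\<in>?B. \<exists>c. \<rho> b *\<^sub>v x = c \<cdot>\<^sub>v x" by blast
  have xc: "x \<in> carrier_vec n" using x by simp
  have xM: "\<rho> (E \<zero> f z \<one>\<^bsub>H\<^esub>) *\<^sub>v x = \<theta> z \<cdot>\<^sub>v x" if "f \<in> carrier K" "z \<in> Z" for f z
    using x(1) that by blast
  have "\<exists>e. \<rho> s *\<^sub>v x = e \<cdot>\<^sub>v x" if s: "s \<in> Sg" for s
  proof -
    obtain f z c where s': "f \<in> carrier K" "z \<in> Z" "c \<in> C" "s = E \<zero> f z c" using s by (auto simp: Sg_def)
    obtain e where e: "\<rho> (E \<zero> \<zero> \<zero> c) *\<^sub>v x = e \<cdot>\<^sub>v x" using x(3) s'(3) by blast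
    have "s = E \<zero> f z \<one>\<^bsub>H\<^esub> \<otimes>\<^bsub>G\<^esub> E \<zero> \<zero> \<zero> c" using s' by simp
    then have "\<rho> s *\<^sub>v x = \<rho> (E \<zero> f z \<one>\<^bsub>H\<^esub>) *\<^sub>v (e \<cdot>\<^sub>v x)"
      using is_repD(4)[OF rep _ _ xc, of "E \<zero> f z \<one>\<^bsub>H\<^esub>" "E \<zero> \<zero> \<zero> c"] s'(1-3) e by simp
    also have "\<dots> = e \<cdot>\<^sub>v (\<theta> z \<cdot>\<^sub>v x)"
      using mult_mat_vec[OF M_mat[OF s'(1,2)] xc] xM s' by simp
    finally show ?thesis by (auto simp: smult_smult_assoc)
  qed
  then obtain \<psi> where \<psi>: "\<And>s. s \<in> Sg \<Longrightarrow> \<rho> s *\<^sub>v x = \<psi> s \<cdot>\<^sub>v x" by metis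
  have \<psi>M: "\<psi> (E \<zero> f z \<one>\<^bsub>H\<^esub>) = \<theta> z" if fz: "f \<in> carrier K" "z \<in> Z" for f z
  proof (rule smult_vec_cancel[OF xc x(2)])
    have "E \<zero> f z \<one>\<^bsub>H\<^esub> \<in> Sg" using fz by (auto simp: Sg_def)
    then show "\<psi> (E \<zero> f z \<one>\<^bsub>H\<^esub>) \<cdot>\<^sub>v x = \<theta> z \<cdot>\<^sub>v x" using \<psi> xM[OF fz] by metis
  qed
  show ?thesis
  proof (rule G.irreducible_degree_eq_index[OF fin_G irr sub_S card_Sg normal_M _ xc x(2) \<psi>])
    show "Mg \<subseteq> Sg" by (auto simp: Mg_def Sg_def)
  next
    fix g assume g: "g \<in> carrier G"
      and stab: "\<And>a a'. a \<in> Mg \<Longrightarrow> a' \<in> Mg \<Longrightarrow> a \<otimes>\<^bsub>G\<^esub> g = g \<otimes>\<^bsub>G\<^esub> a' \<Longrightarrow> \<psi> a = \<psi> a'"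
    show "g \<in> Sg"
      by (rule inertia_S[of \<theta> z1 \<psi> g])
         (erule (1) \<theta>_add | rule \<theta>_one z1 g | erule (1) \<psi>M | erule (2) stab)+
  qed
qed

text \<open>With \<open>Z\<close> in the kernel the images of \<open>P\<close> commute, so
  \<open>P\<close> has a common eigenvector whose character is nontrivial at \<open>d\<close>; by
  freeness of the action the stabilizer of this character is \<open>P\<close> itself.\<close>

lemma degree_P_nontrivial:
  assumes irr: "irreducible_rep G n \<rho>" and Z: "\<And>z. z \<in> Zg \<Longrightarrow> \<rho> z = 1\<^sub>m n"
    and d: "d \<in> Pg" "\<rho> d \<noteq> 1\<^sub>m n"
  shows "n = card (carrier H)"
proof -
  have rep: "is_rep G n \<rho>" using irr by (simp add: irreducible_rep_def)
  have sP: "subgroup Pg G" using normal_P by (rule normal_imp_subgroup)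
  have PG: "Pg \<subseteq> carrier G" using sP by (rule subgroup.subset)
  have comm: "\<rho> (a \<otimes>\<^bsub>G\<^esub> b) = \<rho> (b \<otimes>\<^bsub>G\<^esub> a)" if ab: "a \<in> Pg" "b \<in> Pg" for a b
  proof -
    obtain z where z: "z \<in> Zg" "a \<otimes>\<^bsub>G\<^esub> b = z \<otimes>\<^bsub>G\<^esub> b \<otimes>\<^bsub>G\<^esub> a" using comm_P[OF ab] by blast
    have G: "z \<in> carrier G" "a \<in> carrier G" "b \<in> carrier G" using z(1) ab Z_subset_P PG by auto
    have ba: "\<rho> (b \<otimes>\<^bsub>G\<^esub> a) \<in> carrier_mat n n" using G by (intro is_repD(1)[OF rep]) simp
    have "\<rho> (a \<otimes>\<^bsub>G\<^esub> b) = \<rho> z * \<rho> (b \<otimes>\<^bsub>G\<^esub> a)"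
      unfolding z(2) using is_repD(3)[OF rep, of z "b \<otimes>\<^bsub>G\<^esub> a"] G by (simp add: G.m_assoc)
    then show ?thesis using Z[OF z(1)] ba by simp
  qed
  obtain v \<chi> where v: "v \<in> carrier_vec n" "v \<noteq> 0\<^sub>v n" "\<And>s. s \<in> Pg \<Longrightarrow> \<rho> s *\<^sub>v v = \<chi> s \<cdot>\<^sub>v v"
    and \<chi>: "\<chi> d \<noteq> 1" "\<And>a b. a \<in> Pg \<Longrightarrow> b \<in> Pg \<Longrightarrow> \<chi> (a \<otimes>\<^bsub>G\<^esub> b) = \<chi> a * \<chi> b"
    "\<And>s. s \<in> Pg \<Longrightarrow> \<chi> s \<noteq> 0" "\<And>s. s \<in> Pg \<Longrightarrow> \<rho> s = 1\<^sub>m n \<Longrightarrow> \<chi> s = 1"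
    by (rule G.common_eigenvector_nontrivial[OF fin_G rep sP _ d])
        (rule comm, assumption+, rule that, assumption+)
  show ?thesis
  proof (rule G.irreducible_degree_eq_index[OF fin_G irr sP card_Pg normal_P order_refl v])
    fix g assume g: "g \<in> carrier G"
      and stab: "\<And>a a'. a \<in> Pg \<Longrightarrow> a' \<in> Pg \<Longrightarrow> a \<otimes>\<^bsub>G\<^esub> g = g \<otimes>\<^bsub>G\<^esub> a' \<Longrightarrow> \<chi> a = \<chi> a'"
    show "g \<in> Pg"
    proof (rule not_P_nontrivial_on_commutator[OF \<chi>(2,3) _ d(1) \<chi>(1) g stab])
      show "\<chi> z = 1" if "z \<in> Zg" for z using that Z \<chi>(4) Z_subset_P by auto
    qed
  qed
qed

text \<open>Here \<open>\<rho>\<close> factors through \<open>H\<close>. Either some commutator of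
  \<open>Qg\<close> with \<open>G\<close> acts nontrivially, and then a character of
  \<open>Qg\<close> is moved and has stabilizer \<open>Qg\<close> by maximality; or the image of
  \<open>Qg\<close> is central, and since its index is prime the whole image is abelian.\<close>

lemma degree_P_trivial:
  assumes irr: "irreducible_rep G n \<rho>" and P: "\<And>u. u \<in> Pg \<Longrightarrow> \<rho> u = 1\<^sub>m n"
  shows "n = 1 \<or> n = q"
proof -
  have rep: "is_rep G n \<rho>" using irr by (simp add: irreducible_rep_def)
  have sQ: "subgroup Qg G" using normal_Q by (rule normal_imp_subgroup)
  have QG: "Qg \<subseteq> carrier G" using sQ by (rule subgroup.subset)
  have comm: "\<rho> (a \<otimes>\<^bsub>G\<^esub> b) = \<rho> (b \<otimes>\<^bsub>G\<^esub> a)"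
    if ab: "a \<in> carrier G" "b \<in> carrier G" "z \<in> carrier G" "\<rho> z = 1\<^sub>m n"
      "a \<otimes>\<^bsub>G\<^esub> b = z \<otimes>\<^bsub>G\<^esub> b \<otimes>\<^bsub>G\<^esub> a" for a b z
  proof -
    have ba: "\<rho> (b \<otimes>\<^bsub>G\<^esub> a) \<in> carrier_mat n n" using ab by (intro is_repD(1)[OF rep]) simp
    have "\<rho> (a \<otimes>\<^bsub>G\<^esub> b) = \<rho> z * \<rho> (b \<otimes>\<^bsub>G\<^esub> a)"
      unfolding ab(5) using is_repD(3)[OF rep, of z "b \<otimes>\<^bsub>G\<^esub> a"] ab(1-3) by (simp add: G.m_assoc)
    then show ?thesis using ab(4) ba by simp
  qed
  have commQ: "\<rho> (a \<otimes>\<^bsub>G\<^esub> b) = \<rho> (b \<otimes>\<^bsub>G\<^esub> a)" if ab: "a \<in> Qg" "b \<in> Qg" for a b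
  proof -
    obtain z where "z \<in> Pg" "a \<otimes>\<^bsub>G\<^esub> b = z \<otimes>\<^bsub>G\<^esub> b \<otimes>\<^bsub>G\<^esub> a" using comm_Q[OF ab] by blast
    then show ?thesis using comm[of a b z] P ab QG Pg_iff by auto
  qed
  show ?thesis
  proof (cases "\<exists>x\<in>Qg. \<exists>g\<in>carrier G. \<rho> (x \<otimes>\<^bsub>G\<^esub> g \<otimes>\<^bsub>G\<^esub> inv\<^bsub>G\<^esub> (g \<otimes>\<^bsub>G\<^esub> x)) \<noteq> 1\<^sub>m n")
    case True
    then obtain x g where x: "x \<in> Qg" "g \<in> carrier G"
      and nt: "\<rho> (x \<otimes>\<^bsub>G\<^esub> g \<otimes>\<^bsub>G\<^esub> inv\<^bsub>G\<^esub> (g \<otimes>\<^bsub>G\<^esub> x)) \<noteq> 1\<^sub>m n" by blast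
    let ?c = "x \<otimes>\<^bsub>G\<^esub> g \<otimes>\<^bsub>G\<^esub> inv\<^bsub>G\<^esub> (g \<otimes>\<^bsub>G\<^esub> x)"
    let ?a = "g \<otimes>\<^bsub>G\<^esub> x \<otimes>\<^bsub>G\<^esub> inv\<^bsub>G\<^esub> g"
    have xG: "x \<in> carrier G" using x QG by auto
    have a: "?a \<in> Qg" using normal.inv_op_closed2[OF normal_Q x(2,1)] .
    have aG: "?a \<in> carrier G" using xG x by simp
    \<comment> \<open>Written as \<open>x\<close> times the inverse of its conjugate, the commutator
      lies in \<open>Qg\<close>, and its nontriviality under \<open>\<chi>\<close> says that
      \<open>\<chi>\<close> differs at \<open>x\<close> and at that conjugate.\<close>
    have c_eq: "?c = x \<otimes>\<^bsub>G\<^esub> inv\<^bsub>G\<^esub> ?a" using xG x(2) by (simp add: G.inv_mult_group G.m_assoc)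
    have cQ: "?c \<in> Qg" unfolding c_eq using x a sQ by (simp add: subgroup.m_closed subgroup.m_inv_closed)
    obtain v \<chi> where v: "v \<in> carrier_vec n" "v \<noteq> 0\<^sub>v n" "\<And>s. s \<in> Qg \<Longrightarrow> \<rho> s *\<^sub>v v = \<chi> s \<cdot>\<^sub>v v"
      and \<chi>: "\<chi> ?c \<noteq> 1" "\<And>a b. a \<in> Qg \<Longrightarrow> b \<in> Qg \<Longrightarrow> \<chi> (a \<otimes>\<^bsub>G\<^esub> b) = \<chi> a * \<chi> b"
      "\<And>s. s \<in> Qg \<Longrightarrow> \<chi> s \<noteq> 0"
      by (rule G.common_eigenvector_nontrivial[OF fin_G rep sQ _ cQ nt])
        (rule commQ, assumption+, rule that, assumption+)
    \<comment> \<open>The stabilizer of \<open>\<chi>\<close> in \<open>G\<close>. It contains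
      \<open>Qg\<close> because a homomorphism to a commutative group is invariant under
      conjugation.\<close>
    let ?T = "{g \<in> carrier G. \<forall>a\<in>Qg. \<forall>a'\<in>Qg. a \<otimes>\<^bsub>G\<^esub> g = g \<otimes>\<^bsub>G\<^esub> a' \<longrightarrow> \<chi> a = \<chi> a'}"
    have QT: "Qg \<subseteq> ?T"
    proof (intro subsetI CollectI conjI ballI impI)
      fix h a a' assume h: "h \<in> Qg" "a \<in> Qg" "a' \<in> Qg" and eq: "a \<otimes>\<^bsub>G\<^esub> h = h \<otimes>\<^bsub>G\<^esub> a'"
      have "\<chi> a * \<chi> h = \<chi> h * \<chi> a'" using \<chi>(2)[OF h(2,1)] \<chi>(2)[OF h(1,3)] eq by auto
      then show "\<chi> a = \<chi> a'" using \<chi>(3)[OF h(1)] by simp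
    qed (use QG in auto)
    have T: "subgroup ?T G"
    proof (rule G.subgroupI)
      show "?T \<noteq> {}" using QT x by blast
    next
      fix h assume h: "h \<in> ?T"
      then have hG: "h \<in> carrier G" by simp
      show "inv\<^bsub>G\<^esub> h \<in> ?T"
      proof (intro CollectI conjI ballI impI)
        fix a a' assume aa: "a \<in> Qg" "a' \<in> Qg" and eq: "a \<otimes>\<^bsub>G\<^esub> inv\<^bsub>G\<^esub> h = inv\<^bsub>G\<^esub> h \<otimes>\<^bsub>G\<^esub> a'"
        have aaG: "a \<in> carrier G" "a' \<in> carrier G" using aa QG by auto
        have "a' \<otimes>\<^bsub>G\<^esub> h = h \<otimes>\<^bsub>G\<^esub> (inv\<^bsub>G\<^esub> h \<otimes>\<^bsub>G\<^esub> a') \<otimes>\<^bsub>G\<^esub> h" using aaG hG by (simp flip: G.m_assoc)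
        also have "\<dots> = h \<otimes>\<^bsub>G\<^esub> a" unfolding eq[symmetric] using aaG hG by (simp add: G.m_assoc)
        finally have "\<chi> a' = \<chi> a" using h aa by blast
        then show "\<chi> a = \<chi> a'" ..
      qed (use hG in simp)
    next
      fix h k assume hk: "h \<in> ?T" "k \<in> ?T"
      then have hG: "h \<in> carrier G" "k \<in> carrier G" by simp_all
      show "h \<otimes>\<^bsub>G\<^esub> k \<in> ?T"
      proof (intro CollectI conjI ballI impI)
        fix a a' assume aa: "a \<in> Qg" "a' \<in> Qg" and eq: "a \<otimes>\<^bsub>G\<^esub> (h \<otimes>\<^bsub>G\<^esub> k) = h \<otimes>\<^bsub>G\<^esub> k \<otimes>\<^bsub>G\<^esub> a'"
        have aaG: "a \<in> carrier G" "a' \<in> carrier G" using aa QG by auto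
        let ?b = "k \<otimes>\<^bsub>G\<^esub> a' \<otimes>\<^bsub>G\<^esub> inv\<^bsub>G\<^esub> k"
        have b: "?b \<in> Qg" using normal.inv_op_closed2[OF normal_Q hG(2) aa(2)] .
        have bk: "?b \<otimes>\<^bsub>G\<^esub> k = k \<otimes>\<^bsub>G\<^esub> a'" using aaG hG by (simp add: G.m_assoc)
        have "a \<otimes>\<^bsub>G\<^esub> h \<otimes>\<^bsub>G\<^esub> k = h \<otimes>\<^bsub>G\<^esub> ?b \<otimes>\<^bsub>G\<^esub> k"
          using eq bk aaG hG by (simp add: G.m_assoc)
        then have "a \<otimes>\<^bsub>G\<^esub> h = h \<otimes>\<^bsub>G\<^esub> ?b" using aaG hG by (simp add: G.right_cancel)
        then have "\<chi> a = \<chi> ?b" using hk(1) aa(1) b by blast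
        also have "\<chi> ?b = \<chi> a'" using hk(2) b aa(2) bk by blast
        finally show "\<chi> a = \<chi> a'" .
      qed (use hG in simp)
    qed simp
    have "g \<notin> ?T"
    proof
      assume "g \<in> ?T"
      moreover have "?a \<otimes>\<^bsub>G\<^esub> g = g \<otimes>\<^bsub>G\<^esub> x" using xG x(2) by (simp add: G.m_assoc)
      ultimately have "\<chi> ?a = \<chi> x" using a x(1) by blast
      moreover have "?c \<otimes>\<^bsub>G\<^esub> ?a = x" unfolding c_eq using xG aG by (simp add: G.m_assoc del: G.inv_mult_group)
      then have "\<chi> x = \<chi> ?c * \<chi> ?a" using \<chi>(2)[OF cQ a] by simp
      ultimately show False using \<chi>(1) \<chi>(3)[OF x(1)] by simp
    qed
    then have "?T \<noteq> carrier G" using x by blast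
    then have TQ: "?T = Qg"
      by (rule G.prime_index_maximal[OF fin_G sQ T QT prime_q card_Qg])
    have "n = q"
    proof (rule G.irreducible_degree_eq_index[OF fin_G irr sQ card_Qg normal_Q order_refl v])
      fix g assume "g \<in> carrier G"
        and "\<And>a a'. a \<in> Qg \<Longrightarrow> a' \<in> Qg \<Longrightarrow> a \<otimes>\<^bsub>G\<^esub> g = g \<otimes>\<^bsub>G\<^esub> a' \<Longrightarrow> \<chi> a = \<chi> a'"
      then have "g \<in> ?T" by blast
      then show "g \<in> Qg" unfolding TQ .
    qed
    then show ?thesis by simp
  next
    case False
    then have central: "\<rho> (x \<otimes>\<^bsub>G\<^esub> g) = \<rho> (g \<otimes>\<^bsub>G\<^esub> x)" if "x \<in> Qg" "g \<in> carrier G" for x g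
      using that QG commutator_form[of x g]
      by (intro comm[of x g "x \<otimes>\<^bsub>G\<^esub> g \<otimes>\<^bsub>G\<^esub> inv\<^bsub>G\<^esub> (g \<otimes>\<^bsub>G\<^esub> x)"]) auto
    \<comment> \<open>If \<open>x \<notin> Q\<close>, the centralizer of \<open>\<rho> x\<close> is a subgroup properly containing the maximal subgroup \<open>Q\<close>.\<close>
    have all: "\<rho> (x \<otimes>\<^bsub>G\<^esub> g) = \<rho> (g \<otimes>\<^bsub>G\<^esub> x)" if x: "x \<in> carrier G" and g: "g \<in> carrier G" for x g
    proof (cases "x \<in> Qg")
      case True
      then show ?thesis using central g by blast
    next
      case xQ: False
      let ?T = "{h \<in> carrier G. \<rho> h * \<rho> x = \<rho> x * \<rho> h}"
      have mat: "\<rho> h \<in> carrier_mat n n" if "h \<in> carrier G" for h using is_repD(1)[OF rep that] .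
      have T: "subgroup ?T G"
      proof (rule G.subgroupI)
        show "?T \<noteq> {}" using x by blast
      next
        fix h assume "h \<in> ?T"
        then have h: "h \<in> carrier G" "\<rho> h * \<rho> x = \<rho> x * \<rho> h" by auto
        let ?i = "inv\<^bsub>G\<^esub> h"
        have i: "?i \<in> carrier G" using h by simp
        have ih: "\<rho> ?i * \<rho> h = 1\<^sub>m n" "\<rho> h * \<rho> ?i = 1\<^sub>m n"
          using is_repD(3)[OF rep i h(1)] is_repD(3)[OF rep h(1) i] is_repD(2)[OF rep] h by simp_all
        note m = mat[OF x] mat[OF h(1)] mat[OF i]
        have "\<rho> ?i * \<rho> x = \<rho> ?i * (\<rho> x * (\<rho> h * \<rho> ?i))" using ih m by simp
        also have "\<dots> = \<rho> ?i * ((\<rho> x * \<rho> h) * \<rho> ?i)" using m by (simp add: assoc_mult_mat[of _ n n _ n _ n])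
        also have "\<dots> = (\<rho> ?i * \<rho> h) * (\<rho> x * \<rho> ?i)"
          unfolding h(2)[symmetric] using m by (simp add: assoc_mult_mat[of _ n n _ n _ n])
        also have "\<dots> = \<rho> x * \<rho> ?i" unfolding ih using m by simp
        finally show "?i \<in> ?T" using i by simp
      next
        fix h k assume "h \<in> ?T" "k \<in> ?T"
        then have h: "h \<in> carrier G" "\<rho> h * \<rho> x = \<rho> x * \<rho> h"
          and k: "k \<in> carrier G" "\<rho> k * \<rho> x = \<rho> x * \<rho> k" by auto
        note m = mat[OF x] mat[OF h(1)] mat[OF k(1)]
        have "\<rho> h * \<rho> k * \<rho> x = \<rho> h * (\<rho> x * \<rho> k)" unfolding k(2)[symmetric]
          using m by (simp add: assoc_mult_mat[of _ n n _ n _ n])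
        also have "\<dots> = \<rho> h * \<rho> x * \<rho> k" using m by (simp add: assoc_mult_mat[of _ n n _ n _ n])
        also have "\<dots> = \<rho> x * (\<rho> h * \<rho> k)" unfolding h(2)
          using m by (simp add: assoc_mult_mat[of _ n n _ n _ n])
        finally show "h \<otimes>\<^bsub>G\<^esub> k \<in> ?T" using h k is_repD(3)[OF rep h(1) k(1)] by simp
      qed simp
      have QT: "Qg \<subseteq> ?T"
      proof
        fix h assume h: "h \<in> Qg"
        then have hG: "h \<in> carrier G" using QG by auto
        show "h \<in> ?T" using central[OF h x] is_repD(3)[OF rep hG x] is_repD(3)[OF rep x hG] hG by simp
      qed
      have "?T = carrier G"
      proof (rule ccontr)
        assume "?T \<noteq> carrier G"
        then have "?T = Qg" by (rule G.prime_index_maximal[OF fin_G sQ T QT prime_q card_Qg])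
        moreover have "x \<in> ?T" using x by simp
        ultimately show False using xQ by blast
      qed
      then have "\<rho> g * \<rho> x = \<rho> x * \<rho> g" using g by blast
      then show ?thesis using is_repD(3)[OF rep g x] is_repD(3)[OF rep x g] by simp
    qed
    have n: "n > 0" using irr by (simp add: irreducible_rep_def)
    have full: "is_subspace n (carrier_vec n)" by (auto simp: is_subspace_def)
    have "\<exists>v\<in>carrier_vec n. v \<noteq> 0\<^sub>v n \<and> (\<forall>b\<in>carrier G. \<exists>c. \<rho> b *\<^sub>v v = c \<cdot>\<^sub>v v)"
    proof (rule G.common_eigenvector[OF fin_G rep full, of "unit_vec n 0"])
      show "unit_vec n 0 \<noteq> (0\<^sub>v n :: complex vec)"
        using n by (metis index_unit_vec(2) index_zero_vec(1) zero_neq_one)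
    qed (use all is_repD(5)[OF rep] in auto)
    then obtain v where v: "v \<in> carrier_vec n" "v \<noteq> 0\<^sub>v n" "\<forall>b\<in>carrier G. \<exists>c. \<rho> b *\<^sub>v v = c \<cdot>\<^sub>v v" by blast
    then obtain \<chi> where \<chi>: "\<And>s. s \<in> carrier G \<Longrightarrow> \<rho> s *\<^sub>v v = \<chi> s \<cdot>\<^sub>v v" by metis
    have "n = 1"
      by (rule G.irreducible_degree_eq_index[OF fin_G irr G.subgroup_self _ G.normal_self order_refl v(1,2) \<chi>]) auto
    then show ?thesis by simp
  qed
qed

theorem char_degrees_eq: "char_degrees G = {1, q, card (carrier H), card (carrier K) * q}"
proof
  show "{1, q, card (carrier H), card (carrier K) * q} \<subseteq> char_degrees G"
    using one_in_char_degrees q_in_char_degrees card_H_in_char_degrees card_K_q_in_char_degrees by simp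
next
  show "char_degrees G \<subseteq> {1, q, card (carrier H), card (carrier K) * q}"
  proof
    fix n assume "n \<in> char_degrees G"
    then obtain \<rho> where irr: "irreducible_rep G n \<rho>" by (auto simp: char_degrees_def)
    consider "\<exists>d\<in>Zg. \<rho> d \<noteq> 1\<^sub>m n" | "\<forall>d\<in>Zg. \<rho> d = 1\<^sub>m n" "\<exists>d\<in>Pg. \<rho> d \<noteq> 1\<^sub>m n"
      | "\<forall>d\<in>Pg. \<rho> d = 1\<^sub>m n" by blast
    then show "n \<in> {1, q, card (carrier H), card (carrier K) * q}"
    proof cases
      case 1
      then show ?thesis using degree_Z_nontrivial[OF irr] by blast
    next
      case 2
      then show ?thesis using degree_P_nontrivial[OF irr] by blast
    next
      case 3
      then show ?thesis using degree_P_trivial[OF irr] by blast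
    qed
  qed
qed

lemma group_structure: "solvable G" "derived_length G = 4" "fitting_height G = 3"
  using tower_G tower.solvable_tower tower.derived_length_eq tower.fitting_height_eq by blast+

end

section \<open>Arithmetic\<close>

text \<open>Modulo \<open>q^2\<close> the power \<open>p^i\<close> is \<open>1 + i (p - 1)\<close>,
  so the geometric sum is \<open>q + (p - 1) q (q - 1) / 2\<close>. For odd \<open>q\<close> the
  number \<open>(q - 1) / 2\<close> is an integer and the second term is divisible by
  \<open>q^2\<close>; hence \<open>q\<close> divides the sum exactly once. The cofactor exceeds one
  because the sum is at least \<open>p\<close>, which is larger than \<open>q\<close>.\<close>

lemma geometric_sum_factor:
  assumes "prime q" "odd q" "q dvd p - 1" "p > (1::nat)"
  obtains s where "p ^ q - 1 = (p - 1) * (q * s)" "(\<Sum>i<q. p ^ i) = q * s" "[s = 1] (mod q)" "s > 1"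
proof -
  obtain t where t: "p - 1 = q * t" using assms(3) by (rule dvdE)
  then have p: "p = 1 + q * t" using assms(4) by simp
  have pow: "[p ^ i = 1 + i * (q * t)] (mod q\<^sup>2)" for i
  proof (induction i)
    case (Suc i)
    have "[p ^ Suc i = (1 + q * t) * (1 + i * (q * t))] (mod q\<^sup>2)"
      using cong_mult[OF cong_refl Suc, of p] p by simp
    also have "(1 + q * t) * (1 + i * (q * t)) = 1 + Suc i * (q * t) + q\<^sup>2 * (i * t * t)"
      by (simp add: algebra_simps power2_eq_square)
    also have "[\<dots> = 1 + Suc i * (q * t)] (mod q\<^sup>2)" by (simp add: cong_def)
    finally show ?case .
  qed simp
  have "even (q - 1)" using assms(2) by simp
  then obtain h where h: "q - 1 = 2 * h" by (rule evenE)
  have q0: "q > 1" using assms(1) by (rule prime_gt_1_nat)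
  have tri: "(\<Sum>i<q. i) = q * h"
  proof -
    have "2 * (\<Sum>i<q. i) = q * (q - 1)"
      using Sum_Ico_nat[of 0 q] dvd_mult_div_cancel[of 2 "q * (q - 1)"] \<open>even (q - 1)\<close>
      by (simp add: lessThan_atLeast0)
    then show ?thesis using h by simp
  qed
  have "[(\<Sum>i<q. p ^ i) = (\<Sum>i<q. 1 + i * (q * t))] (mod q\<^sup>2)"
    by (rule cong_sum) (rule pow)
  also have "(\<Sum>i<q. 1 + i * (q * t)) = q + (\<Sum>i<q. i) * (q * t)"
    by (simp only: sum.distrib sum_distrib_right[symmetric]) simp
  also have "\<dots> = q + q\<^sup>2 * (h * t)" unfolding tri by (simp add: power2_eq_square)
  also have "[\<dots> = q] (mod q\<^sup>2)" by (simp add: cong_def)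
  finally have S: "[(\<Sum>i<q. p ^ i) = q] (mod q\<^sup>2)" .
  then have "[(\<Sum>i<q. p ^ i) = q] (mod q)"
    by (rule cong_dvd_modulus_nat) (simp add: power2_eq_square)
  then have "q dvd (\<Sum>i<q. p ^ i)" by (simp add: cong_def dvd_eq_mod_eq_0)
  then obtain s where s: "(\<Sum>i<q. p ^ i) = q * s" by (rule dvdE)
  have s1: "[s = 1] (mod q)"
    using S q0 unfolding s power2_eq_square
    by (metis cong_mult_lcancel_nat cong_def mod_mult_mult1 mult.right_neutral mult_cancel1 not_one_less_zero)
  have "p > q" using p q0 assms(4) t by (cases t) auto
  have "p ^ 1 \<le> (\<Sum>i<q. p ^ i)" using q0 by (intro member_le_sum) auto
  then have qs: "q < q * s" unfolding s[symmetric] using \<open>p > q\<close> by (metis less_le_trans power_one_right)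
  have "s \<noteq> 0" "s \<noteq> 1" using qs by auto
  then have "s > 1" by linarith
  moreover have "p ^ q - 1 = (p - 1) * (q * s)"
  proof -
    have "int (p ^ q) - 1 = (int p - 1) * (\<Sum>i<q. int p ^ i)"
      by (simp add: power_diff_1_eq)
    also have "\<dots> = int ((p - 1) * (\<Sum>i<q. p ^ i))" using assms(4) by (simp add: of_nat_diff)
    finally show ?thesis unfolding s by linarith
  qed
  ultimately show thesis using that s s1 by blast
qed

lemma third_degree_eq:
  assumes "prime q" "odd q" "q dvd p - 1" "p > (1::nat)"
  shows "pprime_part q (p ^ q - 1) * ppart q (p - 1) * q = p ^ q - 1"
proof -
  obtain s where s: "p ^ q - 1 = (p - 1) * (q * s)" "[s = 1] (mod q)" "s > 1"
    by (rule geometric_sum_factor[OF assms]) blast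
  have q1: "q > 1" using assms(1) by (rule prime_gt_1_nat)
  have "\<not> q dvd s" using s(2) q1 by (metis cong_dvd_iff nat_dvd_1_iff_1 nat_neq_iff)
  then have "multiplicity q (p ^ q - 1) = multiplicity q (p - 1) + 1"
    unfolding s(1) using assms s
    by (simp add: prime_elem_multiplicity_mult_distrib not_dvd_imp_multiplicity_0 multiplicity_same_power prime_gt_0_nat)
  then have "ppart q (p ^ q - 1) = ppart q (p - 1) * q" by (simp add: ppart_def)
  moreover have "ppart q (p ^ q - 1) dvd p ^ q - 1" by (simp add: ppart_def multiplicity_dvd)
  ultimately show ?thesis by (simp add: pprime_part_def mult.assoc)
qed

text \<open>A prime factor \<open>r\<close> of \<open>s\<close> divides neither \<open>q\<close> nor
  \<open>p - 1\<close>: modulo a divisor of \<open>p - 1\<close> the geometric sum is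
  \<open>q\<close>, which would force \<open>r = q\<close>, while \<open>s\<close> is prime to
  \<open>q\<close>. It follows that no power of \<open>p - 1\<close> annihilates the
  \<open>q\<close>-th power of a generator of the multiplicative group.\<close>

lemma not_dvd_power_minus_one:
  assumes "prime q" "odd q" "q dvd p - 1" "p > (1::nat)"
  shows "\<not> p ^ q - 1 dvd q * (p - 1) ^ n"
proof
  assume dvd: "p ^ q - 1 dvd q * (p - 1) ^ n"
  obtain s where s: "p ^ q - 1 = (p - 1) * (q * s)" "(\<Sum>i<q. p ^ i) = q * s" "[s = 1] (mod q)" "s > 1"
    by (rule geometric_sum_factor[OF assms])
  have q1: "q > 1" using assms(1) by (rule prime_gt_1_nat)
  have "\<not> q dvd s" using s(3) q1 by (metis cong_dvd_iff nat_dvd_1_iff_1 nat_neq_iff)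
  obtain r where r: "prime r" "r dvd s" using s(4) prime_factor_nat[of s] by auto
  have rp: "\<not> r dvd p - 1"
  proof
    assume "r dvd p - 1"
    then have "[p = 1] (mod r)" using assms(4) by (simp add: cong_altdef_nat)
    then have "[(\<Sum>i<q. p ^ i) = (\<Sum>i<q. 1 ^ i)] (mod r)" by (intro cong_sum cong_pow)
    then have "[q * s = q] (mod r)" using s(2) by simp
    then have "r dvd q" using r(2) by (metis cong_dvd_iff dvd_mult)
    then have "r = q" using r(1) assms(1) by (simp add: primes_dvd_imp_eq)
    then show False using r \<open>\<not> q dvd s\<close> by simp
  qed
  have "r dvd q * (p - 1) ^ n" using dvd r(2) s(1) by (metis dvd_mult dvd_trans)
  then have "r dvd q \<or> r dvd p - 1" using r(1) prime_dvd_mult_iff prime_dvd_power by blast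
  then have "r dvd q" using rp by blast
  then have "r = q" using r(1) assms(1) by (simp add: primes_dvd_imp_eq)
  then show False using r \<open>\<not> q dvd s\<close> by simp
qed

section \<open>Dickson nearfields\<close>

text \<open>The Dickson nearfield twists the multiplication of the field by powers of the Frobenius map,
  \<open>b \<circ> c = b \<otimes> fr (dlog b) c\<close>. This is associative because \<open>fr k\<close> depends only on \<open>k\<close> modulo \<open>q\<close> and
  \<open>dlog (b \<circ> c) \<equiv> dlog b + dlog c\<close> modulo \<open>q\<close>.\<close>

locale nearfield = field R for R (structure) +
  fixes p q :: nat and \<gamma>
  assumes fin: "finite (carrier R)" and card: "card (carrier R) = p ^ q"
    and prime_p: "prime p" and prime_q: "prime q" and odd_q: "odd q" and q_dvd: "q dvd p - 1"
    and frob: "\<lbrakk>x \<in> carrier R; y \<in> carrier R\<rbrakk> \<Longrightarrow> (x \<oplus> y) [^] p = x [^] p \<oplus> y [^] p"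
    and gen: "\<gamma> \<in> carrier R" "\<gamma> \<noteq> \<zero>" "\<And>x. x \<in> carrier R \<Longrightarrow> x \<noteq> \<zero> \<Longrightarrow> \<exists>k::nat. x = \<gamma> [^] k"
begin

section \<open>Discrete logarithms and the Frobenius map\<close>

definition N where "N = p ^ q - 1"

lemma p1: "p > 1" and q1: "q > 1"
  using prime_p prime_q by (simp_all only: prime_gt_1_nat)

lemma q_less_p: "q < p"
  using q_dvd p1 by (auto dest!: dvd_imp_le)

lemma N_pos: "N > 0" and pq: "p ^ q = Suc N"
proof -
  have "1 < p ^ q" using p1 q1 by (intro one_less_power) auto
  then show "N > 0" "p ^ q = Suc N" by (auto simp: N_def)
qed

text \<open>One factor \<open>q\<close> comes from \<open>p - 1\<close> and a second from the
  geometric sum. With two of them \<open>N div q\<close> is still divisible by \<open>q\<close>, so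
  the twist in \<open>B\<close> does not change discrete logarithms modulo \<open>q\<close>.\<close>

lemma q_dvd_N: "q dvd N" and qq_dvd_N: "q dvd N div q" and p1q_dvd: "p - 1 dvd N"
proof -
  obtain s where s: "N = (p - 1) * (q * s)"
    unfolding N_def by (rule geometric_sum_factor[OF prime_q odd_q q_dvd p1]) blast
  then show "q dvd N" "p - 1 dvd N" by simp_all
  have "N div q = (p - 1) * s" using s q1 by simp
  then show "q dvd N div q" using q_dvd by simp
qed

lemma p_cong: "[p ^ i = 1] (mod q)"
proof -
  have "[p = 1] (mod q)" using q_dvd p1 by (simp add: cong_altdef_nat)
  then have "[p ^ i = 1 ^ i] (mod q)" by (rule cong_pow)
  then show ?thesis by simp
qed

lemma pow_nonzero: "\<lbrakk>x \<in> carrier R; x \<noteq> \<zero>\<rbrakk> \<Longrightarrow> x [^] (n::nat) \<noteq> \<zero>"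
  by (induction n) (auto simp: integral_iff)

lemma pow_N: "\<lbrakk>x \<in> carrier R; x \<noteq> \<zero>\<rbrakk> \<Longrightarrow> x [^] N = \<one>"
proof -
  assume x: "x \<in> carrier R" "x \<noteq> \<zero>"
  interpret M: group "mult_of R" by (rule field_mult_group)
  have "Coset.order (mult_of R) = N" using order_mult_of[OF fin] card by (simp add: Coset.order_def N_def)
  then show ?thesis using M.pow_order_eq_1[of x] x by (simp add: nat_pow_mult_of)
qed

lemma pow_gen_eq_iff: "\<gamma> [^] (j::nat) = \<gamma> [^] (k::nat) \<longleftrightarrow> [j = k] (mod N)"
proof -
  interpret M: group "mult_of R" by (rule field_mult_group)
  have g: "\<gamma> \<in> carrier (mult_of R)" using gen by simp
  have fM: "finite (carrier (mult_of R))" using fin by simp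
  have cM: "card (carrier (mult_of R)) = N" using card gen fin by (simp add: N_def card_Diff_singleton)
  have "carrier (mult_of R) \<subseteq> {\<gamma> [^] x | x. x \<in> (UNIV :: nat set)}" using gen(3) by auto
  also have "\<dots> = {\<gamma> [^] x | x. x \<in> {0 .. M.ord \<gamma> - 1}}"
    using M.ord_elems[OF fM g] by (simp add: nat_pow_mult_of)
  finally have sub: "carrier (mult_of R) \<subseteq> (\<lambda>x. \<gamma> [^] x) ` {0 .. M.ord \<gamma> - 1}" by auto
  have "N \<le> card {0 .. M.ord \<gamma> - 1}"
    unfolding cM[symmetric] by (rule surj_card_le[OF _ sub]) simp
  then have "N \<le> Suc (M.ord \<gamma> - 1)" by simp
  moreover have dvd: "M.ord \<gamma> dvd N" using M.ord_dvd_group_order[OF g] cM by (simp add: Coset.order_def)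
  moreover have "M.ord \<gamma> \<noteq> 0" using dvd N_pos by (metis dvd_0_left_iff less_irrefl)
  moreover have "M.ord \<gamma> \<le> N" using dvd N_pos by (rule dvd_imp_le)
  ultimately have ord: "M.ord \<gamma> = N" by linarith
  have "\<gamma> [^]\<^bsub>mult_of R\<^esub> int j = \<gamma> [^]\<^bsub>mult_of R\<^esub> int k \<longleftrightarrow> int N dvd int k - int j"
    using M.int_pow_eq[OF g] ord by simp
  then show ?thesis
    by (simp add: int_pow_int nat_pow_mult_of cong_iff_dvd_diff flip: cong_int_iff)
       (metis dvd_diff_commute)
qed

text \<open>An arbitrary exponent is chosen; for a nonzero element its class modulo \<open>N\<close>
  is determined. Since \<open>q\<close> divides \<open>N\<close>, the Frobenius power that it
  selects does not depend on the choice. At zero the value is unspecified.\<close>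

definition dlog :: "'a \<Rightarrow> nat" where "dlog x = (SOME k. x = \<gamma> [^] k)"

lemma dlog: "\<lbrakk>x \<in> carrier R; x \<noteq> \<zero>\<rbrakk> \<Longrightarrow> \<gamma> [^] dlog x = x"
  unfolding dlog_def using gen(3) by (metis (mono_tags, lifting) someI_ex)

lemma dlog_gen: "[dlog (\<gamma> [^] k) = k] (mod N)"
  using pow_gen_eq_iff dlog[of "\<gamma> [^] k"] pow_nonzero gen by simp

lemma dlog_one: "[dlog \<one> = 0] (mod N)"
  using dlog_gen[of 0] by simp

definition fr :: "nat \<Rightarrow> 'a \<Rightarrow> 'a" where "fr k x = x [^] (p ^ k)"

lemma fr_closed [simp]: "x \<in> carrier R \<Longrightarrow> fr k x \<in> carrier R"
  by (simp add: fr_def)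

lemma fr_0 [simp]: "x \<in> carrier R \<Longrightarrow> fr 0 x = x"
  by (simp add: fr_def)

lemma fr_fr: "x \<in> carrier R \<Longrightarrow> fr j (fr k x) = fr (j + k) x"
  by (simp add: fr_def nat_pow_pow power_add mult.commute)

lemma fr_mult: "\<lbrakk>x \<in> carrier R; y \<in> carrier R\<rbrakk> \<Longrightarrow> fr k (x \<otimes> y) = fr k x \<otimes> fr k y"
  by (simp add: fr_def nat_pow_distrib)

lemma fr_pow: "x \<in> carrier R \<Longrightarrow> fr k (x [^] (n::nat)) = (fr k x) [^] n"
  by (simp add: fr_def nat_pow_pow mult.commute)

lemma fr_one [simp]: "fr k \<one> = \<one>"
  by (simp add: fr_def)

lemma fr_Suc: "x \<in> carrier R \<Longrightarrow> fr (Suc k) x = (fr k x) [^] p"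
  by (simp add: fr_def nat_pow_pow mult.commute)

lemma fr_add: "\<lbrakk>x \<in> carrier R; y \<in> carrier R\<rbrakk> \<Longrightarrow> fr k (x \<oplus> y) = fr k x \<oplus> fr k y"
  by (induction k) (simp_all add: fr_Suc frob)

lemma fr_q: "x \<in> carrier R \<Longrightarrow> fr q x = x"
  by (cases "x = \<zero>") (simp_all add: fr_def pq pow_N nat_pow_zero)

lemma fr_add_mult: "x \<in> carrier R \<Longrightarrow> fr (j + q * t) x = fr j x"
proof (induction t)
  case (Suc t)
  have "fr (j + q * Suc t) x = fr (j + q * t) (fr q x)"
    using Suc.prems by (simp add: fr_fr add.commute add.left_commute)
  then show ?case using Suc by (simp add: fr_q)
qed simp

lemma fr_cong: "[j = k] (mod q) \<Longrightarrow> x \<in> carrier R \<Longrightarrow> fr j x = fr k x"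
proof -
  assume "[j = k] (mod q)" and x: "x \<in> carrier R"
  then have "fr (j mod q + q * (j div q)) x = fr (k mod q + q * (k div q)) x"
    by (simp only: fr_add_mult cong_def)
  then show ?thesis by simp
qed

lemma fr_id: "q dvd j \<Longrightarrow> x \<in> carrier R \<Longrightarrow> fr j x = x"
  using fr_cong[of j 0 x] by (simp add: cong_0_iff)

lemma fr_nonzero: "\<lbrakk>x \<in> carrier R; x \<noteq> \<zero>\<rbrakk> \<Longrightarrow> fr k x \<noteq> \<zero>"
  by (simp add: fr_def pow_nonzero)

section \<open>The nearfield group\<close>

definition H where
  "H = \<lparr>carrier = carrier R - {\<zero>}, monoid.mult = (\<lambda>b c. b \<otimes> fr (dlog b) c), one = \<one>\<rparr>"

lemma H_simps [simp]: "carrier H = carrier R - {\<zero>}" "b \<otimes>\<^bsub>H\<^esub> c = b \<otimes> fr (dlog b) c" "\<one>\<^bsub>H\<^esub> = \<one>"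
  by (simp_all add: H_def)

text \<open>The Frobenius twist multiplies a logarithm by a power of \<open>p\<close>, which is one
  modulo \<open>q\<close>.\<close>

lemma dlog_mult_H:
  assumes "b \<in> carrier H" "c \<in> carrier H"
  shows "[dlog (b \<otimes> fr (dlog b) c) = dlog b + dlog c] (mod q)"
proof -
  have bc: "b \<in> carrier R" "b \<noteq> \<zero>" "c \<in> carrier R" "c \<noteq> \<zero>" using assms by auto
  have "b \<otimes> fr (dlog b) c = \<gamma> [^] dlog b \<otimes> fr (dlog b) (\<gamma> [^] dlog c)" using bc by (simp add: dlog)
  also have "\<dots> = \<gamma> [^] (dlog b + dlog c * p ^ dlog b)"
    using gen by (simp add: fr_def nat_pow_pow nat_pow_mult)
  finally have "[dlog (b \<otimes> fr (dlog b) c) = dlog b + dlog c * p ^ dlog b] (mod N)"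
    using dlog_gen by simp
  then have "[dlog (b \<otimes> fr (dlog b) c) = dlog b + dlog c * p ^ dlog b] (mod q)"
    using q_dvd_N by (rule cong_dvd_modulus_nat)
  also have "[dlog b + dlog c * p ^ dlog b = dlog b + dlog c * 1] (mod q)"
    by (intro cong_add cong_refl cong_mult p_cong)
  finally show ?thesis by simp
qed

lemma fr_dlog_mult:
  "\<lbrakk>b \<in> carrier H; c \<in> carrier H; x \<in> carrier R\<rbrakk> \<Longrightarrow>
    fr (dlog (b \<otimes> fr (dlog b) c)) x = fr (dlog b) (fr (dlog c) x)"
  using fr_cong[OF dlog_mult_H] by (simp add: fr_fr)

lemma fr_dlog_one: "x \<in> carrier R \<Longrightarrow> fr (dlog \<one>) x = x"
  using cong_dvd_modulus_nat[OF dlog_one q_dvd_N] by (intro fr_id) (simp_all add: cong_0_iff)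

sublocale H: group H
proof (rule groupI)
  show "\<one>\<^bsub>H\<^esub> \<in> carrier H" by simp
next
  fix x y assume "x \<in> carrier H" "y \<in> carrier H"
  then show "x \<otimes>\<^bsub>H\<^esub> y \<in> carrier H" by (auto simp: integral_iff fr_nonzero)
next
  fix x y z assume xyz: "x \<in> carrier H" "y \<in> carrier H" "z \<in> carrier H"
  then show "x \<otimes>\<^bsub>H\<^esub> y \<otimes>\<^bsub>H\<^esub> z = x \<otimes>\<^bsub>H\<^esub> (y \<otimes>\<^bsub>H\<^esub> z)"
    using fr_dlog_mult[OF xyz(1,2), of z] by (simp add: fr_mult m_assoc)
next
  fix x assume "x \<in> carrier H"
  then show "\<one>\<^bsub>H\<^esub> \<otimes>\<^bsub>H\<^esub> x = x" by (simp add: fr_dlog_one)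
next
  fix x assume x: "x \<in> carrier H"
  \<comment> \<open>\<open>y\<close> is the image of the field inverse \<open>x [^] (N - 1)\<close>
    under \<open>(q - 1) * dlog x\<close> Frobenius steps; the \<open>dlog x\<close> further steps
    in the twisted product complete a multiple of \<open>q\<close> and thus the identity. So
    \<open>y\<close> is a right inverse by design.\<close>
  define y where "y = \<gamma> [^] (dlog x * (N - 1) * p ^ ((q - 1) * dlog x))"
  have y: "y \<in> carrier R" "y \<noteq> \<zero>" using gen by (simp_all add: y_def pow_nonzero)
  have xR: "x \<in> carrier R" "x \<noteq> \<zero>" using x by auto
  have xy: "fr (dlog x) y = x [^] (N - 1)"
  proof -
    have e: "y = fr ((q - 1) * dlog x) (x [^] (N - 1))"
      using gen dlog[OF xR] by (simp add: y_def fr_def flip: nat_pow_pow)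
    have "fr (dlog x) y = fr (dlog x + (q - 1) * dlog x) (x [^] (N - 1))"
      unfolding e using xR by (simp add: fr_fr)
    also have "dlog x + (q - 1) * dlog x = q * dlog x" using q1 by (simp add: diff_mult_distrib)
    finally show ?thesis using xR by (simp add: fr_id)
  qed
  have "x \<otimes> x [^] (N - 1) = \<one>"
    using xR pow_N[OF xR] N_pos nat_pow_Suc2[OF xR(1), of "N - 1"] by simp
  then have r: "x \<otimes>\<^bsub>H\<^esub> y = \<one>" using xy by simp
  \<comment> \<open>\<open>y\<close> is a left inverse too: \<open>fr (dlog y)\<close> inverts \<open>fr (dlog x)\<close>, because \<open>x \<circ> y = \<one>\<close>\<close>
  have yH: "y \<in> carrier H" using y by simp
  have "fr (dlog y) (x \<otimes> fr (dlog x) y) = \<one>" using r by simp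
  then have 1: "fr (dlog y) x \<otimes> fr (dlog y) (fr (dlog x) y) = \<one>" using xR y by (simp add: fr_mult)
  have "fr (dlog y) (fr (dlog x) y) = fr (dlog (x \<otimes> fr (dlog x) y)) y"
    using fr_dlog_mult[OF x yH y(1)] xR y by (simp add: fr_fr add.commute)
  also have "\<dots> = y" using r y by (simp add: fr_dlog_one)
  finally have "fr (dlog y) x \<otimes> y = \<one>" using 1 by simp
  then have "y \<otimes>\<^bsub>H\<^esub> x = \<one>\<^bsub>H\<^esub>" using xR y by (simp add: m_comm)
  then show "\<exists>y\<in>carrier H. y \<otimes>\<^bsub>H\<^esub> x = \<one>\<^bsub>H\<^esub>" using yH by blast
qed

text \<open>The linear character of \<open>H\<close> that twists the dual copy; its kernel is
  \<open>C\<close>. Its values on nonzero elements are \<open>q\<close>-th roots of unity, which lie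
  in the prime field because \<open>q\<close> divides \<open>p - 1\<close>.\<close>

definition \<epsilon> where "\<epsilon> b = b [^] (N div q)"

text \<open>The prime field, described as the fixed points of the Frobenius map so that closure
  under the field operations is immediate; \<open>Z_eq\<close> identifies it with the multiples of
  one.\<close>

definition Z where "Z = {z \<in> carrier R. z [^] p = z}"

lemma Z_carrier: "z \<in> Z \<Longrightarrow> z \<in> carrier R"
  by (simp add: Z_def)

lemma fr_Z [simp]: "z \<in> Z \<Longrightarrow> fr k z = z"
  by (induction k) (simp_all add: fr_Suc Z_def)

lemma Z_mult: "\<lbrakk>x \<in> Z; y \<in> Z\<rbrakk> \<Longrightarrow> x \<otimes> y \<in> Z"
  by (simp add: Z_def nat_pow_distrib)

lemma Z_add: "\<lbrakk>x \<in> Z; y \<in> Z\<rbrakk> \<Longrightarrow> x \<oplus> y \<in> Z"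
  by (simp add: Z_def frob)

lemma one_Z: "\<one> \<in> Z" and zero_Z: "\<zero> \<in> Z"
  using p1 by (auto simp: Z_def nat_pow_zero)

lemma Z_pow: "x \<in> Z \<Longrightarrow> x [^] (n::nat) \<in> Z"
  by (induction n) (simp_all add: Z_mult one_Z)

lemma Z_neg: assumes x: "x \<in> Z" shows "\<ominus> x \<in> Z"
proof -
  have xR: "x \<in> carrier R" using x by (rule Z_carrier)
  have "(\<ominus> x) [^] p \<oplus> x = (\<ominus> x \<oplus> x) [^] p" using x frob[of "\<ominus> x" x] by (simp add: Z_def)
  also have "\<dots> = \<zero>" using xR p1 by (simp add: l_neg nat_pow_zero)
  finally have "(\<ominus> x) [^] p = \<ominus> x" using xR by (intro minus_equality[symmetric]) simp_all
  then show ?thesis using xR by (simp add: Z_def)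
qed

lemma \<epsilon>_Z: assumes "b \<in> carrier R" "b \<noteq> \<zero>" shows "\<epsilon> b \<in> Z"
proof -
  obtain t where t: "p - 1 = q * t" using q_dvd by (rule dvdE)
  have "(N div q) * p = (N div q) + N * t"
  proof -
    have pS: "p = Suc (q * t)" using t p1 by linarith
    have "(N div q) * p = (N div q) * Suc (q * t)" by (simp only: pS[symmetric])
    also have "\<dots> = N div q + (N div q * q) * t" by (simp add: algebra_simps)
    finally show ?thesis using q_dvd_N by simp
  qed
  then have "\<epsilon> b [^] p = b [^] (N div q) \<otimes> (b [^] N) [^] t"
    using assms by (simp add: \<epsilon>_def nat_pow_pow nat_pow_mult)
  then show ?thesis using assms by (simp add: \<epsilon>_def Z_def pow_N)
qed

declare Z_carrier [simp]

lemma \<epsilon>_mult: "\<lbrakk>b \<in> carrier H; c \<in> carrier H\<rbrakk> \<Longrightarrow> \<epsilon> (b \<otimes> fr (dlog b) c) = \<epsilon> b \<otimes> \<epsilon> c"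
  using fr_Z[OF \<epsilon>_Z[of c]] fr_pow[of c "dlog b" "N div q"] by (simp add: \<epsilon>_def nat_pow_distrib)

lemma \<epsilon>_one: "\<epsilon> \<one> = \<one>"
  by (simp add: \<epsilon>_def)

lemma \<epsilon>_closed [simp]: "b \<in> carrier R \<Longrightarrow> \<epsilon> b \<in> carrier R"
  by (simp add: \<epsilon>_def)

lemma \<epsilon>_eq_one_iff: assumes "b \<in> carrier R" "b \<noteq> \<zero>" shows "\<epsilon> b = \<one> \<longleftrightarrow> q dvd dlog b"
proof -
  obtain t where t: "N = q * t" using q_dvd_N by (rule dvdE)
  then have t0: "N div q = t" "t > 0" using q1 N_pos by auto
  have "\<epsilon> b = \<gamma> [^] (dlog b * t)"
    using dlog[OF assms] gen t0 by (simp add: \<epsilon>_def flip: nat_pow_pow)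
  then have "\<epsilon> b = \<one> \<longleftrightarrow> [dlog b * t = 0] (mod N)" using pow_gen_eq_iff[of "dlog b * t" 0] by simp
  also have "\<dots> \<longleftrightarrow> q dvd dlog b" unfolding cong_0_iff t using t0 by simp
  finally show ?thesis .
qed

section \<open>The actions of \<open>H\<close> on the two copies of \<open>K\<close>\<close>

definition A where "A b w = b \<otimes> fr (dlog b) w"
text \<open>In \<open>B\<close>, the factor \<open>b [^] (N - 1)\<close> is the inverse of \<open>b\<close>: this makes \<open>A b\<close> and \<open>B b\<close> adjoint up
  to the scalar \<open>\<epsilon> b\<close> with respect to the trace form.\<close>

definition B where "B b f = \<epsilon> b \<otimes> b [^] (N - 1) \<otimes> fr (dlog b) f"
definition m where "m b z = \<epsilon> b \<otimes> z"

lemma mult_pow_N1: "\<lbrakk>b \<in> carrier R; b \<noteq> \<zero>\<rbrakk> \<Longrightarrow> b [^] (N - 1) \<otimes> b = \<one>"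
  using pow_N N_pos nat_pow_Suc[of b "N - 1"] by simp

text \<open>Comparing logarithms modulo \<open>q\<close> on both sides of \<open>A b w = w\<close>
  leaves \<open>q dvd dlog b\<close>. Then no Frobenius twist is present, and the equation is an
  ordinary product in the field.\<close>

lemma A_free:
  assumes "b \<in> carrier H" "w \<in> carrier R" "w \<noteq> \<zero>" "A b w = w" shows "b = \<one>"
proof -
  have b: "b \<in> carrier R" "b \<noteq> \<zero>" using assms by auto
  have "\<gamma> [^] dlog w = \<gamma> [^] dlog b \<otimes> fr (dlog b) (\<gamma> [^] dlog w)"
    using assms b by (simp add: dlog A_def)
  also have "\<dots> = \<gamma> [^] (dlog b + dlog w * p ^ dlog b)"
    using gen by (simp add: fr_def nat_pow_pow nat_pow_mult)
  finally have "[dlog w = dlog b + dlog w * p ^ dlog b] (mod N)" using pow_gen_eq_iff by simp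
  then have "[dlog w = dlog b + dlog w * p ^ dlog b] (mod q)"
    using q_dvd_N by (rule cong_dvd_modulus_nat)
  also have "[dlog b + dlog w * p ^ dlog b = dlog b + dlog w * 1] (mod q)"
    by (intro cong_add cong_refl cong_mult p_cong)
  finally have "[dlog w = dlog b + dlog w] (mod q)" by simp
  then have "q dvd dlog b" by (metis add.commute cong_add_lcancel_0_nat cong_0_iff cong_sym)
  then have "b \<otimes> w = \<one> \<otimes> w" using assms b by (simp add: A_def fr_id)
  then show ?thesis using b assms m_rcancel by (metis one_closed)
qed

text \<open>The same comparison with two more factors. The logarithm of \<open>\<epsilon> b\<close>
  vanishes modulo \<open>q\<close> because \<open>q\<close> divides \<open>N div q\<close>, and the
  coefficient \<open>N - 1\<close> left from the inverse of \<open>b\<close> is prime to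
  \<open>q\<close>; so again \<open>b\<close> lies in \<open>C\<close>, where
  \<open>\<epsilon>\<close> is trivial.\<close>

lemma B_free:
  assumes "b \<in> carrier H" "w \<in> carrier R" "w \<noteq> \<zero>" "B b w = w" shows "b = \<one>"
proof -
  have b: "b \<in> carrier R" "b \<noteq> \<zero>" using assms by auto
  let ?e = "dlog b * (N div q) + dlog b * (N - 1) + dlog w * p ^ dlog b"
  have "\<gamma> [^] dlog w = (\<gamma> [^] dlog b) [^] (N div q) \<otimes> (\<gamma> [^] dlog b) [^] (N - 1) \<otimes> fr (dlog b) (\<gamma> [^] dlog w)"
    using assms b by (simp add: dlog B_def \<epsilon>_def)
  also have "\<dots> = \<gamma> [^] ?e"
    using gen by (simp add: fr_def nat_pow_pow nat_pow_mult)
  finally have "[dlog w = ?e] (mod N)" using pow_gen_eq_iff by simp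
  then have "[dlog w = ?e] (mod q)"
    using q_dvd_N by (rule cong_dvd_modulus_nat)
  also have "[?e = dlog b * 0 + dlog b * (N - 1) + dlog w * 1] (mod q)"
    using qq_dvd_N by (intro cong_add cong_refl cong_mult p_cong) (simp add: cong_0_iff)
  finally have "[dlog w = dlog b * (N - 1) + dlog w] (mod q)" by simp
  then have "q dvd dlog b * (N - 1)" by (metis add.commute cong_add_lcancel_0_nat cong_0_iff cong_sym)
  moreover have "\<not> q dvd N - 1"
  proof
    assume "q dvd N - 1"
    from dvd_diff_nat[OF q_dvd_N this] have "q dvd 1" using N_pos by simp
    then show False using q1 by (metis nat_dvd_1_iff_1 less_irrefl)
  qed
  ultimately have d: "q dvd dlog b" using prime_q by (simp add: prime_dvd_mult_iff)
  then have "\<epsilon> b = \<one>" using \<epsilon>_eq_one_iff b by simp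
  then have "b [^] (N - 1) \<otimes> w = \<one> \<otimes> w" using assms b d by (simp add: B_def fr_id)
  then have "b [^] (N - 1) = \<one>" using b assms m_rcancel by (metis one_closed nat_pow_closed)
  then show ?thesis using mult_pow_N1[OF b] b by simp
qed

text \<open>Partial sums of the trace of \<open>K\<close> over its prime field.\<close>

primrec ptr :: "nat \<Rightarrow> 'a \<Rightarrow> 'a" where
  "ptr 0 x = \<zero>"
| "ptr (Suc n) x = ptr n x \<oplus> fr n x"

lemma ptr_closed [simp]: "x \<in> carrier R \<Longrightarrow> ptr n x \<in> carrier R"
  by (induction n) auto

lemma ptr_add: "\<lbrakk>x \<in> carrier R; y \<in> carrier R\<rbrakk> \<Longrightarrow> ptr n (x \<oplus> y) = ptr n x \<oplus> ptr n y"
  by (induction n) (simp_all add: fr_add a_ac)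

lemma ptr_scale: "\<lbrakk>z \<in> Z; x \<in> carrier R\<rbrakk> \<Longrightarrow> ptr n (z \<otimes> x) = z \<otimes> ptr n x"
  by (induction n) (simp_all add: fr_mult r_distr)

lemma ptr_fr: "x \<in> carrier R \<Longrightarrow> ptr n (fr k x) = fr k (ptr n x)"
proof (induction n)
  case 0
  have "fr k \<zero> = \<zero>" using p1 by (simp add: fr_def nat_pow_zero)
  then show ?case by simp
next
  case (Suc n)
  then show ?case by (simp add: fr_add fr_fr add.commute)
qed

lemma ptr_shift: "x \<in> carrier R \<Longrightarrow> x \<oplus> ptr n (fr 1 x) = ptr (Suc n) x"
  by (induction n) (simp_all add: fr_fr a_assoc[symmetric])

definition tr where "tr x = ptr q x"

lemma tr_closed [simp]: "x \<in> carrier R \<Longrightarrow> tr x \<in> carrier R"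
  by (simp add: tr_def)

text \<open>Shifting by one Frobenius step replaces the summand \<open>x\<close> by
  \<open>fr q x\<close>, which is \<open>x\<close> again.\<close>

lemma tr_fr1: "x \<in> carrier R \<Longrightarrow> fr 1 (tr x) = tr x"
proof -
  assume x: "x \<in> carrier R"
  have "x \<oplus> ptr q (fr 1 x) = x \<oplus> ptr q x"
    using ptr_shift[OF x, of q] x by (simp add: fr_q a_comm)
  then have "ptr q (fr 1 x) = ptr q x" using x by (metis r_neg1 fr_closed ptr_closed)
  then show ?thesis using ptr_fr[OF x, of q 1] by (simp add: tr_def)
qed

lemma tr_Z: "x \<in> carrier R \<Longrightarrow> tr x \<in> Z"
  using tr_fr1[of x] by (simp add: Z_def fr_def del: Z_carrier)

lemma tr_fr: "x \<in> carrier R \<Longrightarrow> tr (fr k x) = tr x"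
  using ptr_fr[of x q k] fr_Z[OF tr_Z, of x k] by (simp add: tr_def)

lemma add_pow_pq: "x \<in> carrier R \<Longrightarrow> add_pow R (p ^ q) x = \<zero>"
  using add.pow_order_eq_1[of x] card by (simp add: Coset.order_def)

text \<open>The additive order of one divides \<open>p^q\<close>. If \<open>p\<close> times one were
  nonzero, so would be \<open>p^n\<close> times one for every \<open>n\<close>, since there are no
  zero divisors; hence the order is \<open>p\<close>.\<close>

lemma char_p: "add_pow R (k::nat) \<one> = \<zero> \<longleftrightarrow> p dvd k"
proof -
  let ?o = "add.ord \<one>"
  have iff: "add_pow R (n::nat) \<one> = \<zero> \<longleftrightarrow> ?o dvd n" for n
    using add.pow_eq_id[of \<one> n] by simp
  have "?o dvd p ^ q" using add_pow_pq[of \<one>] iff by simp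
  then obtain i where i: "?o = p ^ i" using prime_p by (metis divides_primepow_nat)
  have pz: "add_pow R (p) \<one> = \<zero>"
  proof (rule ccontr)
    assume nz: "add_pow R (p) \<one> \<noteq> \<zero>"
    have "add_pow R (p ^ n) \<one> \<noteq> \<zero>" for n
    proof (induction n)
      case (Suc n)
      have "add_pow R (p ^ Suc n) \<one> = add_pow R (p) \<one> \<otimes> add_pow R (p ^ n) \<one>"
        by (simp add: add_pow_ldistr add.nat_pow_pow mult.commute)
      then show ?case using Suc nz integral_iff by simp
    qed simp
    then show False using iff[of "p ^ i"] i by simp
  qed
  then have "?o dvd p" using iff by simp
  moreover have "?o \<noteq> 1" using iff[of 1] by simp
  ultimately have "?o = p" using prime_p prime_nat_iff by auto
  then show ?thesis using iff by simp
qed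

lemma ptr_one: "ptr n \<one> = add_pow R (n) \<one>"
  by (induction n) (simp_all add: add.nat_pow_Suc)

text \<open>The trace of one is \<open>q\<close>, nonzero because \<open>q\<close> is less than the
  characteristic \<open>p\<close>. Dividing by it and by \<open>w\<close>, each time through the
  power \<open>N - 1\<close>, solves the equation and gives nondegeneracy of the trace form.\<close>

lemma T_surj:
  assumes "w \<in> carrier R" "w \<noteq> \<zero>" "z \<in> Z"
  shows "\<exists>f\<in>carrier R. tr (f \<otimes> w) = z"
proof -
  let ?c = "tr \<one>"
  have c: "?c \<in> Z" "?c \<in> carrier R" by (simp_all add: tr_Z)
  have "\<not> p dvd q" using q_less_p q1 by (auto dest: dvd_imp_le)
  then have c0: "?c \<noteq> \<zero>" using char_p[of q] by (simp add: tr_def ptr_one)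
  let ?u = "z \<otimes> ?c [^] (N - 1)"
  have u: "?u \<in> Z" using c assms by (simp add: Z_mult Z_pow)
  let ?f = "?u \<otimes> w [^] (N - 1)"
  have "?f \<otimes> w = ?u" using u assms mult_pow_N1[OF assms(1,2)] by (simp add: m_assoc)
  then have "tr (?f \<otimes> w) = ?u \<otimes> tr \<one>" using ptr_scale[OF u, of \<one> q] u by (simp add: tr_def)
  also have "\<dots> = z" using mult_pow_N1[OF c(2) c0] assms c by (simp add: m_assoc)
  finally show ?thesis using u assms by (intro bexI[of _ ?f]) auto
qed

lemma C_iff: "b \<in> carrier H \<Longrightarrow> (\<forall>z\<in>Z. m b z = z) \<longleftrightarrow> q dvd dlog b"
proof
  assume b: "b \<in> carrier H" and "\<forall>z\<in>Z. m b z = z"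
  then have "m b \<one> = \<one>" using one_Z by blast
  then have "\<epsilon> b = \<one>" using b by (simp add: m_def)
  then show "q dvd dlog b" using b \<epsilon>_eq_one_iff by simp
next
  assume b: "b \<in> carrier H" and "q dvd dlog b"
  then have "\<epsilon> b = \<one>" using \<epsilon>_eq_one_iff by simp
  then show "\<forall>z\<in>Z. m b z = z" by (simp add: m_def)
qed

end

section \<open>Complex characters of \<open>Z\<close> and \<open>C\<close>\<close>

definition root_of_unity :: "nat \<Rightarrow> nat \<Rightarrow> complex" where
  "root_of_unity n k = cis (2 * pi * real k / real n)"

lemma root_of_unity_add: "root_of_unity n (j + k) = root_of_unity n j * root_of_unity n k"
  by (simp add: root_of_unity_def cis_mult add_divide_distrib distrib_left)

lemma root_of_unity_0 [simp]: "root_of_unity n 0 = 1"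
  by (simp add: root_of_unity_def)

lemma root_of_unity_mod: assumes "n > 0" shows "root_of_unity n k = root_of_unity n (k mod n)"
proof -
  have "root_of_unity n (n * t) = 1" for t
    using assms cis_multiple_2pi[of "real t"] by (simp add: root_of_unity_def mult_ac)
  then have "root_of_unity n (k mod n + n * (k div n)) = root_of_unity n (k mod n)"
    by (simp only: root_of_unity_add mult_1_right)
  then show ?thesis by simp
qed

lemma root_of_unity_eq_iff:
  assumes "n > 0" shows "root_of_unity n j = root_of_unity n k \<longleftrightarrow> [j = k] (mod n)"
proof -
  have "inj_on (root_of_unity n) {..<n}"
    using bij_betw_imp_inj_on[OF bij_betw_roots_unity[OF assms]] by (simp add: root_of_unity_def[abs_def])
  then have "root_of_unity n (j mod n) = root_of_unity n (k mod n) \<longleftrightarrow> j mod n = k mod n"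
    using assms by (auto dest!: inj_onD)
  then show ?thesis using root_of_unity_mod[OF assms] by (metis cong_def)
qed

context nearfield
begin

lemma add_pow_one_eq_iff: "add_pow R (j::nat) \<one> = add_pow R (k::nat) \<one> \<longleftrightarrow> [j = k] (mod p)"
proof (induction j k rule: linorder_wlog)
  case (le j k)
  have "add_pow R k \<one> = add_pow R j \<one> \<oplus> add_pow R (k - j) \<one>"
    using le by (simp add: add.nat_pow_mult)
  then have "add_pow R j \<one> = add_pow R k \<one> \<longleftrightarrow> add_pow R (k - j) \<one> = \<zero>"
    by (simp add: add.l_cancel_one')
  also have "\<dots> \<longleftrightarrow> p dvd k - j" by (rule char_p)
  also have "\<dots> \<longleftrightarrow> [j = k] (mod p)" using le by (metis cong_altdef_nat cong_sym_eq)
  finally show ?case .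
qed (metis cong_sym)

text \<open>A counting argument: a nonzero solution of \<open>z [^] p = z\<close> has a logarithm
  divisible by \<open>N div (p - 1)\<close>, so there are at most \<open>p\<close> fixed points
  including zero, and the multiples of one already supply \<open>p\<close> of them.\<close>

lemma Z_eq: "Z = (\<lambda>k::nat. add_pow R k \<one>) ` {..<p}"
proof -
  let ?P = "(\<lambda>k::nat. add_pow R k \<one>) ` {..<p}"
  have inj: "inj_on (\<lambda>k::nat. add_pow R k \<one>) {..<p}"
    by (rule inj_onI) (simp add: add_pow_one_eq_iff cong_def)
  have "add_pow R (k::nat) \<one> \<in> Z" for k
    by (induction k) (simp_all add: zero_Z Z_add one_Z)
  then have PZ: "?P \<subseteq> Z" by blast
  define M where "M = N div (p - 1)"
  have M: "N = M * (p - 1)" using p1q_dvd by (simp add: M_def)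
  have "Z \<subseteq> insert \<zero> ((\<lambda>j. \<gamma> [^] (M * j)) ` {..<p - 1})"
  proof
    fix z assume z: "z \<in> Z"
    show "z \<in> insert \<zero> ((\<lambda>j. \<gamma> [^] (M * j)) ` {..<p - 1})"
    proof (cases "z = \<zero>")
      case False
      have zR: "z \<in> carrier R" using z by simp
      let ?k = "dlog z"
      have zk: "z = \<gamma> [^] ?k" using dlog[OF zR False] by simp
      have "z [^] p = z" using z unfolding Z_def by blast
      then have "\<gamma> [^] (?k * p) = \<gamma> [^] ?k" using zk gen by (metis nat_pow_pow)
      then have "[?k * p = ?k] (mod N)" by (simp only: pow_gen_eq_iff)
      then have "N dvd ?k * p - ?k" using p1 by (simp add: cong_altdef_nat)
      moreover have "?k * p - ?k = ?k * (p - 1)" by (simp add: diff_mult_distrib2)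
      ultimately have "M * (p - 1) dvd ?k * (p - 1)" using M by simp
      then have "M dvd ?k" using p1 by simp
      then obtain j where j: "?k = M * j" by (rule dvdE)
      have "[M * j = M * (j mod (p - 1))] (mod N)"
        unfolding M cong_def by (simp add: mod_mult_mult1)
      then have "z = \<gamma> [^] (M * (j mod (p - 1)))"
        using zk j pow_gen_eq_iff by simp
      moreover have "j mod (p - 1) < p - 1" using p1 by simp
      ultimately show ?thesis by blast
    qed simp
  qed
  then have "card Z \<le> card (insert \<zero> ((\<lambda>j. \<gamma> [^] (M * j)) ` {..<p - 1}))"
    by (rule card_mono[rotated]) simp
  also have "\<dots> \<le> Suc (card ((\<lambda>j. \<gamma> [^] (M * j)) ` {..<p - 1}))" by (rule card_insert_le_m1) auto
  also have "\<dots> \<le> Suc (p - 1)" using card_image_le[of "{..<p - 1}"] by auto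
  also have "\<dots> = p" using p1 by simp
  finally have le: "card Z \<le> card ?P" using inj by (simp add: card_image)
  have "Z \<subseteq> carrier R" using Z_carrier by blast
  then have "finite Z" using fin by (rule finite_subset)
  from card_seteq[OF this PZ le] show ?thesis by (rule sym)
qed

lemma additive_character: 
  "\<exists>\<theta> :: 'a \<Rightarrow> complex. (\<forall>x\<in>Z. \<forall>y\<in>Z. \<theta> (x \<oplus> y) = \<theta> x * \<theta> y) \<and>
      \<theta> \<zero> = 1 \<and> (\<exists>z\<in>Z. \<theta> z \<noteq> 1)"
proof -
  define j where "j z = (SOME k::nat. z = add_pow R k \<one>)" for z
  have j: "add_pow R (j z) \<one> = z" if "z \<in> Z" for z
  proof -
    have "\<exists>k::nat. z = add_pow R k \<one>" using that unfolding Z_eq by blast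
    from someI_ex[OF this] show ?thesis unfolding j_def by simp
  qed
  define \<theta> where "\<theta> z = root_of_unity p (j z)" for z
  have p0: "p > 0" using p1 by simp
  have \<theta>: "\<theta> (add_pow R k \<one>) = root_of_unity p k" if "add_pow R k \<one> \<in> Z" for k
    using j[OF that] by (simp add: \<theta>_def root_of_unity_eq_iff[OF p0] add_pow_one_eq_iff)
  have "\<theta> (x \<oplus> y) = \<theta> x * \<theta> y" if "x \<in> Z" "y \<in> Z" for x y
  proof -
    have xy: "x \<oplus> y = add_pow R (j x + j y) \<one>"
      using j[OF that(1)] j[OF that(2)] by (metis add.nat_pow_mult one_closed)
    have "\<theta> (add_pow R (j x + j y) \<one>) = root_of_unity p (j x + j y)"
      by (rule \<theta>) (use Z_add[OF that] xy in simp)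
    then show ?thesis unfolding xy by (simp add: root_of_unity_add \<theta>_def)
  qed
  moreover have "\<theta> \<zero> = 1" using \<theta>[of 0] zero_Z by simp
  moreover have "\<theta> \<one> \<noteq> 1"
  proof -
    have "\<theta> \<one> = root_of_unity p 1" using \<theta>[of 1] one_Z by simp
    then show ?thesis using root_of_unity_eq_iff[OF p0, of 1 0] p1 by (simp add: cong_def)
  qed
  ultimately show ?thesis using one_Z by blast
qed

lemma C_eq: "{b \<in> carrier H. \<forall>z\<in>Z. m b z = z} = {b \<in> carrier H. q dvd dlog b}"
  using C_iff by blast

lemma card_H: "card (carrier H) = N"
  using card fin by (simp add: N_def card_Diff_singleton)

lemma card_C: "q * card {b \<in> carrier H. \<forall>z\<in>Z. m b z = z} = card (carrier H)"
proof -
  obtain t where t: "N = q * t" using q_dvd_N by (rule dvdE)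
  have t0: "t > 0" using t N_pos by (cases t) auto
  have q0: "q > 0" using q1 by simp
  have "{b \<in> carrier H. q dvd dlog b} = (\<lambda>j. \<gamma> [^] (q * j)) ` {..<t}"
  proof (intro equalityI subsetI)
    fix b assume b: "b \<in> {b \<in> carrier H. q dvd dlog b}"
    then obtain j where j: "dlog b = q * j" by (auto elim: dvdE)
    have "[q * j = q * (j mod t)] (mod N)" unfolding t cong_def by (simp add: mod_mult_mult1)
    then have "b = \<gamma> [^] (q * (j mod t))" using dlog[of b] b j pow_gen_eq_iff by auto
    moreover have "j mod t < t" using t0 by simp
    ultimately show "b \<in> (\<lambda>j. \<gamma> [^] (q * j)) ` {..<t}" by blast
  next
    fix b assume "b \<in> (\<lambda>j. \<gamma> [^] (q * j)) ` {..<t}"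
    then obtain j where b: "b = \<gamma> [^] (q * j)" by blast
    have "[dlog b = q * j] (mod q)" unfolding b using dlog_gen q_dvd_N by (rule cong_dvd_modulus_nat)
    then have "q dvd dlog b" by (metis cong_dvd_iff dvd_triv_left)
    then show "b \<in> {b \<in> carrier H. q dvd dlog b}" using b gen pow_nonzero by simp
  qed
  moreover have "inj_on (\<lambda>j. \<gamma> [^] (q * j)) {..<t}"
  proof (rule inj_onI)
    fix j k assume jk: "j \<in> {..<t}" "k \<in> {..<t}" "\<gamma> [^] (q * j) = \<gamma> [^] (q * k)"
    then have "[q * j = q * k] (mod q * t)" by (simp only: pow_gen_eq_iff t)
    then have "(q * j) mod (q * t) = (q * k) mod (q * t)" by (simp add: cong_def)
    then show "j = k" using jk q0 by simp
  qed
  ultimately have "card {b \<in> carrier H. q dvd dlog b} = t" by (simp add: card_image)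
  then show ?thesis unfolding C_eq card_H using t by simp
qed

text \<open>On \<open>C\<close> the twisted product is the field product, so \<open>C\<close> is the
  cyclic group of nonzero \<open>q\<close>-th powers and in particular abelian.\<close>

lemma C_mult: "\<lbrakk>q dvd dlog b; b \<in> carrier R; c \<in> carrier R\<rbrakk> \<Longrightarrow> b \<otimes>\<^bsub>H\<^esub> c = b \<otimes> c"
  by (simp add: fr_id)

lemma dlog_mult: "\<lbrakk>b \<in> carrier H; c \<in> carrier H\<rbrakk> \<Longrightarrow> [dlog (b \<otimes> c) = dlog b + dlog c] (mod N)"
  using dlog_gen[of "dlog b + dlog c"] gen by (simp add: dlog flip: nat_pow_mult)

text \<open>The character sends \<open>\<gamma> [^] k\<close> to the \<open>N\<close>-th root of
  unity with exponent \<open>k\<close>, so it is faithful on \<open>C\<close>. An element outside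
  \<open>C\<close> conjugates \<open>C\<close> by a nontrivial power of Frobenius, which moves
  \<open>\<gamma> [^] q\<close>, and \<open>\<kappa>\<close> detects this.\<close>

lemma kappa_exists: "\<exists>\<kappa> :: 'a \<Rightarrow> complex.
      (\<forall>b\<in>{b \<in> carrier H. \<forall>z\<in>Z. m b z = z}. \<forall>c\<in>{b \<in> carrier H. \<forall>z\<in>Z. m b z = z}.
         \<kappa> (b \<otimes>\<^bsub>H\<^esub> c) = \<kappa> b * \<kappa> c) \<and> \<kappa> \<one>\<^bsub>H\<^esub> = 1 \<and>
      (\<forall>b\<in>carrier H. b \<notin> {b \<in> carrier H. \<forall>z\<in>Z. m b z = z} \<longrightarrow>
        (\<exists>c\<in>{b \<in> carrier H. \<forall>z\<in>Z. m b z = z}. \<exists>c'\<in>{b \<in> carrier H. \<forall>z\<in>Z. m b z = z}.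
          c \<otimes>\<^bsub>H\<^esub> b = b \<otimes>\<^bsub>H\<^esub> c' \<and> \<kappa> c \<noteq> \<kappa> c'))"
  unfolding C_eq
proof (intro exI[of _ "\<lambda>b. root_of_unity N (dlog b)"] conjI ballI impI)
  fix b c assume b: "b \<in> {b \<in> carrier H. q dvd dlog b}" and c: "c \<in> {b \<in> carrier H. q dvd dlog b}"
  have "b \<otimes>\<^bsub>H\<^esub> c = b \<otimes> c" using b c by (intro C_mult) auto
  moreover have "root_of_unity N (dlog (b \<otimes> c)) = root_of_unity N (dlog b + dlog c)"
    unfolding root_of_unity_eq_iff[OF N_pos] using b c by (intro dlog_mult) auto
  ultimately show "root_of_unity N (dlog (b \<otimes>\<^bsub>H\<^esub> c)) = root_of_unity N (dlog b) * root_of_unity N (dlog c)"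
    by (simp add: root_of_unity_add)
next
  have "root_of_unity N (dlog \<one>) = root_of_unity N 0"
    unfolding root_of_unity_eq_iff[OF N_pos] by (rule dlog_one)
  then show "root_of_unity N (dlog \<one>\<^bsub>H\<^esub>) = 1" by simp
next
  fix b assume b: "b \<in> carrier H" and "b \<notin> {b \<in> carrier H. q dvd dlog b}"
  then have nd: "\<not> q dvd dlog b" by blast
  have bR: "b \<in> carrier R" using b by simp
  define j where "j = dlog b mod q"
  have j: "0 < j" "j < q" using nd q1 by (auto simp: j_def mod_greater_zero_iff_not_dvd)
  have frj: "fr (dlog b) x = fr j x" if "x \<in> carrier R" for x
    by (rule fr_cong) (use that in \<open>simp_all add: j_def cong_def\<close>)
  \<comment> \<open>\<open>?c\<close> is the image of \<open>?c'\<close> under \<open>j\<close>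
    Frobenius steps, the conjugation effected by \<open>b\<close>.\<close>
  let ?c' = "\<gamma> [^] q" and ?c = "\<gamma> [^] (q * p ^ j)"
  have c'R: "?c' \<in> carrier R" "?c' \<noteq> \<zero>" and cR: "?c \<in> carrier R" "?c \<noteq> \<zero>" using gen pow_nonzero by auto
  have d: "q dvd dlog (\<gamma> [^] (q * i))" for i
  proof -
    have "[dlog (\<gamma> [^] (q * i)) = q * i] (mod q)" using dlog_gen q_dvd_N by (rule cong_dvd_modulus_nat)
    then show ?thesis by (metis cong_dvd_iff dvd_triv_left)
  qed
  have "fr j ?c' = ?c" using gen by (simp add: fr_def nat_pow_pow)
  then have eq: "?c \<otimes>\<^bsub>H\<^esub> b = b \<otimes>\<^bsub>H\<^esub> ?c'"
    using C_mult[OF d cR(1) bR] frj[OF c'R(1)] cR bR by (simp add: m_comm)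
  \<comment> \<open>As \<open>0 < j < q\<close> and \<open>q \<le> p - 1\<close>, the number
    \<open>q * p ^ j\<close> lies strictly between \<open>q\<close> and \<open>N\<close>.\<close>
  have "\<not> [q * p ^ j = q] (mod N)"
  proof
    assume cong: "[q * p ^ j = q] (mod N)"
    have "p ^ j \<le> p ^ (q - 1)" using j p1 by (intro power_increasing) auto
    then have "q * p ^ j \<le> (p - 1) * p ^ (q - 1)" using q_less_p by (intro mult_mono) auto
    also have "\<dots> = p ^ q - p ^ (q - 1)"
      using q1 by (simp add: diff_mult_distrib flip: power_Suc)
    also have "\<dots> < N"
    proof -
      have "p ^ (q - 1) > 1" using p1 q1 by (intro one_less_power) auto
      moreover have "p ^ (q - 1) \<le> p ^ q" using p1 by (intro power_increasing) auto
      ultimately show ?thesis unfolding N_def by linarith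
    qed
    finally have lt: "q * p ^ j < N" .
    have "1 < p ^ j" using j p1 by (intro one_less_power)
    then have gt: "q < q * p ^ j" using q1 by simp
    have "q * p ^ j = q" using cong_less_modulus_unique_nat[OF cong lt] gt lt by linarith
    then show False using gt by linarith
  qed
  moreover have "root_of_unity N (dlog ?c) = root_of_unity N (q * p ^ j)"
    "root_of_unity N (dlog ?c') = root_of_unity N q"
    unfolding root_of_unity_eq_iff[OF N_pos] by (rule dlog_gen)+
  ultimately have ne: "root_of_unity N (dlog ?c) \<noteq> root_of_unity N (dlog ?c')"
    by (simp only: root_of_unity_eq_iff[OF N_pos, symmetric] not_False_eq_True)
  show "\<exists>c\<in>{b \<in> carrier H. q dvd dlog b}. \<exists>c'\<in>{b \<in> carrier H. q dvd dlog b}.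
      c \<otimes>\<^bsub>H\<^esub> b = b \<otimes>\<^bsub>H\<^esub> c' \<and> root_of_unity N (dlog c) \<noteq> root_of_unity N (dlog c')"
    by (intro bexI[of _ ?c] bexI[of _ ?c'] conjI eq ne) (use cR c'R d[of "p ^ j"] d[of 1] in auto)
qed

text \<open>On \<open>C\<close>, conjugation by \<open>\<gamma>\<close> is the Frobenius map, so the
  commutator of \<open>c\<close> with \<open>\<gamma>\<close> is the inverse of
  \<open>c [^] (p - 1)\<close>. The elements of \<open>C\<close> not annihilated by any power of
  \<open>p - 1\<close> are stable under this operation, and \<open>\<gamma> [^] q\<close> is one of
  them by \<open>not_dvd_power_minus_one\<close>.\<close>

lemma D_exists: "\<exists>D \<subseteq> carrier H - {\<one>\<^bsub>H\<^esub>}. D \<noteq> {} \<and>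
      (\<forall>c\<in>D. \<exists>x\<in>carrier H. \<exists>d\<in>D. c \<otimes>\<^bsub>H\<^esub> x = d \<otimes>\<^bsub>H\<^esub> x \<otimes>\<^bsub>H\<^esub> c)"
proof -
  let ?D = "{c \<in> carrier H. q dvd dlog c \<and> (\<forall>n::nat. c [^] ((p - 1) ^ n) \<noteq> \<one>)}"
  have "?D \<subseteq> carrier H - {\<one>\<^bsub>H\<^esub>}" by (auto simp: nat_pow_one)
  moreover have "\<gamma> [^] q \<in> ?D"
  proof (intro CollectI conjI allI)
    show "\<gamma> [^] q \<in> carrier H" using gen pow_nonzero by simp
    have "[dlog (\<gamma> [^] q) = q] (mod q)" using dlog_gen q_dvd_N by (rule cong_dvd_modulus_nat)
    then show "q dvd dlog (\<gamma> [^] q)" by (metis cong_dvd_iff dvd_refl)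
    fix n
    have "\<gamma> [^] (q * (p - 1) ^ n) \<noteq> \<gamma> [^] (0::nat)"
      using not_dvd_power_minus_one[OF prime_q odd_q q_dvd p1, of n]
      by (simp only: pow_gen_eq_iff cong_0_iff N_def) simp
    then show "(\<gamma> [^] q) [^] ((p - 1) ^ n) \<noteq> \<one>" using gen by (simp add: nat_pow_pow)
  qed
  moreover have "\<exists>x\<in>carrier H. \<exists>d\<in>?D. c \<otimes>\<^bsub>H\<^esub> x = d \<otimes>\<^bsub>H\<^esub> x \<otimes>\<^bsub>H\<^esub> c" if c: "c \<in> ?D" for c
  proof -
    have cR: "c \<in> carrier R" "c \<noteq> \<zero>" "q dvd dlog c" using c by auto
    \<comment> \<open>Modulo \<open>N\<close> the exponent is \<open>1 - p\<close>, written as a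
      natural number.\<close>
    let ?d = "c [^] ((p - 1) * (N - 1))"
    have dR: "?d \<in> carrier R" "?d \<noteq> \<zero>" using cR pow_nonzero by auto
    have d_dlog: "q dvd dlog ?d"
    proof -
      have e: "?d = \<gamma> [^] (dlog c * ((p - 1) * (N - 1)))" using dlog cR gen by (simp flip: nat_pow_pow)
      have "[dlog ?d = dlog c * ((p - 1) * (N - 1))] (mod q)"
        unfolding e by (rule cong_dvd_modulus_nat[OF dlog_gen q_dvd_N])
      moreover have "q dvd dlog c * ((p - 1) * (N - 1))" using cR(3) by (rule dvd_mult2)
      ultimately show ?thesis using cong_dvd_iff by blast
    qed
    have "?d [^] ((p - 1) ^ n) \<noteq> \<one>" for n :: nat
    proof
      assume "?d [^] ((p - 1) ^ n) = \<one>"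
      moreover have "?d [^] ((p - 1) ^ n) = (c [^] ((p - 1) ^ Suc n)) [^] (N - 1)"
        using cR by (simp add: nat_pow_pow mult_ac)
      ultimately have "(c [^] ((p - 1) ^ Suc n)) [^] (N - 1) = \<one>" by simp
      then have "c [^] ((p - 1) ^ Suc n) = \<one>"
        using mult_pow_N1[of "c [^] ((p - 1) ^ Suc n)"] cR pow_nonzero[OF cR(1,2)]
        by (metis l_one nat_pow_closed)
      then show False using c by blast
    qed
    then have d: "?d \<in> ?D" using dR d_dlog by simp
    have dlg: "[dlog \<gamma> = 1] (mod q)"
      using dlog_gen[of 1] gen q_dvd_N by (metis cong_dvd_modulus_nat nat_pow_eone)
    have "?d \<otimes> c [^] p = c [^] ((p - 1) * (N - 1) + p)" using cR by (simp add: nat_pow_mult)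
    also have "(p - 1) * (N - 1) + p = N * (p - 1) + 1"
    proof -
      have "(p - 1) * (N - 1) + p = (p - 1) * (N - 1) + (p - 1) + 1" using p1 by simp
      also have "\<dots> = (p - 1) * (N - 1 + 1) + 1" by (simp only: distrib_left mult_1_right)
      finally show ?thesis using N_pos by (simp add: mult.commute)
    qed
    also have "c [^] (N * (p - 1) + 1) = (c [^] N) [^] (p - 1) \<otimes> c"
      using cR by (simp add: nat_pow_pow nat_pow_mult)
    also have "\<dots> = c" using pow_N cR by simp
    finally have dc: "?d \<otimes> c [^] p = c" .
    have g: "\<gamma> \<in> carrier H" using gen by simp
    have "?d \<otimes>\<^bsub>H\<^esub> \<gamma> \<otimes>\<^bsub>H\<^esub> c = ?d \<otimes>\<^bsub>H\<^esub> (\<gamma> \<otimes>\<^bsub>H\<^esub> c)"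
      using H.m_assoc[of ?d \<gamma> c] d c g by blast
    also have "\<dots> = ?d \<otimes>\<^bsub>H\<^esub> (\<gamma> \<otimes> c [^] p)"
      using fr_cong[OF dlg cR(1)] by (simp add: fr_def)
    also have "\<dots> = ?d \<otimes> (\<gamma> \<otimes> c [^] p)" using d_dlog dR gen cR by (intro C_mult) auto
    also have "\<dots> = c \<otimes> \<gamma>" using dc dR gen cR by (metis m_comm m_lcomm nat_pow_closed)
    also have "\<dots> = c \<otimes>\<^bsub>H\<^esub> \<gamma>" using C_mult cR gen by simp
    finally have eq: "?d \<otimes>\<^bsub>H\<^esub> \<gamma> \<otimes>\<^bsub>H\<^esub> c = c \<otimes>\<^bsub>H\<^esub> \<gamma>" .
    show ?thesis by (rule bexI[of _ \<gamma>], rule bexI[of _ ?d]) (fact eq[symmetric] d g)+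
  qed
  ultimately show ?thesis by (intro exI[of _ ?D]) blast
qed

theorem heis_nearfield:
  assumes "inj_on enc (carrier R \<times> carrier R \<times> Z \<times> carrier H)"
  shows "heis R H Z A B m (\<lambda>f w. tr (f \<otimes> w)) q enc"
proof (intro heis.intro heis_axioms.intro)
  show "abelian_group R" by (rule abelian_group_axioms)
  show "group H" by (rule H.is_group)
  show "finite (carrier R)" "finite (carrier H)" using fin by simp_all
  show "Z \<subseteq> carrier R" using Z_carrier by blast
  show "\<exists>z\<in>Z. z \<noteq> \<zero>" using one_Z by (intro bexI[of _ \<one>]) simp_all
  show "A b w \<in> carrier R" if "b \<in> carrier H" "w \<in> carrier R" for b w
    using that by (simp add: A_def)
  show "A b (w \<oplus> w') = A b w \<oplus> A b w'" if "b \<in> carrier H" "w \<in> carrier R" "w' \<in> carrier R" for b w w'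
    using that by (simp add: A_def fr_add r_distr)
  show "A \<one>\<^bsub>H\<^esub> w = w" if "w \<in> carrier R" for w using that by (simp add: A_def fr_dlog_one)
  show "A (b \<otimes>\<^bsub>H\<^esub> c) w = A b (A c w)" if "b \<in> carrier H" "c \<in> carrier H" "w \<in> carrier R" for b c w
    using that fr_dlog_mult[OF that] by (simp add: A_def fr_mult m_assoc)
  show "b = \<one>\<^bsub>H\<^esub>" if "b \<in> carrier H" "w \<in> carrier R" "w \<noteq> \<zero>" "A b w = w" for b w
    using A_free[OF that] by simp
  show "B b w \<in> carrier R" if "b \<in> carrier H" "w \<in> carrier R" for b w
    using that by (simp add: B_def)
  show "B b (w \<oplus> w') = B b w \<oplus> B b w'" if "b \<in> carrier H" "w \<in> carrier R" "w' \<in> carrier R" for b w w'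
    using that by (simp add: B_def fr_add r_distr)
  show "B \<one>\<^bsub>H\<^esub> w = w" if "w \<in> carrier R" for w using that by (simp add: B_def fr_dlog_one \<epsilon>_one)
  show "B (b \<otimes>\<^bsub>H\<^esub> c) w = B b (B c w)" if "b \<in> carrier H" "c \<in> carrier H" "w \<in> carrier R" for b c w
  proof -
    have cl: "b \<in> carrier R" "c \<in> carrier R" "c \<noteq> \<zero>" using that by auto
    have "fr (dlog b) (\<epsilon> c) = \<epsilon> c" using \<epsilon>_Z cl by simp
    then show ?thesis
      using that cl fr_dlog_mult[OF that] \<epsilon>_mult[OF that(1,2)]
      by (simp add: B_def fr_mult fr_pow nat_pow_distrib m_ac)
  qed
  show "b = \<one>\<^bsub>H\<^esub>" if "b \<in> carrier H" "w \<in> carrier R" "w \<noteq> \<zero>" "B b w = w" for b w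
    using B_free[OF that] by simp
  show "m b z \<in> Z" if "b \<in> carrier H" "z \<in> Z" for b z
    using that \<epsilon>_Z[of b] by (simp add: m_def Z_mult)
  show "m b (z \<oplus> z') = m b z \<oplus> m b z'" if "b \<in> carrier H" "z \<in> Z" "z' \<in> Z" for b z z'
    using that by (simp add: m_def r_distr)
  show "m \<one>\<^bsub>H\<^esub> z = z" if "z \<in> Z" for z using that by (simp add: m_def \<epsilon>_one)
  show "m (b \<otimes>\<^bsub>H\<^esub> c) z = m b (m c z)" if "b \<in> carrier H" "c \<in> carrier H" "z \<in> Z" for b c z
    using that \<epsilon>_mult[OF that(1,2)] by (simp add: m_def m_assoc)
  show "m b (m c z) = m c (m b z)" if "b \<in> carrier H" "c \<in> carrier H" "z \<in> Z" for b c z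
    using that by (simp add: m_def m_lcomm)
  show "m b z' = z'" if "b \<in> carrier H" "z \<in> Z" "z \<noteq> \<zero>" "m b z = z" "z' \<in> Z" for b z z'
  proof -
    have "\<epsilon> b \<otimes> z = \<one> \<otimes> z" using that by (simp add: m_def)
    then have "\<epsilon> b = \<one>" using that m_rcancel[of z "\<epsilon> b" \<one>] by simp
    then show ?thesis using that by (simp add: m_def)
  qed
  show "tr (f \<otimes> w) \<in> Z" if "f \<in> carrier R" "w \<in> carrier R" for f w
    using that by (simp add: tr_Z)
  show "tr ((f \<oplus> f') \<otimes> w) = tr (f \<otimes> w) \<oplus> tr (f' \<otimes> w)"
    if "f \<in> carrier R" "f' \<in> carrier R" "w \<in> carrier R" for f f' w
    using that by (simp add: l_distr tr_def ptr_add)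
  show "tr (f \<otimes> (w \<oplus> w')) = tr (f \<otimes> w) \<oplus> tr (f \<otimes> w')"
    if "f \<in> carrier R" "w \<in> carrier R" "w' \<in> carrier R" for f w w'
    using that by (simp add: r_distr tr_def ptr_add)
  show "tr (B b f \<otimes> A b w) = m b (tr (f \<otimes> w))"
    if "b \<in> carrier H" "f \<in> carrier R" "w \<in> carrier R" for b f w
  proof -
    have b: "b \<in> carrier R" "b \<noteq> \<zero>" using that by auto
    have "B b f \<otimes> A b w = \<epsilon> b \<otimes> ((b [^] (N - 1) \<otimes> b) \<otimes> (fr (dlog b) f \<otimes> fr (dlog b) w))"
      using that b by (simp add: B_def A_def m_ac)
    also have "\<dots> = \<epsilon> b \<otimes> fr (dlog b) (f \<otimes> w)" using that b mult_pow_N1[OF b] by (simp add: fr_mult)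
    finally show ?thesis
      using that b ptr_scale[OF \<epsilon>_Z[OF b], of "fr (dlog b) (f \<otimes> w)" q] tr_fr[of "f \<otimes> w" "dlog b"]
      by (simp add: m_def tr_def)
  qed
  show "\<exists>f\<in>carrier R. tr (f \<otimes> w) = z" if "w \<in> carrier R" "w \<noteq> \<zero>" "z \<in> Z" for w z
    using T_surj[OF that] .
  show "\<exists>w\<in>carrier R. tr (f \<otimes> w) = z" if "f \<in> carrier R" "f \<noteq> \<zero>" "z \<in> Z" for f z
    using T_surj[OF that] that m_comm by metis
  show "b \<otimes>\<^bsub>H\<^esub> c = c \<otimes>\<^bsub>H\<^esub> b"
    if "b \<in> carrier H" "\<forall>z\<in>Z. m b z = z" "c \<in> carrier H" "\<forall>z\<in>Z. m c z = z" for b c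
    using that C_iff C_mult[of b c] C_mult[of c b] m_comm[of b c] by simp
qed (fact zero_Z | fact prime_q | fact card_C | fact additive_character | fact kappa_exists
    | fact D_exists | fact assms | erule (1) Z_add | erule Z_neg)+

end

section \<open>A field with $p^q$ elements\<close>

text \<open>Integer coefficients together with an ideal containing \<open>p\<close> stand in for
  polynomials over the prime field, so that this field need not be constructed first.\<close>

definition int_poly_ring :: "int poly ring" where
  "int_poly_ring = \<lparr>carrier = UNIV, monoid.mult = (*), one = 1, zero = 0, add = (+)\<rparr>"

lemma int_poly_ring_simps [simp]:
  "carrier int_poly_ring = UNIV" "x \<otimes>\<^bsub>int_poly_ring\<^esub> y = x * y" "\<one>\<^bsub>int_poly_ring\<^esub> = 1"
  "\<zero>\<^bsub>int_poly_ring\<^esub> = 0" "x \<oplus>\<^bsub>int_poly_ring\<^esub> y = x + y"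
  by (simp_all add: int_poly_ring_def)

lemma cring_int_poly_ring: "cring int_poly_ring"
proof (rule cringI)
  show "abelian_group int_poly_ring"
  proof (rule abelian_groupI)
    fix x show "\<exists>y\<in>carrier int_poly_ring. y \<oplus>\<^bsub>int_poly_ring\<^esub> x = \<zero>\<^bsub>int_poly_ring\<^esub>"
      by (intro bexI[of _ "- x"]) auto
  qed (auto simp: algebra_simps)
  show "Group.comm_monoid int_poly_ring" by (rule comm_monoidI) (auto simp: algebra_simps)
qed (auto simp: algebra_simps)

definition poly_ideal :: "int poly set \<Rightarrow> bool" where
  "poly_ideal J \<longleftrightarrow> 0 \<in> J \<and> (\<forall>x\<in>J. \<forall>y\<in>J. x + y \<in> J) \<and> (\<forall>x\<in>J. \<forall>r. r * x \<in> J)"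

lemma ideal_iff_poly_ideal: "ideal J int_poly_ring \<longleftrightarrow> poly_ideal J"
proof
  assume J: "ideal J int_poly_ring"
  then interpret ideal J int_poly_ring .
  show "poly_ideal J"
    unfolding poly_ideal_def
    using additive_subgroup.a_closed[OF is_additive_subgroup] I_l_closed
      additive_subgroup.zero_closed[OF is_additive_subgroup] by auto
next
  assume J: "poly_ideal J"
  interpret cring int_poly_ring by (rule cring_int_poly_ring)
  have minus: "\<ominus>\<^bsub>int_poly_ring\<^esub> x = - x" for x
    using minus_equality[of "- x" x] by simp
  have neg: "- x \<in> J" if "x \<in> J" for x
    using J that unfolding poly_ideal_def by (metis mult_minus1)
  show "ideal J int_poly_ring"
  proof (rule idealI)
    show "ring int_poly_ring" by (rule ring_axioms)
    show "subgroup J (add_monoid int_poly_ring)"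
      by (rule add.subgroupI) (use J neg in \<open>auto simp: poly_ideal_def minus\<close>)
  qed (use J in \<open>auto simp: poly_ideal_def mult.commute\<close>)
qed

lemma maximal_ideal_exists:
  assumes I: "poly_ideal I" "1 \<notin> I"
  obtains M where "poly_ideal M" "I \<subseteq> M" "1 \<notin> M"
    "\<And>J. poly_ideal J \<Longrightarrow> M \<subseteq> J \<Longrightarrow> 1 \<notin> J \<Longrightarrow> J = M"
proof -
  let ?A = "{J. poly_ideal J \<and> I \<subseteq> J \<and> 1 \<notin> J}"
  have "\<exists>M\<in>?A. \<forall>J\<in>?A. M \<subseteq> J \<longrightarrow> J = M"
  proof (rule subset_Zorn_nonempty)
    show "?A \<noteq> {}" using I by blast
  next
    fix \<C> assume ne: "\<C> \<noteq> {}" and ch: "subset.chain ?A \<C>"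
    have sub: "\<C> \<subseteq> ?A" and tot: "\<And>X Y. X \<in> \<C> \<Longrightarrow> Y \<in> \<C> \<Longrightarrow> X \<subseteq> Y \<or> Y \<subseteq> X"
      using ch by (auto simp: subset_chain_def)
    have "x + y \<in> \<Union>\<C>" if xy: "x \<in> \<Union>\<C>" "y \<in> \<Union>\<C>" for x y
    proof -
      obtain X Y where XY: "X \<in> \<C>" "Y \<in> \<C>" "x \<in> X" "y \<in> Y" using xy by blast
      obtain W where "W \<in> \<C>" "x \<in> W" "y \<in> W" using tot[OF XY(1,2)] XY by blast
      then show ?thesis using sub unfolding poly_ideal_def by blast
    qed
    moreover have "r * x \<in> \<Union>\<C>" if "x \<in> \<Union>\<C>" for r x
      using that sub unfolding poly_ideal_def by blast
    moreover have "0 \<in> \<Union>\<C>" "I \<subseteq> \<Union>\<C>" "1 \<notin> \<Union>\<C>"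
      using ne sub unfolding poly_ideal_def by blast+
    ultimately show "\<Union>\<C> \<in> ?A" unfolding poly_ideal_def by blast
  qed
  then obtain M where M: "M \<in> ?A" "\<forall>J\<in>?A. M \<subseteq> J \<longrightarrow> J = M" by (rule bexE)
  show thesis
  proof (rule that[of M])
    fix J assume J: "poly_ideal J" "M \<subseteq> J" "1 \<notin> J"
    then have "J \<in> ?A" using M(1) by auto
    then show "J = M" using M(2) J(2) by blast
  qed (use M(1) in auto)
qed

lemma binomial_prime_exponent:
  fixes x y :: "'a :: comm_ring_1"
  assumes "prime p"
  shows "\<exists>h. (x + y) ^ p = x ^ p + y ^ p + of_nat p * h"
proof -
  have p: "p > 1" using assms by (rule prime_gt_1_nat)
  define h where "h = (\<Sum>k\<in>{1..<p}. of_nat ((p choose k) div p) * x ^ k * y ^ (p - k))"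
  have "(x + y) ^ p = (\<Sum>k\<le>p. of_nat (p choose k) * x ^ k * y ^ (p - k))" by (rule binomial_ring)
  also have "{..p} = insert 0 (insert p {1..<p})" using p by auto
  also have "(\<Sum>k\<in>insert 0 (insert p {1..<p}). of_nat (p choose k) * x ^ k * y ^ (p - k))
    = y ^ p + (x ^ p + (\<Sum>k\<in>{1..<p}. of_nat (p choose k) * x ^ k * y ^ (p - k)))"
    using p by (subst sum.insert; simp)+
  also have "(\<Sum>k\<in>{1..<p}. of_nat (p choose k) * x ^ k * y ^ (p - k)) = of_nat p * h"
    unfolding h_def sum_distrib_left
  proof (rule sum.cong)
    fix k assume "k \<in> {1..<p}"
    then have "p dvd (p choose k)" using assms by (intro dvd_choose_prime) auto
    then have "p choose k = p * ((p choose k) div p)" by simp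
    then have "(of_nat (p choose k) :: 'a) = of_nat p * of_nat ((p choose k) div p)"
      by (metis of_nat_mult)
    then show "(of_nat (p choose k) :: 'a) * x ^ k * y ^ (p - k)
        = of_nat p * (of_nat ((p choose k) div p) * x ^ k * y ^ (p - k))" by (simp add: mult.assoc)
  qed simp
  finally show ?thesis by (intro exI[of _ h]) (simp add: algebra_simps)
qed

text \<open>The functional \<open>f \<mapsto> \<Sum>n. a\<^sup>n (coeff f (q n))\<close>, i.e. the constant coefficient modulo
  \<open>X\<^sup>q - a\<close>, shows that this ideal is proper.\<close>

lemma kummer_ideal_proper:
  fixes p a :: int and q :: nat
  assumes p: "\<not> p dvd 1" and q: "q > 0"
  shows "1 \<noteq> [:p:] * x + (monom 1 q - [:a:]) * y"
proof
  assume eq: "1 = [:p:] * x + (monom 1 q - [:a:]) * y"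
  \<comment> \<open>One more than the degree of \<open>y\<close>, so that
    \<open>coeff y (q * K)\<close> vanishes; this is the boundary term left when the two sums over
    \<open>y\<close> are cancelled against each other.\<close>
  define K where "K = Suc (degree y)"
  have c: "coeff 1 (q * n) = p * coeff x (q * n) + (if n = 0 then 0 else coeff y (q * (n - 1))) - a * coeff y (q * n)" for n
  proof -
    have "coeff 1 (q * n) = coeff ([:p:] * x + (monom 1 q - [:a:]) * y) (q * n)" using eq by simp
    also have "\<dots> = p * coeff x (q * n) + coeff (monom 1 q * y) (q * n) - a * coeff y (q * n)"
      by (simp add: left_diff_distrib)
    also have "coeff (monom 1 q * y) (q * n) = (if n = 0 then 0 else coeff y (q * (n - 1)))"
      using q by (cases n) (simp_all add: coeff_monom_mult)
    finally show ?thesis .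
  qed
  let ?y = "\<lambda>n. a ^ n * coeff y (q * n)"
  have "(\<Sum>n\<le>K. a ^ n * coeff 1 (q * n)) = (\<Sum>n\<le>K. if n = 0 then 1 else 0)"
    using q by (intro sum.cong) auto
  also have "\<dots> = (1::int)" by (simp add: sum.delta)
  finally have "1 = (\<Sum>n\<le>K. a ^ n * coeff 1 (q * n))" by simp
  also have "\<dots> = (\<Sum>n\<le>K. p * (a ^ n * coeff x (q * n)) + (if n = 0 then 0 else a * ?y (n - 1)) - a * ?y n)"
  proof (rule sum.cong)
    fix n show "a ^ n * coeff 1 (q * n) = p * (a ^ n * coeff x (q * n)) + (if n = 0 then 0 else a * ?y (n - 1)) - a * ?y n"
      unfolding c by (cases n) (simp_all add: algebra_simps)
  qed simp
  also have "\<dots> = p * (\<Sum>n\<le>K. a ^ n * coeff x (q * n)) + (\<Sum>n\<le>K. if n = 0 then 0 else a * ?y (n - 1)) - (\<Sum>n\<le>K. a * ?y n)"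
    by (simp add: sum.distrib sum_subtractf sum_distrib_left)
  also have "(\<Sum>n\<le>K. if n = 0 then 0 else a * ?y (n - 1)) = (\<Sum>n\<le>degree y. a * ?y n)"
    unfolding K_def by (subst sum.atMost_Suc_shift) simp
  also have "(\<Sum>n\<le>K. a * ?y n) = (\<Sum>n\<le>degree y. a * ?y n)"
  proof -
    have "1 * K \<le> q * K" using q by (intro mult_le_mono1) simp
    moreover have "degree y < K" by (simp add: K_def)
    ultimately have "degree y < q * K" by linarith
    then have "coeff y (q * K) = 0" by (rule coeff_eq_0)
    then show ?thesis by (simp add: K_def)
  qed
  finally have "1 = p * (\<Sum>n\<le>K. a ^ n * coeff x (q * n))" by simp
  then have "p dvd 1" by (rule dvdI)
  then show False using p by simp
qed

text \<open>\<open>a\<close> is a primitive root modulo \<open>p\<close>, and \<open>M\<close> is a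
  maximal ideal containing \<open>p\<close> and \<open>X^q - a\<close>. The size of the quotient
  comes from \<open>spanning\<close> and \<open>independent\<close>, which take the place of
  irreducibility of \<open>X^q - a\<close> over the prime field; the condition
  \<open>q dvd p - 1\<close> makes the \<open>q\<close>-th roots of unity available there.\<close>

locale kummer_quotient =
  fixes p q :: nat and a :: int and M :: "int poly set"
  assumes prime_p: "prime p" and prime_q: "prime q" and q_dvd: "q dvd p - 1"
    and a: "\<And>k::nat. [a ^ k = 1] (mod int p) \<longleftrightarrow> p - 1 dvd k"
    and M: "poly_ideal M" "1 \<notin> M" and max: "\<And>J. poly_ideal J \<Longrightarrow> M \<subseteq> J \<Longrightarrow> 1 \<notin> J \<Longrightarrow> J = M"
    and pM: "[:int p:] \<in> M" and XM: "monom 1 q - [:a:] \<in> M"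
begin

definition eqM :: "int poly \<Rightarrow> int poly \<Rightarrow> bool" where "eqM f g \<longleftrightarrow> f - g \<in> M"

lemma M_add: "x \<in> M \<Longrightarrow> y \<in> M \<Longrightarrow> x + y \<in> M" and M_mult: "x \<in> M \<Longrightarrow> r * x \<in> M"
  and M_zero: "0 \<in> M"
  using M(1) by (auto simp: poly_ideal_def)

lemma M_neg: "x \<in> M \<Longrightarrow> - x \<in> M"
  using M_mult[of x "- 1"] by simp

lemma eqM_refl [simp]: "eqM f f"
  by (simp add: eqM_def M_zero)

lemma eqM_sym: "eqM f g \<Longrightarrow> eqM g f"
  using M_neg[of "f - g"] by (simp add: eqM_def)

lemma eqM_trans [trans]: "eqM f g \<Longrightarrow> eqM g h \<Longrightarrow> eqM f h"
  using M_add[of "f - g" "g - h"] by (simp add: eqM_def)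

lemma eqM_add: "eqM f g \<Longrightarrow> eqM f' g' \<Longrightarrow> eqM (f + f') (g + g')"
  using M_add[of "f - g" "f' - g'"] by (simp add: eqM_def algebra_simps)

lemma eqM_mult: "eqM f g \<Longrightarrow> eqM f' g' \<Longrightarrow> eqM (f * f') (g * g')"
  using M_add[OF M_mult[of "f - g" f'] M_mult[of "f' - g'" g]] by (simp add: eqM_def algebra_simps)

lemma eqM_pow: "eqM f g \<Longrightarrow> eqM (f ^ n) (g ^ n)"
  by (induction n) (auto intro: eqM_mult)

lemma eqM_sum: "(\<And>i. i \<in> I \<Longrightarrow> eqM (f i) (g i)) \<Longrightarrow> eqM (sum f I) (sum g I)"
  by (induction I rule: infinite_finite_induct) (auto intro: eqM_add)

lemma eqM_const: "[c = d] (mod int p) \<Longrightarrow> eqM [:c:] [:d:]"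
proof -
  assume "[c = d] (mod int p)"
  then obtain k where k: "c - d = int p * k" by (metis cong_iff_dvd_diff dvdE)
  have "[:c:] - [:d:] = [:k:] * [:int p:]" using k by (simp add: mult.commute)
  then show ?thesis unfolding eqM_def using M_mult[OF pM, of "[:k:]"] by simp
qed

lemma M_const: "[:c:] \<in> M \<longleftrightarrow> int p dvd c"
proof
  assume c: "[:c:] \<in> M"
  show "int p dvd c"
  proof (rule ccontr)
    assume "\<not> int p dvd c"
    then have "coprime (int p) c" using prime_p by (simp add: prime_imp_coprime)
    then obtain u v where "u * int p + v * c = 1" using bezout_int[of "int p" c] by (auto simp: coprime_iff_gcd_eq_1)
    then have "[:u:] * [:int p:] + [:v:] * [:c:] = 1" by (simp add: one_pCons mult.commute)
    then show False using M_add[OF M_mult[OF pM] M_mult[OF c]] M(2) by metis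
  qed
next
  assume "int p dvd c"
  then obtain k where "c = int p * k" by (rule dvdE)
  then have "[:c:] = [:k:] * [:int p:]" by (simp add: mult.commute)
  then show "[:c:] \<in> M" using M_mult[OF pM, of "[:k:]"] by simp
qed

lemma p1: "p > 1" and q1: "q > 1"
  using prime_p prime_q by (simp_all only: prime_gt_1_nat)

lemma eqM_frob: "eqM ((f + g) ^ p) (f ^ p + g ^ p)"
proof -
  obtain h where h: "(f + g) ^ p = f ^ p + g ^ p + of_nat p * h"
    using binomial_prime_exponent[OF prime_p] by blast
  have "of_nat p * h = h * [:int p:]" by (simp add: of_nat_poly mult.commute)
  then show ?thesis unfolding eqM_def h using M_mult[OF pM, of h] by simp
qed

lemma eqM_frob_sum: "finite I \<Longrightarrow> eqM ((\<Sum>i\<in>I. f i) ^ p) (\<Sum>i\<in>I. f i ^ p)"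
proof (induction I rule: finite_induct)
  case empty
  then show ?case using p1 by (simp add: zero_power)
next
  case (insert i I)
  have "eqM ((f i + sum f I) ^ p) (f i ^ p + sum f I ^ p)" by (rule eqM_frob)
  also have "eqM \<dots> (f i ^ p + (\<Sum>i\<in>I. f i ^ p))" by (intro eqM_add eqM_refl insert.IH)
  finally show ?case using insert by simp
qed

definition X :: "int poly" where "X = monom 1 1"
text \<open>A primitive \<open>q\<close>-th root of unity modulo \<open>p\<close>: the eigenvalue of
  \<open>X\<close> under Frobenius, by \<open>X_p\<close>.\<close>

definition w :: int where "w = a ^ ((p - 1) div q)"

lemma X_q: "eqM (X ^ q) [:a:]"
  using XM by (simp add: eqM_def X_def monom_power)

lemma X_p: "eqM (X ^ p) ([:w:] * X)"
proof -
  have "p = q * ((p - 1) div q) + 1" using q_dvd p1 by simp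
  then have "X ^ p = (X ^ q) ^ ((p - 1) div q) * X" by (metis Suc_eq_plus1 power_Suc2 power_mult)
  also have "eqM \<dots> ([:a:] ^ ((p - 1) div q) * X)" by (intro eqM_mult eqM_pow X_q eqM_refl)
  also have "[:a:] ^ ((p - 1) div q) = [:w:]" by (simp add: w_def poly_const_pow)
  finally show ?thesis .
qed

lemma w_pow: "[w ^ k = 1] (mod int p) \<longleftrightarrow> q dvd k"
proof -
  obtain t where t: "p - 1 = q * t" using q_dvd by (rule dvdE)
  have t0: "t > 0" using t p1 by (cases t) auto
  have "(p - 1) div q = t" using t q1 by simp
  then have "[w ^ k = 1] (mod int p) \<longleftrightarrow> p - 1 dvd t * k"
    using a[of "t * k"] by (simp add: w_def power_mult)
  also have "\<dots> \<longleftrightarrow> q dvd k" unfolding t using t0 by simp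
  finally show ?thesis .
qed

lemma fermat: "[c ^ p = c] (mod int p)"
proof (cases "int p dvd c")
  case True
  moreover have "c dvd c ^ p" using p1 by (intro dvd_power) simp
  ultimately have "int p dvd c ^ p" by (rule dvd_trans)
  then show ?thesis using True by (simp add: cong_def dvd_eq_mod_eq_0)
next
  case False
  have "c ^ p - c = c * (c ^ (p - 1) - 1)" using p1 by (simp add: algebra_simps flip: power_Suc)
  moreover have "[c ^ (p - 1) = 1] (mod int p)"
  proof -
    define n where "n = nat (c mod int p)"
    have n: "int n = c mod int p" using p1 by (simp add: n_def)
    have "\<not> p dvd n" using False n by (metis dvd_mod_iff dvd_refl int_dvd_int_iff)
    then have "[n ^ (p - 1) = 1] (mod p)" using prime_p by (intro fermat_theorem)
    then have "[int n ^ (p - 1) = 1] (mod int p)" by (metis cong_int_iff of_nat_1 of_nat_power)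
    moreover have "[c = int n] (mod int p)" unfolding n by (simp add: cong_def)
    ultimately show ?thesis by (meson cong_pow cong_trans)
  qed
  ultimately show ?thesis by (metis cong_iff_dvd_diff dvd_mult)
qed

lemma geometric_w: "[(\<Sum>k<q. w ^ (k * j)) = (if q dvd j then int q else 0)] (mod int p)"
proof (cases "q dvd j")
  case True
  have "[(\<Sum>k<q. w ^ (k * j)) = (\<Sum>k<q. 1)] (mod int p)"
    using True by (intro cong_sum) (simp add: w_pow)
  then show ?thesis using True by simp
next
  case False
  let ?S = "\<Sum>k<q. (w ^ j) ^ k"
  have "(w ^ j - 1) * ?S = (w ^ j) ^ q - 1" by (simp add: power_diff_1_eq)
  moreover have "[(w ^ j) ^ q = 1] (mod int p)" using w_pow[of "j * q"] by (simp add: power_mult)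
  ultimately have "int p dvd (w ^ j - 1) * ?S" by (simp add: cong_iff_dvd_diff)
  moreover have "\<not> int p dvd w ^ j - 1" using False w_pow[of j] by (simp add: cong_iff_dvd_diff)
  ultimately have "int p dvd ?S" using prime_p by (simp add: prime_dvd_mult_iff)
  moreover have "?S = (\<Sum>k<q. w ^ (k * j))" by (simp add: power_mult mult.commute flip: power_mult)
  ultimately show ?thesis using False by (simp add: cong_0_iff)
qed

text \<open>The powers of \<open>X\<close> are eigenvectors of the Frobenius map with distinct eigenvalues, hence
  linearly independent.\<close>

lemma independent:
  assumes "(\<Sum>j<q. [:c j:] * X ^ j) \<in> M" "i < q"
  shows "int p dvd c i"
proof -
  \<comment> \<open>The Frobenius map fixes constants and multiplies \<open>X ^ j\<close> by
    \<open>w ^ j\<close>; applying it \<open>k\<close> times to the given relation yields this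
    one.\<close>
  have step: "(\<Sum>j<q. [:c j * w ^ (k * j):] * X ^ j) \<in> M" for k
  proof (induction k)
    case 0
    then show ?case using assms(1) by simp
  next
    case (Suc k)
    let ?d = "\<lambda>j. c j * w ^ (k * j)"
    have "eqM (\<Sum>j<q. [:?d j:] * X ^ j) 0" using Suc by (simp add: eqM_def)
    then have "eqM ((\<Sum>j<q. [:?d j:] * X ^ j) ^ p) (0 ^ p)" by (rule eqM_pow)
    moreover have "(0 :: int poly) ^ p = 0" using p1 by (simp add: zero_power)
    ultimately have "eqM 0 ((\<Sum>j<q. [:?d j:] * X ^ j) ^ p)" by (simp only: eqM_sym)
    also have "eqM \<dots> (\<Sum>j<q. ([:?d j:] * X ^ j) ^ p)" by (rule eqM_frob_sum) simp
    also have "eqM \<dots> (\<Sum>j<q. [:c j * w ^ (Suc k * j):] * X ^ j)"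
    proof (rule eqM_sum)
      fix j
      have "([:?d j:] * X ^ j) ^ p = [:?d j ^ p:] * (X ^ p) ^ j"
        by (simp only: power_mult_distrib poly_const_pow power_mult[symmetric] mult.commute[of j p])
      also have "eqM \<dots> ([:?d j:] * ([:w:] * X) ^ j)"
        by (intro eqM_mult eqM_const fermat eqM_pow X_p)
      also have "[:?d j:] * ([:w:] * X) ^ j = [:c j * w ^ (Suc k * j):] * X ^ j"
        by (simp add: smult_power power_add mult_ac)
      finally show "eqM (([:?d j:] * X ^ j) ^ p) ([:c j * w ^ (Suc k * j):] * X ^ j)" .
    qed
    finally show ?case using eqM_sym[of 0] by (simp add: eqM_def)
  qed
  \<comment> \<open>Discrete Fourier inversion, isolating the index \<open>i\<close>;
    \<open>q - i\<close> replaces \<open>- i\<close> to keep the exponents natural.\<close>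
  have "(\<Sum>k<q. [:w ^ (k * (q - i)):] * (\<Sum>j<q. [:c j * w ^ (k * j):] * X ^ j)) \<in> M"
  proof -
    have "eqM (\<Sum>k<q. [:w ^ (k * (q - i)):] * (\<Sum>j<q. [:c j * w ^ (k * j):] * X ^ j)) (\<Sum>k<q. 0)"
      by (rule eqM_sum) (unfold eqM_def diff_zero, rule M_mult, rule step)
    then show ?thesis by (simp add: eqM_def)
  qed
  also have "(\<Sum>k<q. [:w ^ (k * (q - i)):] * (\<Sum>j<q. [:c j * w ^ (k * j):] * X ^ j))
    = (\<Sum>j<q. [:c j * (\<Sum>k<q. w ^ (k * (q - i + j))):] * X ^ j)"
  proof -
    have "(\<Sum>k<q. [:w ^ (k * (q - i)):] * (\<Sum>j<q. [:c j * w ^ (k * j):] * X ^ j))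
      = (\<Sum>j<q. \<Sum>k<q. [:c j * w ^ (k * (q - i + j)):] * X ^ j)"
      unfolding sum_distrib_left
      by (subst sum.swap) (intro sum.cong refl, simp add: power_add distrib_left mult_ac)
    also have "\<dots> = (\<Sum>j<q. [:c j * (\<Sum>k<q. w ^ (k * (q - i + j))):] * X ^ j)"
    proof (rule sum.cong)
      fix j
      have "[:c j * (\<Sum>k<q. w ^ (k * (q - i + j))):] = (\<Sum>k<q. [:c j * w ^ (k * (q - i + j)):])"
        unfolding sum_distrib_left by (rule poly_eqI) (simp add: coeff_pCons coeff_sum split: nat.split)
      then show "(\<Sum>k<q. [:c j * w ^ (k * (q - i + j)):] * X ^ j) = [:c j * (\<Sum>k<q. w ^ (k * (q - i + j))):] * X ^ j"
        by (simp only: sum_distrib_right)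
    qed simp
    finally show ?thesis .
  qed
  finally have "eqM (\<Sum>j<q. [:c j * (\<Sum>k<q. w ^ (k * (q - i + j))):] * X ^ j) 0"
    by (unfold eqM_def diff_zero)
  then have "eqM 0 (\<Sum>j<q. [:c j * (\<Sum>k<q. w ^ (k * (q - i + j))):] * X ^ j)" by (rule eqM_sym)
  also have "eqM \<dots> (\<Sum>j<q. if j = i then [:c i * int q:] * X ^ i else 0)"
  proof (rule eqM_sum)
    fix j assume "j \<in> {..<q}"
    then have j: "j < q" by simp
    have dvd: "q dvd q - i + j \<longleftrightarrow> j = i"
    proof
      assume d: "q dvd q - i + j"
      then obtain t where t: "q - i + j = q * t" by (rule dvdE)
      have "q - i + j < q * 2" "0 < q - i + j" using j assms(2) by auto
      then have "q * t < q * 2" "0 < q * t" using t by auto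
      then have "t = 1" by simp
      then show "j = i" using t assms(2) by auto
    qed (use assms(2) in simp)
    have "[c j * (\<Sum>k<q. w ^ (k * (q - i + j))) = c j * (if q dvd q - i + j then int q else 0)] (mod int p)"
      by (rule cong_mult[OF cong_refl geometric_w])
    then have "eqM ([:c j * (\<Sum>k<q. w ^ (k * (q - i + j))):] * X ^ j)
        ([:c j * (if q dvd q - i + j then int q else 0):] * X ^ j)"
      by (intro eqM_mult eqM_const eqM_refl)
    then show "eqM ([:c j * (\<Sum>k<q. w ^ (k * (q - i + j))):] * X ^ j)
        (if j = i then [:c i * int q:] * X ^ i else 0)"
      unfolding dvd by (cases "j = i") simp_all
  qed
  also have "(\<Sum>j<q. if j = i then [:c i * int q:] * X ^ i else 0) = [:c i * int q:] * X ^ i"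
    using assms(2) by (simp add: sum.delta)
  \<comment> \<open>Multiplying by \<open>X ^ (q - i)\<close> turns the surviving term into the
    constant \<open>c i * q * a\<close>, to which \<open>M_const\<close> applies.\<close>
  finally have "eqM (0 * X ^ (q - i)) ([:c i * int q:] * X ^ i * X ^ (q - i))"
    by (intro eqM_mult eqM_refl)
  also have "[:c i * int q:] * X ^ i * X ^ (q - i) = [:c i * int q:] * X ^ q"
    using assms(2) by (simp add: mult.assoc flip: power_add)
  also have "eqM \<dots> ([:c i * int q:] * [:a:])" by (intro eqM_mult eqM_refl X_q)
  finally have "eqM 0 [:c i * int q * a:]" by (simp add: mult.commute)
  from eqM_sym[OF this] have "[:c i * int q * a:] \<in> M" by (unfold eqM_def diff_zero)
  then have "int p dvd c i * int q * a" by (simp only: M_const)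
  moreover have "\<not> int p dvd int q"
    using q_dvd p1 q1 by (auto dest!: dvd_imp_le)
  moreover have "\<not> int p dvd a"
  proof
    assume "int p dvd a"
    moreover have "a dvd a ^ (p - 1)" using p1 by (intro dvd_power) simp
    ultimately have "int p dvd a ^ (p - 1)" by (rule dvd_trans)
    then have "[a ^ (p - 1) = 0] (mod int p)" by (simp only: cong_0_iff)
    moreover have "[a ^ (p - 1) = 1] (mod int p)" using a by simp
    ultimately have "[0 = 1] (mod int p)" by (meson cong_sym cong_trans)
    then show False using p1 by (auto simp: cong_def)
  qed
  ultimately show ?thesis using prime_p by (simp add: prime_dvd_mult_iff)
qed

lemma spanning: "\<exists>c. (\<forall>j<q. 0 \<le> c j \<and> c j < int p) \<and> eqM f (\<Sum>j<q. [:c j:] * X ^ j)"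
proof -
  have "\<exists>c. eqM f (\<Sum>j<q. [:c j:] * X ^ j)"
  proof (induction f)
    case 0
    show ?case by (intro exI[of _ "\<lambda>_. 0"]) simp
  next
    case (pCons d f)
    then obtain c where c: "eqM f (\<Sum>j<q. [:c j:] * X ^ j)" by blast
    obtain r where r: "q = Suc r" using q1 by (cases q) auto
    \<comment> \<open>Multiplication by \<open>X\<close> shifts the coefficients; the top one,
      \<open>c r\<close>, meets \<open>X ^ q\<close> and returns to degree zero with the factor
      \<open>a\<close>.\<close>
    define e where "e j = (if j = 0 then d + c r * a else c (j - 1))" for j
    have "pCons d f = [:d:] + X * f" by (simp add: X_def monom_altdef)
    also have "eqM \<dots> ([:d:] + X * (\<Sum>j<q. [:c j:] * X ^ j))" by (intro eqM_add eqM_mult eqM_refl c)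
    also have "[:d:] + X * (\<Sum>j<q. [:c j:] * X ^ j) = [:d:] + (\<Sum>j<r. [:c j:] * X ^ Suc j) + [:c r:] * X ^ q"
      unfolding r by (simp add: sum_distrib_left distrib_left mult_ac)
    also have "eqM \<dots> ([:d:] + (\<Sum>j<r. [:c j:] * X ^ Suc j) + [:c r:] * [:a:])"
      by (intro eqM_add eqM_mult eqM_refl X_q)
    also have "[:d:] + (\<Sum>j<r. [:c j:] * X ^ Suc j) + [:c r:] * [:a:] = (\<Sum>j<q. [:e j:] * X ^ j)"
      unfolding r by (subst sum.lessThan_Suc_shift) (simp add: e_def)
    finally show ?case by blast
  qed
  then obtain c where c: "eqM f (\<Sum>j<q. [:c j:] * X ^ j)" by blast
  have "eqM (\<Sum>j<q. [:c j:] * X ^ j) (\<Sum>j<q. [:c j mod int p:] * X ^ j)"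
    by (intro eqM_sum eqM_mult eqM_const eqM_refl) (simp add: cong_def)
  then have "eqM f (\<Sum>j<q. [:c j mod int p:] * X ^ j)" using c eqM_trans by blast
  then show ?thesis using p1 by (intro exI[of _ "\<lambda>j. c j mod int p"]) simp
qed

section \<open>The quotient field\<close>

definition K where "K = int_poly_ring Quot M"
definition \<pi> where "\<pi> = (+>\<^bsub>int_poly_ring\<^esub>) M"

lemma ideal_M: "ideal M int_poly_ring"
  using M(1) by (simp add: ideal_iff_poly_ideal)

lemma field_K: "field K"
  unfolding K_def
proof (rule maximalideal.quotient_is_field[OF maximalidealI cring_int_poly_ring])
  show "ideal M int_poly_ring" by (rule ideal_M)
  show "carrier int_poly_ring \<noteq> M" using M(2) by auto
next
  fix J assume "ideal J int_poly_ring" "M \<subseteq> J"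
  then have J: "poly_ideal J" "M \<subseteq> J" by (simp_all add: ideal_iff_poly_ideal)
  show "J = M \<or> J = carrier int_poly_ring"
  proof (cases "1 \<in> J")
    case True
    have "r \<in> J" for r
    proof -
      have "r * 1 \<in> J" using J True unfolding poly_ideal_def by blast
      then show ?thesis by simp
    qed
    then show ?thesis by auto
  next
    case False
    then show ?thesis using max J by blast
  qed
qed

lemma \<pi>_hom: "\<pi> \<in> ring_hom int_poly_ring K"
  unfolding \<pi>_def K_def by (rule ideal.rcos_ring_hom[OF ideal_M])

lemma carrier_K: "carrier K = range \<pi>"
  by (auto simp: K_def \<pi>_def FactRing_def A_RCOSETS_def' )

lemma \<pi>_add: "\<pi> (f + g) = \<pi> f \<oplus>\<^bsub>K\<^esub> \<pi> g" and \<pi>_mult: "\<pi> (f * g) = \<pi> f \<otimes>\<^bsub>K\<^esub> \<pi> g"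
  and \<pi>_one: "\<pi> 1 = \<one>\<^bsub>K\<^esub>"
  using ring_hom_add[OF \<pi>_hom, of f g] ring_hom_mult[OF \<pi>_hom, of f g] ring_hom_one[OF \<pi>_hom] by simp_all

lemma \<pi>_pow: "\<pi> (f ^ n) = \<pi> f [^]\<^bsub>K\<^esub> n"
proof -
  interpret field K by (rule field_K)
  show ?thesis by (induction n) (simp_all add: \<pi>_one \<pi>_mult power_Suc2 del: power_Suc)
qed

lemma \<pi>_eq_iff: "\<pi> f = \<pi> g \<longleftrightarrow> eqM f g"
proof -
  interpret ideal M int_poly_ring by (rule ideal_M)
  have neg: "\<ominus>\<^bsub>int_poly_ring\<^esub> g = - g" by (rule minus_equality) simp_all
  have "\<pi> f = \<pi> g \<longleftrightarrow> f \<ominus>\<^bsub>int_poly_ring\<^esub> g \<in> M"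
    unfolding \<pi>_def using quotient_eq_iff_same_a_r_cos[OF ideal_M, of f g] by simp
  then show ?thesis by (simp add: a_minus_def neg eqM_def)
qed

lemma frob_K:
  assumes "x \<in> carrier K" "y \<in> carrier K"
  shows "(x \<oplus>\<^bsub>K\<^esub> y) [^]\<^bsub>K\<^esub> p = x [^]\<^bsub>K\<^esub> p \<oplus>\<^bsub>K\<^esub> y [^]\<^bsub>K\<^esub> p"
proof -
  obtain f g where "x = \<pi> f" "y = \<pi> g" using assms carrier_K by auto
  then show ?thesis using eqM_frob[of f g] by (simp add: \<pi>_eq_iff[symmetric] \<pi>_add \<pi>_pow)
qed

text \<open>Coefficient vectors with entries in \<open>0..<p\<close> represent every class by
  \<open>spanning\<close>; \<open>independent\<close> separates them, since two such entries that
  are congruent modulo \<open>p\<close> are equal.\<close>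

lemma card_K: "finite (carrier K)" "card (carrier K) = p ^ q"
proof -
  let ?S = "{..<q} \<rightarrow>\<^sub>E {0..<int p}"
  let ?h = "\<lambda>c. \<pi> (\<Sum>j<q. [:c j:] * X ^ j)"
  have "carrier K \<subseteq> ?h ` ?S"
  proof
    fix x assume "x \<in> carrier K"
    then obtain f where x: "x = \<pi> f" using carrier_K by auto
    obtain c where c: "\<forall>j<q. 0 \<le> c j \<and> c j < int p" "eqM f (\<Sum>j<q. [:c j:] * X ^ j)"
      using spanning by blast
    have "x = ?h c" unfolding x using c(2) by (simp only: \<pi>_eq_iff)
    also have "\<dots> = ?h (restrict c {..<q})" by (intro arg_cong[of _ _ \<pi>] sum.cong) auto
    finally show "x \<in> ?h ` ?S" using c(1) by (intro image_eqI[of _ _ "restrict c {..<q}"]) auto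
  qed
  moreover have "?h ` ?S \<subseteq> carrier K" using carrier_K by auto
  ultimately have im: "carrier K = ?h ` ?S" by blast
  have "inj_on ?h ?S"
  proof (rule inj_onI)
    fix c d assume c: "c \<in> ?S" and d: "d \<in> ?S" and "?h c = ?h d"
    then have "(\<Sum>j<q. [:c j:] * X ^ j) - (\<Sum>j<q. [:d j:] * X ^ j) \<in> M" by (simp add: \<pi>_eq_iff eqM_def)
    also have "(\<Sum>j<q. [:c j:] * X ^ j) - (\<Sum>j<q. [:d j:] * X ^ j) = (\<Sum>j<q. [:c j - d j:] * X ^ j)"
      unfolding sum_subtractf[symmetric] by (rule sum.cong) (simp_all add: smult_diff_left)
    finally have mem: "(\<Sum>j<q. [:c j - d j:] * X ^ j) \<in> M" .
    have "c j = d j" if j: "j < q" for j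
    proof -
      have "int p dvd c j - d j" using independent[OF mem j] .
      then have "c j mod int p = d j mod int p" by (simp only: mod_eq_dvd_iff)
      moreover have "c j \<in> {0..<int p}" by (rule PiE_mem[OF c]) (simp add: j)
      moreover have "d j \<in> {0..<int p}" by (rule PiE_mem[OF d]) (simp add: j)
      ultimately show ?thesis by simp
    qed
    then show "c = d" by (intro PiE_ext[OF c d]) simp
  qed
  then have "card (carrier K) = card ?S" unfolding im by (rule card_image)
  also have "\<dots> = p ^ q" by (simp add: card_PiE)
  finally show "card (carrier K) = p ^ q" .
  show "finite (carrier K)" unfolding im by (intro finite_imageI finite_PiE) auto
qed

end

lemma kummer_quotient_exists:
  assumes "prime p" "prime q" "q dvd p - 1"
  shows "\<exists>a M. kummer_quotient p q a M"
proof -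
  have p1: "p > 1" and q1: "q > 1" using assms by (simp_all only: prime_gt_1_nat)
  obtain g where g: "residue_primroot p g" using prime_primitive_root_exists[OF p1 assms(1)] by blast
  let ?a = "int g"
  have a: "[?a ^ k = 1] (mod int p) \<longleftrightarrow> p - 1 dvd k" for k :: nat
  proof -
    have "[?a ^ k = 1] (mod int p) \<longleftrightarrow> [g ^ k = 1] (mod p)"
      by (metis cong_int_iff of_nat_1 of_nat_power)
    also have "\<dots> \<longleftrightarrow> ord p g dvd k" by (rule ord_divides)
    also have "ord p g = p - 1" using g assms(1) by (simp add: residue_primroot_def totient_prime)
    finally show ?thesis .
  qed
  let ?I = "{[:int p:] * x + (monom 1 q - [:?a:]) * y | x y. True}"
  have "poly_ideal ?I"
    unfolding poly_ideal_def
  proof (intro conjI ballI allI)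
    show "0 \<in> ?I" by (intro CollectI exI[of _ 0]) simp
  next
    fix f g assume "f \<in> ?I" "g \<in> ?I"
    then obtain x y x' y' where "f = [:int p:] * x + (monom 1 q - [:?a:]) * y"
      "g = [:int p:] * x' + (monom 1 q - [:?a:]) * y'" by blast
    then have "f + g = [:int p:] * (x + x') + (monom 1 q - [:?a:]) * (y + y')" by (simp add: algebra_simps smult_add_right)
    then show "f + g \<in> ?I" by blast
  next
    fix f r assume "f \<in> ?I"
    then obtain x y where "f = [:int p:] * x + (monom 1 q - [:?a:]) * y" by blast
    then have "r * f = [:int p:] * (r * x) + (monom 1 q - [:?a:]) * (r * y)" by (simp only: distrib_left mult.left_commute)
    then show "r * f \<in> ?I" by blast
  qed
  moreover have "1 \<notin> ?I"
    using kummer_ideal_proper[of "int p" q _ ?a] p1 q1 by auto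
  ultimately obtain M where M: "poly_ideal M" "?I \<subseteq> M" "1 \<notin> M"
    "\<And>J. poly_ideal J \<Longrightarrow> M \<subseteq> J \<Longrightarrow> 1 \<notin> J \<Longrightarrow> J = M"
    by (rule maximal_ideal_exists) blast
  have "[:int p:] * 1 + (monom 1 q - [:?a:]) * 0 \<in> ?I" "[:int p:] * 0 + (monom 1 q - [:?a:]) * 1 \<in> ?I" by blast+
  then have "[:int p:] \<in> M" "monom 1 q - [:?a:] \<in> M" using M(2) by auto
  then have "kummer_quotient p q ?a M" using assms a M by unfold_locales auto
  then show ?thesis by blast
qed

lemma nearfield_exists:
  assumes "prime p" "prime q" "odd q" "q dvd p - 1"
  shows "\<exists>(K :: int poly set ring) \<gamma>. nearfield K p q \<gamma>"
proof -
  obtain a M where "kummer_quotient p q a M" using kummer_quotient_exists[OF assms(1,2,4)] by blast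
  then interpret kummer_quotient p q a M .
  interpret field K by (rule field_K)
  obtain \<gamma> where \<gamma>: "\<gamma> \<in> carrier (mult_of K)"
    "carrier (mult_of K) = {\<gamma> [^]\<^bsub>K\<^esub> i | i :: nat. i \<in> UNIV}"
    using finite_field_mult_group_has_gen[OF card_K(1)] by blast
  have "nearfield K p q \<gamma>"
  proof (intro nearfield.intro nearfield_axioms.intro field_K card_K assms frob_K)
    fix x assume "x \<in> carrier K" "x \<noteq> \<zero>\<^bsub>K\<^esub>"
    then have "x \<in> carrier (mult_of K)" by simp
    then show "\<exists>k::nat. x = \<gamma> [^]\<^bsub>K\<^esub> k" unfolding \<gamma>(2) by blast
  qed (use \<gamma>(1) in simp_all)
  then show ?thesis by blast
qed

theorem theorem3p3:
  fixes p q :: nat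
  assumes "prime p" and "prime q" and "odd q" and "q dvd p - 1"
  shows "\<exists>G :: nat monoid. group G \<and> finite (carrier G) \<and> solvable G \<and>
           derived_length G = 4 \<and> fitting_height G = 3 \<and>
           char_degrees G = {1, q, pprime_part q (p ^ q - 1) * ppart q (p - 1) * q, p ^ q * q}"
proof -
  obtain K :: "int poly set ring" and \<gamma> where "nearfield K p q \<gamma>"
    using nearfield_exists[OF assms] by blast
  then interpret nf: nearfield K p q \<gamma> .
  have "nf.Z \<subseteq> carrier K" using nf.Z_carrier by blast
  then have "finite nf.Z" using nf.fin by (rule finite_subset)
  then have "finite (carrier K \<times> carrier K \<times> nf.Z \<times> carrier nf.H)"
    using nf.fin by simp
  then obtain enc :: "int poly set \<times> int poly set \<times> int poly set \<times> int poly set \<Rightarrow> nat"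
    where enc: "inj_on enc (carrier K \<times> carrier K \<times> nf.Z \<times> carrier nf.H)"
    using finite_imp_inj_to_nat_seg by blast
  interpret h: heis K nf.H nf.Z nf.A nf.B nf.m "\<lambda>f w. nf.tr (f \<otimes>\<^bsub>K\<^esub> w)" q enc
    by (rule nf.heis_nearfield[OF enc])
  have "card (carrier nf.H) = pprime_part q (p ^ q - 1) * ppart q (p - 1) * q"
    using third_degree_eq[OF assms(2-4) nf.p1] nf.card_H by (simp add: nf.N_def)
  then have "char_degrees h.G = {1, q, pprime_part q (p ^ q - 1) * ppart q (p - 1) * q, p ^ q * q}"
    using h.char_degrees_eq nf.card by simp
  then show ?thesis using h.G.is_group h.fin_G h.group_structure by blast
qed

end
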